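(* Let $b$ be a prime, let $s,d,\alpha\in\mathbb N$ (positive integers), and let $\boldsymbol\ell=(\ell_1,\ldots,\ell_{ds})\in\mathbb N_0^{ds}$. With $K$, $v$, $\boldsymbol r=(r_i)_{i\in v}$, $q(\boldsymbol\ell)$, $\eta(\boldsymbol\ell)$, and $\sigma_{d,\boldsymbol\ell,s}(f)$ as defined in the context, if $f\in\mathcal H_{s,\alpha}$, then $$\sigma_{d,\boldsymbol\ell,s}(f)\le 2^{q(\boldsymbol\ell)}\,b^{|K|}\,\eta(\boldsymbol\ell)\,\|\partial^{\boldsymbol r}f_v\|_{L_2([0,1]^{|v|})}.$$ Consequently, $$\sigma_{d,\boldsymbol\ell,s}(f)\le 2^{s\max(d-\alpha,0)}\,b^{ds}\,\eta(\boldsymbol\ell)\,\|f\|_{\mathcal H_{s,\alpha}}.$$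
   Context: Base-$b$ expansions of points in $[0,1)$ are chosen to be the ones not eventually equal to $b-1$. Walsh functions: for $k=\sum_{r\ge0}\kappa_rb^r\in\mathbb N_0$ and $x=\sum_{r\ge1}x_rb^{-r}\in[0,1)$, $\operatorname{wal}_k(x)=\exp\bigl(\tfrac{2\pi i}{b}\sum_{r\ge1}\kappa_{r-1}x_r\bigr)$; for vectors, $\operatorname{wal}_{\boldsymbol k}(x)=\prod_j\operatorname{wal}_{k_j}(x_j)$. Walsh coefficients: $\widehat f(\boldsymbol h)=\int_{[0,1]^s}f(x)\overline{\operatorname{wal}_{\boldsymbol h}(x)}\,\mathrm dx$, $\boldsymbol h\in\mathbb N_0^s$. Interlacing of frequencies: $\mathcal E_d:\mathbb N_0^{ds}\to\mathbb N_0^s$ is the bijection given, for $k_j=\sum_{a\ge0}\kappa_{j,a}b^a$, by $\mathcal E_d(\boldsymbol k)_i=\sum_{a\ge0}\sum_{r=1}^d\kappa_{(i-1)d+r,a}b^{r-1+ad}$, $1\le i\le s$. Blocks: $B_0=\{0\}$, $B_\ell=\{k\in\mathbb N_0:b^{\ell-1}\le k<b^\ell\}$ for $\ell\ge1$, and $B_{\boldsymbol\ell}=\prod_{j=1}^{ds}B_{\ell_j}$. Put $\sigma_{d,\boldsymbol\ell,s}(f)\ge0$ with $$\sigma_{d,\boldsymbol\ell,s}^2(f)=\sum_{\boldsymbol k\in B_{\boldsymbol\ell}}|\widehat f(\mathcal E_d(\boldsymbol k))|^2.$$ Index sets: $K=\{j:\ell_j>0\}$, $K_i=K\cap\{(i-1)d+1,\ldots,id\}$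 for $1\le i\le s$, $v=\{i:K_i\ne\emptyset\}$, $r_i=\min(\alpha,|K_i|)$ for $i\in v$, $q(\boldsymbol\ell)=\sum_{i\in v}(|K_i|-r_i)$. For $j=(i-1)d+h\in K_i$ with $1\le h\le d$, let $\eta'_j=(b-1)b^{-h-(\ell_j-1)d}$. For each $i\in v$ let $\eta_{i,1}\le\cdots\le\eta_{i,|K_i|}$ be the numbers $\eta'_j$, $j\in K_i$, in nondecreasing order with repetitions retained, and put $\eta(\boldsymbol\ell)=\prod_{i\in v}\prod_{h=1}^{r_i}\eta_{i,h}$ (empty products equal $1$). Sobolev space: for $u\subseteq\{1,\ldots,s\}$ let $f_u(x_u)=\int_{[0,1]^{s-|u|}}f(x)\,\mathrm dx_{-u}$ (integrating out the variables not in $u$), and $I(f)=\int_{[0,1]^s}f(x)\,\mathrm dx$ (so for $v=\emptyset$, $\|\partial^{\boldsymbol r}f_v\|$ means $|I(f)|$). For smooth $f$ on $[0,1]^s$, $$\|f\|_{\mathcal H_{s,\alpha}}^2=|I(f)|^2+\sum_{\emptyset\ne u\subseteq\{1,\ldots,s\}}\ \sum_{\boldsymbol\nu_u\in\{1,\ldots,\alpha\}^u}\int_{[0,1]^{|u|}}|\partial^{\boldsymbol\nu_u}f_u(x_u)|^2\,\mathrm dx_u.$$ $\mathcal H_{s,\alpha}$ is the completion of the smooth functions in this norm; since $\|f\|_{L_2}\le\|f\|_{\mathcal H_{s,\alpha}}$, it is embedded in $L_2([0,1]^s)$, and the derivatives $\partial^{\boldsymbol\nu_u}f_u$ are extended to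 it by continuity (as $L_2$ weak derivatives). *)

theory Defs
  imports "HOL-Analysis.Analysis" "HOL-Computational_Algebra.Primes"
begin

definition nat_digit :: "nat \<Rightarrow> nat \<Rightarrow> nat \<Rightarrow> nat" where
  "nat_digit b k r = k div b ^ r mod b"

text \<open>For \<open>x \<in> [0,1)\<close> and \<open>r \<ge> 1\<close> this is the \<open>r\<close>-th digit after the point in the
  base-\<open>b\<close> expansion that is not eventually equal to \<open>b - 1\<close>; see \<open>real_digit_sums\<close>
  and \<open>real_digit_not_eventually_max\<close>. The value at \<open>x = 1\<close> is irrelevant, since it only matters on a null set.\<close>

definition real_digit :: "nat \<Rightarrow> real \<Rightarrow> nat \<Rightarrow> nat" where
  "real_digit b x r = nat (\<lfloor>x * real b ^ r\<rfloor> mod int b)"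

lemma floor_real_digit_Suc:
  assumes "b \<ge> 2"
  shows "\<lfloor>x * real b ^ Suc n\<rfloor> = int b * \<lfloor>x * real b ^ n\<rfloor> + int (real_digit b x (Suc n))"
proof -
  have "\<lfloor>x * real b ^ n\<rfloor> = \<lfloor>x * real b ^ Suc n / real_of_int (int b)\<rfloor>"
    using assms by (simp add: field_simps)
  also have "\<dots> = \<lfloor>x * real b ^ Suc n\<rfloor> div int b"
    by (simp only: floor_divide_real_eq_div[of "int b"] of_nat_0_le_iff)
  finally have *: "\<lfloor>x * real b ^ n\<rfloor> = \<lfloor>x * real b ^ Suc n\<rfloor> div int b" .
  have "int (real_digit b x (Suc n)) = \<lfloor>x * real b ^ Suc n\<rfloor> mod int b"
    using assms by (simp add: real_digit_def)
  then show ?thesis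
    using * by simp
qed

lemma real_digit_sums:
  assumes "b \<ge> 2" "0 \<le> x" "x < 1"
  shows "(\<lambda>r. real (real_digit b x (Suc r)) / real b ^ Suc r) sums x"
proof -
  have part: "(\<Sum>r<n. real (real_digit b x (Suc r)) / real b ^ Suc r)
      = real_of_int \<lfloor>x * real b ^ n\<rfloor> / real b ^ n" for n
  proof (induction n)
    case 0
    have "\<lfloor>x\<rfloor> = 0" using assms by linarith
    then show ?case by simp
  next
    case (Suc n)
    have "real_of_int \<lfloor>x * real b ^ Suc n\<rfloor>
        = real b * real_of_int \<lfloor>x * real b ^ n\<rfloor> + real (real_digit b x (Suc n))"
      by (simp only: floor_real_digit_Suc[OF assms(1)]) simp
    then show ?case
      using Suc assms by (simp only: sum.lessThan_Suc) (simp add: field_simps)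
  qed
  have lo: "x - (1 / real b) ^ n \<le> real_of_int \<lfloor>x * real b ^ n\<rfloor> / real b ^ n" for n
  proof -
    have "x * real b ^ n - 1 \<le> real_of_int \<lfloor>x * real b ^ n\<rfloor>" by linarith
    then have "(x * real b ^ n - 1) / real b ^ n \<le> real_of_int \<lfloor>x * real b ^ n\<rfloor> / real b ^ n"
      using assms by (intro divide_right_mono) auto
    then show ?thesis using assms by (simp add: diff_divide_distrib power_one_over)
  qed
  have hi: "real_of_int \<lfloor>x * real b ^ n\<rfloor> / real b ^ n \<le> x" for n
    using assms by (simp add: field_simps)
  have "(\<lambda>n. (1 / real b) ^ n) \<longlonglongrightarrow> 0"
    using assms by (intro LIMSEQ_power_zero) auto
  then have lim: "(\<lambda>n. x - (1 / real b) ^ n) \<longlonglongrightarrow> x"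
    using tendsto_diff[OF tendsto_const[of x], of "\<lambda>n. (1 / real b) ^ n" 0] by simp
  have "(\<lambda>n. real_of_int \<lfloor>x * real b ^ n\<rfloor> / real b ^ n) \<longlonglongrightarrow> x"
    by (rule tendsto_sandwich[OF _ _ lim tendsto_const]) (simp_all only: lo hi eventually_True)
  then show ?thesis
    unfolding sums_def part .
qed

lemma real_digit_not_eventually_max:
  assumes "b \<ge> 2"
  shows "\<not> (\<forall>\<^sub>F r in sequentially. real_digit b x r = b - 1)"
proof
  assume "\<forall>\<^sub>F r in sequentially. real_digit b x r = b - 1"
  then obtain n where n: "\<And>r. r \<ge> n \<Longrightarrow> real_digit b x r = b - 1"
    by (auto simp: eventually_sequentially)
  have b: "int (b - 1) = int b - 1" using assms by simp
  have F: "\<lfloor>x * real b ^ (n + m)\<rfloor> + 1 = int b ^ m * (\<lfloor>x * real b ^ n\<rfloor> + 1)" for m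
  proof (induction m)
    case (Suc m)
    have "\<lfloor>x * real b ^ (n + Suc m)\<rfloor> + 1 = int b * (\<lfloor>x * real b ^ (n + m)\<rfloor> + 1)"
      using floor_real_digit_Suc[OF assms, of x "n + m"] n[of "Suc (n + m)"] b
      by (simp add: algebra_simps)
    then show ?case using Suc by simp
  qed simp
  define e where "e = real_of_int (\<lfloor>x * real b ^ n\<rfloor> + 1) - x * real b ^ n"
  have e: "e > 0" unfolding e_def by linarith
  have le: "real b ^ m * e \<le> 1" for m
  proof -
    have "real_of_int (\<lfloor>x * real b ^ (n + m)\<rfloor> + 1)
        = real b ^ m * real_of_int (\<lfloor>x * real b ^ n\<rfloor> + 1)"
      by (simp only: F) simp
    moreover have "real_of_int (\<lfloor>x * real b ^ (n + m)\<rfloor> + 1) \<le> x * real b ^ (n + m) + 1"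
      by simp
    ultimately show ?thesis
      unfolding e_def by (simp add: algebra_simps power_add)
  qed
  obtain m where "1 / e < real b ^ m"
    using real_arch_pow[of "real b" "1 / e"] assms by auto
  then show False
    using le[of m] e by (simp add: field_simps)
qed

definition wal :: "nat \<Rightarrow> nat \<Rightarrow> real \<Rightarrow> complex" where
  "wal b k x = exp (2 * of_real pi * \<i> / of_nat b *
     of_real (\<Sum>r. real (nat_digit b k r * real_digit b x (Suc r))))"

definition wal_vec :: "nat \<Rightarrow> nat \<Rightarrow> (nat \<Rightarrow> nat) \<Rightarrow> (nat \<Rightarrow> real) \<Rightarrow> complex" where
  "wal_vec b s h x = (\<Prod>j\<in>{1..s}. wal b (h j) (x j))"

text \<open>For a finite set \<open>u\<close> of coordinates, points of \<open>[0,1]\<^sup>u\<close> are represented by extensional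
  functions on \<open>u\<close>. The product topology of the function space restricted to
  \<open>cube_set u\<close> is the Euclidean topology.\<close>

definition cube_set :: "nat set \<Rightarrow> (nat \<Rightarrow> real) set" where
  "cube_set u = (\<Pi>\<^sub>E j\<in>u. {0..1})"

definition cube :: "nat set \<Rightarrow> (nat \<Rightarrow> real) measure" where
  "cube u = (\<Pi>\<^sub>M j\<in>u. restrict_space lborel {0..1})"

text \<open>Functions are complex-valued; the real-valued Sobolev space embeds isometrically.\<close>

definition square_int :: "nat set \<Rightarrow> ((nat \<Rightarrow> real) \<Rightarrow> complex) \<Rightarrow> bool" where
  "square_int u g \<longleftrightarrow> g \<in> borel_measurable (cube u) \<and> integrable (cube u) (\<lambda>x. (cmod (g x))\<^sup>2)"

definition L2norm :: "nat set \<Rightarrow> ((nat \<Rightarrow> real) \<Rightarrow> complex) \<Rightarrow> real" where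
  "L2norm u g = sqrt (LINT x|cube u. (cmod (g x))\<^sup>2)"

definition cube_integral :: "nat \<Rightarrow> ((nat \<Rightarrow> real) \<Rightarrow> complex) \<Rightarrow> complex" where
  "cube_integral s f = (LINT x|cube {1..s}. f x)"

definition walsh_coeff ::
    "nat \<Rightarrow> nat \<Rightarrow> ((nat \<Rightarrow> real) \<Rightarrow> complex) \<Rightarrow> (nat \<Rightarrow> nat) \<Rightarrow> complex" where
  "walsh_coeff b s f h = (LINT x|cube {1..s}. f x * cnj (wal_vec b s h x))"

text \<open>The sum over \<open>a\<close> has only finitely many nonzero terms.\<close>

definition interlace :: "nat \<Rightarrow> nat \<Rightarrow> (nat \<Rightarrow> nat) \<Rightarrow> nat \<Rightarrow> nat" where
  "interlace b d k i =
     (\<Sum>a. \<Sum>r\<in>{1..d}. nat_digit b (k ((i - 1) * d + r)) a * b ^ (r - 1 + a * d))"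

definition block :: "nat \<Rightarrow> nat \<Rightarrow> nat set" where
  "block b l = (if l = 0 then {0} else {k. b ^ (l - 1) \<le> k \<and> k < b ^ l})"

definition block_vec :: "nat \<Rightarrow> nat \<Rightarrow> (nat \<Rightarrow> nat) \<Rightarrow> (nat \<Rightarrow> nat) set" where
  "block_vec b n l = (\<Pi>\<^sub>E j\<in>{1..n}. block b (l j))"

definition block_sigma ::
    "nat \<Rightarrow> nat \<Rightarrow> (nat \<Rightarrow> nat) \<Rightarrow> nat \<Rightarrow> ((nat \<Rightarrow> real) \<Rightarrow> complex) \<Rightarrow> real" where
  "block_sigma b d l s f =
     sqrt (\<Sum>k\<in>block_vec b (d * s) l. (cmod (walsh_coeff b s f (interlace b d k)))\<^sup>2)"

definition K_all :: "nat \<Rightarrow> nat \<Rightarrow> (nat \<Rightarrow> nat) \<Rightarrow> nat set" where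
  "K_all d s l = {j \<in> {1..d * s}. l j > 0}"

definition K_at :: "nat \<Rightarrow> nat \<Rightarrow> (nat \<Rightarrow> nat) \<Rightarrow> nat \<Rightarrow> nat set" where
  "K_at d s l i = K_all d s l \<inter> {(i - 1) * d + 1..i * d}"

definition v_set :: "nat \<Rightarrow> nat \<Rightarrow> (nat \<Rightarrow> nat) \<Rightarrow> nat set" where
  "v_set d s l = {i \<in> {1..s}. K_at d s l i \<noteq> {}}"

definition r_vec :: "nat \<Rightarrow> nat \<Rightarrow> nat \<Rightarrow> (nat \<Rightarrow> nat) \<Rightarrow> nat \<Rightarrow> nat" where
  "r_vec \<alpha> d s l = (\<lambda>i\<in>v_set d s l. min \<alpha> (card (K_at d s l i)))"

definition q_exp :: "nat \<Rightarrow> nat \<Rightarrow> nat \<Rightarrow> (nat \<Rightarrow> nat) \<Rightarrow> nat" where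
  "q_exp \<alpha> d s l = (\<Sum>i\<in>v_set d s l. card (K_at d s l i) - r_vec \<alpha> d s l i)"

definition eta_prime :: "nat \<Rightarrow> nat \<Rightarrow> (nat \<Rightarrow> nat) \<Rightarrow> nat \<Rightarrow> nat \<Rightarrow> real" where
  "eta_prime b d l i j = (let h = j - (i - 1) * d in (real b - 1) / real b ^ (h + (l j - 1) * d))"

definition eta_sorted :: "nat \<Rightarrow> nat \<Rightarrow> nat \<Rightarrow> (nat \<Rightarrow> nat) \<Rightarrow> nat \<Rightarrow> real list" where
  "eta_sorted b d s l i = sort (map (eta_prime b d l i) (sorted_list_of_set (K_at d s l i)))"

definition eta_prod :: "nat \<Rightarrow> nat \<Rightarrow> nat \<Rightarrow> nat \<Rightarrow> (nat \<Rightarrow> nat) \<Rightarrow> real" where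
  "eta_prod \<alpha> b d s l =
     (\<Prod>i\<in>v_set d s l. \<Prod>h\<in>{1..r_vec \<alpha> d s l i}. eta_sorted b d s l i ! (h - 1))"

text \<open>Partial derivatives are taken within \<open>[0,1]\<close>, hence one-sided on the faces of the cube.\<close>

definition partial_deriv ::
    "nat \<Rightarrow> ((nat \<Rightarrow> real) \<Rightarrow> complex) \<Rightarrow> (nat \<Rightarrow> real) \<Rightarrow> complex" where
  "partial_deriv i f x = vector_derivative (\<lambda>t. f (x(i := t))) (at (x i) within {0..1})"

definition smooth_on_cube :: "nat \<Rightarrow> ((nat \<Rightarrow> real) \<Rightarrow> complex) \<Rightarrow> bool" where
  "smooth_on_cube s f \<longleftrightarrow>
     (\<forall>is. set is \<subseteq> {1..s} \<longrightarrow>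
        continuous_on (cube_set {1..s}) (foldr partial_deriv is f) \<and>
        (\<forall>i\<in>{1..s}. \<forall>x\<in>cube_set {1..s}.
           (\<lambda>t. foldr partial_deriv is f (x(i := t))) differentiable (at (x i) within {0..1})))"

text \<open>The order of differentiation is immaterial for smooth functions; it is fixed here
  by the order of the coordinates.\<close>

definition mixed_deriv ::
    "nat set \<Rightarrow> (nat \<Rightarrow> nat) \<Rightarrow> ((nat \<Rightarrow> real) \<Rightarrow> complex) \<Rightarrow> (nat \<Rightarrow> real) \<Rightarrow> complex" where
  "mixed_deriv u \<nu> f = foldr (\<lambda>i. partial_deriv i ^^ \<nu> i) (sorted_list_of_set u) f"

definition marginal ::
    "nat \<Rightarrow> nat set \<Rightarrow> ((nat \<Rightarrow> real) \<Rightarrow> complex) \<Rightarrow> (nat \<Rightarrow> real) \<Rightarrow> complex" where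
  "marginal s u f x = (LINT y|cube ({1..s} - u). f (merge u ({1..s} - u) (x, y)))"

text \<open>The norm formula, with \<open>N u \<nu>\<close> in the place of the \<open>L\<^sub>2\<close> norm of
  \<open>\<partial>\<^sup>\<nu> f\<^sub>u\<close> and \<open>c\<close> in the place of \<open>I(f)\<close>.\<close>

definition sobolev_norm_of ::
    "nat \<Rightarrow> nat \<Rightarrow> complex \<Rightarrow> (nat set \<Rightarrow> (nat \<Rightarrow> nat) \<Rightarrow> real) \<Rightarrow> real" where
  "sobolev_norm_of s \<alpha> c N =
     sqrt ((cmod c)\<^sup>2 + (\<Sum>u\<in>Pow {1..s} - {{}}. \<Sum>\<nu>\<in>(\<Pi>\<^sub>E i\<in>u. {1..\<alpha>}). (N u \<nu>)\<^sup>2))"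

definition smooth_norm :: "nat \<Rightarrow> nat \<Rightarrow> ((nat \<Rightarrow> real) \<Rightarrow> complex) \<Rightarrow> real" where
  "smooth_norm s \<alpha> f = sobolev_norm_of s \<alpha> (cube_integral s f)
     (\<lambda>u \<nu>. L2norm u (mixed_deriv u \<nu> (marginal s u f)))"

text \<open>An element of the completion is a Cauchy sequence of smooth functions, up to null
  sequences; it is identified with the \<open>L\<^sub>2\<close> limit of the sequence.\<close>

definition represents ::
    "nat \<Rightarrow> nat \<Rightarrow> (nat \<Rightarrow> (nat \<Rightarrow> real) \<Rightarrow> complex) \<Rightarrow> ((nat \<Rightarrow> real) \<Rightarrow> complex) \<Rightarrow> bool" where
  "represents s \<alpha> F f \<longleftrightarrow>
     (\<forall>n. smooth_on_cube s (F n)) \<and>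
     (\<forall>e>0. \<exists>M. \<forall>m\<ge>M. \<forall>n\<ge>M. smooth_norm s \<alpha> (\<lambda>x. F m x - F n x) < e) \<and>
     (\<lambda>n. L2norm {1..s} (\<lambda>x. F n x - f x)) \<longlonglongrightarrow> 0"

definition sobolev_space :: "nat \<Rightarrow> nat \<Rightarrow> ((nat \<Rightarrow> real) \<Rightarrow> complex) set" where
  "sobolev_space s \<alpha> = {f. square_int {1..s} f \<and> (\<exists>F. represents s \<alpha> F f)}"

text \<open>Extension of \<open>f \<mapsto> \<partial>\<^sup>\<nu> f\<^sub>u\<close> by continuity. The limit exists because the derivatives of
  the approximating sequence are Cauchy in \<open>L\<^sub>2\<close>, and it is unique up to null sets because
  it is the weak derivative of \<open>f\<^sub>u\<close>.\<close>

definition sobolev_deriv ::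
    "nat \<Rightarrow> nat \<Rightarrow> nat set \<Rightarrow> (nat \<Rightarrow> nat) \<Rightarrow> ((nat \<Rightarrow> real) \<Rightarrow> complex) \<Rightarrow> (nat \<Rightarrow> real) \<Rightarrow> complex"
  where
  "sobolev_deriv s \<alpha> u \<nu> f = (SOME g. square_int u g \<and>
     (\<exists>F. represents s \<alpha> F f \<and>
        (\<lambda>n. L2norm u (\<lambda>x. mixed_deriv u \<nu> (marginal s u (F n)) x - g x)) \<longlonglongrightarrow> 0))"

text \<open>The norm of \<open>\<partial>\<^sup>\<nu> f\<^sub>u\<close>, with the convention that it is \<open>\<bar>I(f)\<bar>\<close> for \<open>u = \<emptyset>\<close>.\<close>

definition deriv_norm ::
    "nat \<Rightarrow> nat \<Rightarrow> nat set \<Rightarrow> (nat \<Rightarrow> nat) \<Rightarrow> ((nat \<Rightarrow> real) \<Rightarrow> complex) \<Rightarrow> real" where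
  "deriv_norm s \<alpha> u \<nu> f =
     (if u = {} then cmod (cube_integral s f) else L2norm u (sobolev_deriv s \<alpha> u \<nu> f))"

definition sobolev_norm :: "nat \<Rightarrow> nat \<Rightarrow> ((nat \<Rightarrow> real) \<Rightarrow> complex) \<Rightarrow> real" where
  "sobolev_norm s \<alpha> f = sobolev_norm_of s \<alpha> (cube_integral s f) (\<lambda>u \<nu>. deriv_norm s \<alpha> u \<nu> f)"

end

theory Submission
  imports Defs
begin

text \<open>In one dimension, let \<open>E\<close> be the product of the operators which subtract from a function on
  \<open>[0,1)\<close> its average over one base-\<open>b\<close> digit, taken over \<open>r\<close> digit positions \<open>p\<close>.
  Cyclic shifts of a digit preserve Lebesgue measure and multiply \<open>wal\<^sub>h\<close> by a root of unity, so \<open>E\<close> does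
  not change the Walsh coefficients at frequencies whose digits dual to these positions are nonzero,
  and by Bessel's inequality the sum of their squares is at most \<open>\<parallel>E g\<parallel>\<^sup>2\<close>. On the other hand, \<open>E g(x)\<close> is an
  average of \<open>r\<close>-fold differences of \<open>g\<close> at \<open>x\<close> with steps of size at most
  \<open>\<eta>\<^sub>p = (b - 1) b\<^sup>-\<^sup>p\<close>; writing them as \<open>r\<close>-fold integrals
  of \<open>g\<^sup>(\<^sup>r\<^sup>)\<close> bounds \<open>\<parallel>E g\<parallel>\<^sup>2\<close> by \<open>\<parallel>g\<^sup>(\<^sup>r\<^sup>)\<parallel>\<^sup>2\<close> times the product of the \<open>2 \<eta>\<^sub>p\<^sup>2\<close>.
  Applied one coordinate at a time to the marginal \<open>f\<^sub>v\<close> (Fubini and differentiation under the integral),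
  with the leading digits of the \<open>k\<^sub>j\<close> that belong to the \<open>r\<^sub>i\<close> smallest \<open>\<eta>'\<^sub>j\<close> as positions, this gives the
  inequality for smooth functions, as \<open>2\<close> to the power \<open>\<Sum>r\<^sub>i\<close> is at most \<open>b\<close> to the power \<open>|K|\<close>; both sides are continuous in the
  Sobolev norm.\<close>

section \<open>Square-integrable functions\<close>

text \<open>The shift of a digit moves \<open>x\<close> by an amount that depends on that digit, so
  the averaged difference of a smooth function jumps and cannot itself be differentiated. For each
  \<open>x\<close> the displacements are therefore frozen at the digits of \<open>x\<close> and
  added to a second variable \<open>y\<close>; the function of \<open>y\<close> is as smooth as the
  given one, and at \<open>y = x\<close> it takes the desired value. One difference costs a factor
  \<eta> from Cauchy-Schwarz on a segment of length at most \<eta>, and a factor 2\<eta> from the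
  window around \<open>y\<close> that contains the segment whatever the sign of the displacement:
  this is the source of 2\<eta>^2. Only \<alpha> derivatives per coordinate are available, so at
  most \<alpha> positions can be used there; the bound is the product of their \<eta>, which is why
  the smallest ones are selected. The coordinates can be treated one by one because the estimate
  asks of the frequencies only that certain digits are nonzero, a condition on each coordinate
  separately.\<close>

definition L2_int :: "'a measure \<Rightarrow> ('a \<Rightarrow> complex) \<Rightarrow> bool" where
  "L2_int N g \<longleftrightarrow> g \<in> borel_measurable N \<and> integrable N (\<lambda>x. (cmod (g x))\<^sup>2)"

definition L2_norm_on :: "'a measure \<Rightarrow> ('a \<Rightarrow> complex) \<Rightarrow> real" where
  "L2_norm_on N g = sqrt (LINT x|N. (cmod (g x))\<^sup>2)"

lemma square_int_eq: "square_int u = L2_int (cube u)"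
  by (simp add: fun_eq_iff square_int_def L2_int_def)

lemma L2norm_eq: "L2norm u = L2_norm_on (cube u)"
  by (simp add: fun_eq_iff L2norm_def L2_norm_on_def)

lemma L2_int_measurable: "L2_int N f \<Longrightarrow> f \<in> borel_measurable N"
  by (simp add: L2_int_def)

lemma L2_norm_on_nonneg [simp]: "0 \<le> L2_norm_on N f"
  by (simp add: L2_norm_on_def)

lemma L2_norm_on_square: "(L2_norm_on N f)\<^sup>2 = (LINT x|N. (cmod (f x))\<^sup>2)"
  by (simp add: L2_norm_on_def)

lemma L2_norm_on_cong: "(\<And>x. x \<in> space N \<Longrightarrow> cmod (f x) = cmod (g x)) \<Longrightarrow> L2_norm_on N f = L2_norm_on N g"
  unfolding L2_norm_on_def by (intro arg_cong[where f = sqrt] Bochner_Integration.integral_cong) auto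

lemma nn_integral_L2_int:
  assumes "L2_int N f"
  shows "(\<integral>\<^sup>+x. ennreal ((cmod (f x))\<^sup>2) \<partial>N) = ennreal ((L2_norm_on N f)\<^sup>2)"
  unfolding L2_norm_on_square using assms by (intro nn_integral_eq_integral) (auto simp: L2_int_def)

text \<open>Extended integrals exist without an integrability proof, so one bound there yields
  membership and norm together; this is how the limit in \<open>L2_complete\<close> is
  handled.\<close>

lemma L2_int_nn_integral:
  assumes "f \<in> borel_measurable N" "(\<integral>\<^sup>+x. ennreal ((cmod (f x))\<^sup>2) \<partial>N) \<le> ennreal (c\<^sup>2)" "0 \<le> c"
  shows "L2_int N f" "L2_norm_on N f \<le> c"
proof -
  have fin: "(\<integral>\<^sup>+x. ennreal ((cmod (f x))\<^sup>2) \<partial>N) < \<infinity>"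
    using assms(2) by (auto intro: le_less_trans)
  show *: "L2_int N f"
    unfolding L2_int_def using assms(1) fin by (auto intro!: integrableI_bounded)
  have "(L2_norm_on N f)\<^sup>2 \<le> c\<^sup>2"
    using assms(2) unfolding nn_integral_L2_int[OF *] by simp
  then show "L2_norm_on N f \<le> c"
    using assms(3) power2_le_imp_le by blast
qed

lemma norm_add_square_le: "(cmod (a + b))\<^sup>2 \<le> 2 * (cmod a)\<^sup>2 + 2 * (cmod b)\<^sup>2"
proof -
  have "(cmod (a + b))\<^sup>2 \<le> (cmod a + cmod b)\<^sup>2"
    by (intro power_mono norm_triangle_ineq) auto
  also have "\<dots> \<le> 2 * (cmod a)\<^sup>2 + 2 * (cmod b)\<^sup>2"
    using zero_le_power2[of "cmod a - cmod b"] unfolding power2_sum power2_diff by linarith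
  finally show ?thesis .
qed

lemma L2_int_add:
  assumes "L2_int N f" "L2_int N g"
  shows "L2_int N (\<lambda>x. f x + g x)"
proof -
  have "integrable N (\<lambda>x. (cmod (f x + g x))\<^sup>2)"
    by (rule Bochner_Integration.integrable_bound[where f = "\<lambda>x. 2 * (cmod (f x))\<^sup>2 + 2 * (cmod (g x))\<^sup>2"])
      (use assms norm_add_square_le in \<open>auto simp: L2_int_def\<close>)
  then show ?thesis
    using assms by (auto simp: L2_int_def)
qed

lemma L2_int_minus: "L2_int N f \<Longrightarrow> L2_int N (\<lambda>x. - f x)"
  by (auto simp: L2_int_def)

lemma L2_int_diff:
  assumes "L2_int N f" "L2_int N g"
  shows "L2_int N (\<lambda>x. f x - g x)"
  using L2_int_add[OF assms(1) L2_int_minus[OF assms(2)]] by simp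

lemma L2_int_cmult: "L2_int N f \<Longrightarrow> L2_int N (\<lambda>x. c * f x)"
  by (auto simp: L2_int_def norm_mult power_mult_distrib)

lemma L2_int_cnj: "L2_int N f \<Longrightarrow> L2_int N (\<lambda>x. cnj (f x))"
  by (auto simp: L2_int_def intro!: measurable_compose[OF _ borel_measurable_continuous_onI[OF continuous_on_cnj[OF continuous_on_id]]])

lemma L2_int_sum: "finite A \<Longrightarrow> (\<And>i. i \<in> A \<Longrightarrow> L2_int N (f i)) \<Longrightarrow> L2_int N (\<lambda>x. \<Sum>i\<in>A. f i x)"
proof (induction A rule: finite_induct)
  case empty
  then show ?case by (simp add: L2_int_def)
qed (auto intro: L2_int_add)

lemma L2_int_bounded:
  assumes "finite_measure N" "f \<in> borel_measurable N" "\<And>x. x \<in> space N \<Longrightarrow> cmod (f x) \<le> B"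
  shows "L2_int N f"
proof -
  interpret finite_measure N by fact
  have "integrable N (\<lambda>x. (cmod (f x))\<^sup>2)"
  proof (rule integrable_const_bound[where B = "B\<^sup>2"])
    show "AE x in N. norm ((cmod (f x))\<^sup>2) \<le> B\<^sup>2"
      using assms(3) by (intro AE_I2) (simp add: power_mono)
  qed (use assms(2) in simp)
  then show ?thesis
    using assms(2) by (simp add: L2_int_def)
qed

text \<open>Integrability of the product, from \<open>a b \<le> a^2 + b^2\<close>, has to come
  first: it identifies the Bochner integral with the extended one, to which the inequality is
  applied.\<close>

lemma L2_Cauchy_Schwarz:
  assumes "L2_int N f" "L2_int N g"
  shows "integrable N (\<lambda>x. f x * g x)"
    and "(LINT x|N. cmod (f x) * cmod (g x)) \<le> L2_norm_on N f * L2_norm_on N g"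
    and "cmod (LINT x|N. f x * g x) \<le> L2_norm_on N f * L2_norm_on N g"
proof -
  have [measurable]: "f \<in> borel_measurable N" "g \<in> borel_measurable N"
    using assms by (auto simp: L2_int_def)
  show int: "integrable N (\<lambda>x. f x * g x)"
  proof (rule Bochner_Integration.integrable_bound[where f = "\<lambda>x. (cmod (f x))\<^sup>2 + (cmod (g x))\<^sup>2"])
    have "cmod a * cmod b \<le> (cmod a)\<^sup>2 + (cmod b)\<^sup>2" for a b
    proof -
      have "0 \<le> cmod a * cmod b" by simp
      then show ?thesis
        using zero_le_power2[of "cmod a - cmod b"] unfolding power2_diff by linarith
    qed
    then show "AE x in N. norm (f x * g x) \<le> norm ((cmod (f x))\<^sup>2 + (cmod (g x))\<^sup>2)"
      by (auto simp: norm_mult)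
  qed (use assms in \<open>auto simp: L2_int_def\<close>)
  then have int': "integrable N (\<lambda>x. cmod (f x) * cmod (g x))"
    using integrable_norm[OF int] by (simp add: norm_mult)
  have "ennreal ((LINT x|N. cmod (f x) * cmod (g x))\<^sup>2)
      = (\<integral>\<^sup>+x. ennreal (cmod (f x)) * ennreal (cmod (g x)) \<partial>N)\<^sup>2"
    using nn_integral_eq_integral[OF int'] by (simp add: ennreal_mult ennreal_power)
  also have "\<dots> \<le> (\<integral>\<^sup>+x. (ennreal (cmod (f x)))\<^sup>2 \<partial>N) * (\<integral>\<^sup>+x. (ennreal (cmod (g x)))\<^sup>2 \<partial>N)"
    by (rule Cauchy_Schwarz_nn_integral) auto
  also have "\<dots> = ennreal ((L2_norm_on N f * L2_norm_on N g)\<^sup>2)"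
    using nn_integral_L2_int[OF assms(1)] nn_integral_L2_int[OF assms(2)]
    by (simp add: ennreal_power ennreal_mult[symmetric] power_mult_distrib)
  finally have "(LINT x|N. cmod (f x) * cmod (g x))\<^sup>2 \<le> (L2_norm_on N f * L2_norm_on N g)\<^sup>2"
    by simp
  then show *: "(LINT x|N. cmod (f x) * cmod (g x)) \<le> L2_norm_on N f * L2_norm_on N g"
    by (rule power2_le_imp_le) auto
  have "cmod (LINT x|N. f x * g x) \<le> (LINT x|N. cmod (f x * g x))"
    by (rule integral_norm_bound)
  then show "cmod (LINT x|N. f x * g x) \<le> L2_norm_on N f * L2_norm_on N g"
    using * by (simp add: norm_mult)
qed

lemma L2_norm_on_triangle:
  assumes "L2_int N f" "L2_int N g"
  shows "L2_norm_on N (\<lambda>x. f x + g x) \<le> L2_norm_on N f + L2_norm_on N g"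
proof -
  have [measurable]: "f \<in> borel_measurable N" "g \<in> borel_measurable N"
    using assms by (auto simp: L2_int_def)
  have i: "integrable N (\<lambda>x. (cmod (f x))\<^sup>2)" "integrable N (\<lambda>x. (cmod (g x))\<^sup>2)"
    "integrable N (\<lambda>x. cmod (f x) * cmod (g x))" "integrable N (\<lambda>x. (cmod (f x + g x))\<^sup>2)"
    using assms L2_int_add[OF assms] integrable_norm[OF L2_Cauchy_Schwarz(1)[OF assms]]
    by (auto simp: L2_int_def norm_mult)
  have "(L2_norm_on N (\<lambda>x. f x + g x))\<^sup>2
      \<le> (LINT x|N. (cmod (f x))\<^sup>2 + (cmod (g x))\<^sup>2 + 2 * (cmod (f x) * cmod (g x)))"
    unfolding L2_norm_on_square
  proof (rule integral_mono)
    fix x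
    have "(cmod (f x + g x))\<^sup>2 \<le> (cmod (f x) + cmod (g x))\<^sup>2"
      by (intro power_mono norm_triangle_ineq) auto
    then show "(cmod (f x + g x))\<^sup>2 \<le> (cmod (f x))\<^sup>2 + (cmod (g x))\<^sup>2 + 2 * (cmod (f x) * cmod (g x))"
      by (simp add: power2_sum)
  qed (use i in auto)
  also have "\<dots> = (L2_norm_on N f)\<^sup>2 + (L2_norm_on N g)\<^sup>2 + 2 * (LINT x|N. cmod (f x) * cmod (g x))"
    using i by (simp add: L2_norm_on_square)
  also have "\<dots> \<le> (L2_norm_on N f + L2_norm_on N g)\<^sup>2"
    using L2_Cauchy_Schwarz(2)[OF assms] by (simp add: power2_sum)
  finally show ?thesis
    by (rule power2_le_imp_le) auto
qed

lemma L2_norm_on_minus_commute: "L2_norm_on N (\<lambda>x. f x - g x) = L2_norm_on N (\<lambda>x. g x - f x)"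
  by (intro L2_norm_on_cong) (simp add: norm_minus_commute)

lemma L2_norm_on_diff_le:
  assumes "L2_int N f" "L2_int N g"
  shows "\<bar>L2_norm_on N f - L2_norm_on N g\<bar> \<le> L2_norm_on N (\<lambda>x. f x - g x)"
  using L2_norm_on_triangle[OF L2_int_diff[OF assms] assms(2)]
    L2_norm_on_triangle[OF L2_int_diff[OF assms(2) assms(1)] assms(1)]
    L2_norm_on_minus_commute[of N f g] by simp

lemma L2_norm_on_tendsto:
  assumes "\<And>n. L2_int N (F n)" "L2_int N g" "(\<lambda>n. L2_norm_on N (\<lambda>x. F n x - g x)) \<longlonglongrightarrow> 0"
  shows "(\<lambda>n. L2_norm_on N (F n)) \<longlonglongrightarrow> L2_norm_on N g"
proof (rule LIM_zero_cancel, rule Lim_null_comparison[OF _ assms(3)])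
  show "\<forall>\<^sub>F n in sequentially. norm (L2_norm_on N (F n) - L2_norm_on N g) \<le> L2_norm_on N (\<lambda>x. F n x - g x)"
    using L2_norm_on_diff_le[OF assms(1,2)] by simp
qed

text \<open>The Riesz-Fischer argument: a subsequence with summable increments converges almost
  everywhere, and Fatou's lemma turns the Cauchy condition into a bound for the distance to the
  limit. It supplies the derivatives in the completed space.\<close>

lemma L2_complete:
  assumes "finite_measure N" "\<And>n. L2_int N (F n)"
    and Cauchy: "\<And>e. 0 < e \<Longrightarrow> \<exists>M. \<forall>m\<ge>M. \<forall>n\<ge>M. L2_norm_on N (\<lambda>x. F m x - F n x) < e"
  shows "\<exists>g. L2_int N g \<and> (\<lambda>n. L2_norm_on N (\<lambda>x. F n x - g x)) \<longlonglongrightarrow> 0"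
proof -
  interpret finite_measure N by fact
  have [measurable]: "F n \<in> borel_measurable N" for n
    using assms(2) by (simp add: L2_int_def)
  define R where "R k = (SOME M. \<forall>m\<ge>M. \<forall>n\<ge>M. L2_norm_on N (\<lambda>x. F m x - F n x) < (1/2)^k)" for k :: nat
  have R: "L2_norm_on N (\<lambda>x. F m x - F n x) < (1/2)^k" if "m \<ge> R k" "n \<ge> R k" for k m n
    using someI_ex[OF Cauchy[of "(1/2)^k"]] that unfolding R_def by auto
  \<comment> \<open>Summing the thresholds makes \<open>r k\<close> and \<open>r (Suc k)\<close>
    both at least \<open>R k\<close>; the added \<open>k\<close> makes the subsequence tend to
    infinity.\<close>
  define r where "r k = (\<Sum>i\<le>k. R i) + k" for k
  have r: "r k \<ge> R k" "r (Suc k) \<ge> R k" "r k \<ge> k" for k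
    using member_le_sum[of k "{..k}" R] by (auto simp: r_def)
  define D where "D k x = cmod (F (r (Suc k)) x - F (r k) x)" for k x
  have [measurable]: "D k \<in> borel_measurable N" for k
    unfolding D_def by measurable
  define c where "c = L2_norm_on N (\<lambda>_. 1)"
  have D_le: "(\<integral>\<^sup>+x. ennreal (D k x) \<partial>N) \<le> ennreal (c * (1/2)^k)" for k
  proof -
    have "L2_int N (\<lambda>x. F (r (Suc k)) x - F (r k) x)" and one: "L2_int N (\<lambda>x. 1)"
      using L2_int_diff[OF assms(2) assms(2)] by (auto simp: L2_int_def)
    note CS = L2_Cauchy_Schwarz[OF this]
    have "integrable N (D k)"
      using integrable_norm[OF CS(1)] by (simp add: D_def[abs_def])
    then have "(\<integral>\<^sup>+x. ennreal (D k x) \<partial>N) = ennreal (LINT x|N. D k x)"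
      by (intro nn_integral_eq_integral) (auto simp: D_def[abs_def])
    also have "(LINT x|N. D k x) \<le> L2_norm_on N (\<lambda>x. F (r (Suc k)) x - F (r k) x) * c"
      using CS(2) by (simp add: D_def c_def)
    also have "\<dots> \<le> (1/2)^k * c"
      using R[OF r(2) r(1), of k] by (intro mult_right_mono) (auto simp: c_def)
    finally show ?thesis
      by (simp add: ennreal_leI mult.commute)
  qed
  have "(\<integral>\<^sup>+x. (\<Sum>k. ennreal (D k x)) \<partial>N) = (\<Sum>k. \<integral>\<^sup>+x. ennreal (D k x) \<partial>N)"
    by (rule nn_integral_suminf) auto
  also have "\<dots> \<le> (\<Sum>k. ennreal (c * (1/2)^k))"
    by (intro suminf_le D_le) auto
  also have "\<dots> = ennreal (\<Sum>k. c * (1/2)^k)"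
    by (intro suminf_ennreal2) (auto simp: c_def intro!: summable_mult summable_geometric)
  also have "\<dots> < \<infinity>" by simp
  finally have "AE x in N. (\<Sum>k. ennreal (D k x)) \<noteq> \<infinity>"
    by (intro nn_integral_PInf_AE) (auto simp: less_top)
  then have conv: "AE x in N. convergent (\<lambda>k. F (r k) x)"
  proof eventually_elim
    case (elim x)
    then have "summable (\<lambda>k. D k x)"
      by (intro summable_suminf_not_top) (auto simp: D_def)
    then have "summable (\<lambda>k. F (r (Suc k)) x - F (r k) x)"
      unfolding D_def by (rule summable_norm_cancel)
    then have "convergent (\<lambda>n. \<Sum>k<n. F (r (Suc k)) x - F (r k) x)"
      by (simp add: summable_iff_convergent)
    then have "convergent (\<lambda>n. (F (r n) x - F (r 0) x) + F (r 0) x)"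
      by (intro convergent_add convergent_const) (simp add: sum_lessThan_telescope[of "\<lambda>k. F (r k) x"])
    then show ?case by simp
  qed
  \<comment> \<open>Where the subsequence diverges, \<open>lim\<close> is an arbitrary value; this
    happens only on a null set.\<close>
  define g where "g x = lim (\<lambda>k. F (r k) x)" for x
  have [measurable]: "g \<in> borel_measurable N"
    unfolding g_def by measurable
  have tail: "(\<integral>\<^sup>+x. ennreal ((cmod (F m x - g x))\<^sup>2) \<partial>N) \<le> ennreal (((1/2)^k)\<^sup>2)" if m: "m \<ge> R k" for m k
  proof -
    have "(\<integral>\<^sup>+x. ennreal ((cmod (F m x - g x))\<^sup>2) \<partial>N)
        = (\<integral>\<^sup>+x. liminf (\<lambda>j. ennreal ((cmod (F m x - F (r j) x))\<^sup>2)) \<partial>N)"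
    proof (intro nn_integral_cong_AE, use conv in eventually_elim)
      fix x assume "convergent (\<lambda>k. F (r k) x)"
      then have "(\<lambda>k. F (r k) x) \<longlonglongrightarrow> g x"
        unfolding g_def by (simp add: convergent_LIMSEQ_iff)
      then have "(\<lambda>j. ennreal ((cmod (F m x - F (r j) x))\<^sup>2)) \<longlonglongrightarrow> ennreal ((cmod (F m x - g x))\<^sup>2)"
        by (intro tendsto_intros)
      then show "ennreal ((cmod (F m x - g x))\<^sup>2) = liminf (\<lambda>j. ennreal ((cmod (F m x - F (r j) x))\<^sup>2))"
        using lim_imp_Liminf[OF sequentially_bot] by metis
    qed
    also have "\<dots> \<le> liminf (\<lambda>j. \<integral>\<^sup>+x. ennreal ((cmod (F m x - F (r j) x))\<^sup>2) \<partial>N)"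
      by (rule nn_integral_liminf) auto
    also have "\<dots> \<le> ennreal (((1/2)^k)\<^sup>2)"
    proof (rule Liminf_le, simp, intro eventually_sequentiallyI[of "R k"])
      fix j assume "R k \<le> j"
      then have "L2_norm_on N (\<lambda>x. F m x - F (r j) x) \<le> (1/2)^k"
        using R[OF m, of "r j"] r(3)[of j] by simp
      then show "(\<integral>\<^sup>+x. ennreal ((cmod (F m x - F (r j) x))\<^sup>2) \<partial>N) \<le> ennreal (((1/2)^k)\<^sup>2)"
        by (subst nn_integral_L2_int) (auto intro!: L2_int_diff assms(2) ennreal_leI power_mono)
    qed
    finally show ?thesis .
  qed
  have tail': "L2_int N (\<lambda>x. F m x - g x)" "L2_norm_on N (\<lambda>x. F m x - g x) \<le> (1/2)^k" if "m \<ge> R k" for m k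
    using L2_int_nn_integral[OF _ tail[OF that]] by auto
  have "L2_int N (\<lambda>x. F (R 0) x - (F (R 0) x - g x))"
    by (intro L2_int_diff[OF assms(2) tail'(1)[of 0]]) simp
  then have "L2_int N g" by simp
  moreover have "(\<lambda>n. L2_norm_on N (\<lambda>x. F n x - g x)) \<longlonglongrightarrow> 0"
  proof (rule LIMSEQ_I)
    fix e :: real assume "0 < e"
    then obtain k where k: "(1/2::real)^k < e"
      using real_arch_pow_inv[of e "1/2"] by auto
    show "\<exists>no. \<forall>n\<ge>no. norm (L2_norm_on N (\<lambda>x. F n x - g x) - 0) < e"
      using le_less_trans[OF tail'(2) k] by (intro exI[of _ "R k"] allI impI) simp
  qed
  ultimately show ?thesis by blast
qed

section \<open>Digit shifts\<close>

abbreviation unit_measure :: "real measure" where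
  "unit_measure \<equiv> restrict_space lborel {0..1}"

lemma emeasure_unit_measure: "emeasure unit_measure {0..1} = 1"
  by (simp add: emeasure_restrict_space)

lemma finite_measure_unit_measure: "finite_measure unit_measure"
  by (rule finite_measureI) (simp add: space_restrict_space emeasure_unit_measure)

lemma measure_unit_measure: "measure unit_measure {0..1} = 1"
  by (simp add: measure_def emeasure_unit_measure)

lemma AE_unit_measure_less_1: "AE x in unit_measure. 0 \<le> x \<and> x < 1"
proof -
  have "AE x in lborel. x \<noteq> (1::real)"
    by (rule AE_lborel_singleton)
  then show ?thesis
    by (subst AE_restrict_space_iff) auto
qed

lemma real_digit_less: "b \<ge> 2 \<Longrightarrow> real_digit b x r < b"
  by (simp add: real_digit_def nat_less_iff)

lemma int_real_digit: "b \<ge> 2 \<Longrightarrow> int (real_digit b x r) = \<lfloor>x * real b ^ r\<rfloor> mod int b"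
  by (simp add: real_digit_def)

text \<open>Truncating after \<open>r\<close> digits is truncating after \<open>n\<close> digits and
  dropping the last \<open>n - r\<close>; so agreement of two points at one level implies agreement
  at all coarser ones.\<close>

lemma floor_mult_power_div:
  assumes "b \<ge> 2" "r \<le> n"
  shows "\<lfloor>x * real b ^ r\<rfloor> = \<lfloor>x * real b ^ n\<rfloor> div int b ^ (n - r)"
  using assms(2)
proof (induction n rule: dec_induct)
  case (step n)
  have "\<lfloor>x * real b ^ n\<rfloor> = \<lfloor>x * real b ^ Suc n\<rfloor> div int b"
    using assms(1) real_digit_less[OF assms(1), of x "Suc n"]
    by (simp add: floor_real_digit_Suc[OF assms(1)] del: power_Suc)
  moreover have "int b ^ (Suc n - r) = int b * int b ^ (n - r)"
    using step by (simp add: Suc_diff_le)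
  ultimately show ?case
    using step by (simp add: zdiv_zmult2_eq)
qed simp

text \<open>No carry arises: at level \<open>p\<close> the truncation ends in the admissible digit
  \<open>c\<close>, so the coarser truncations keep their values, and at finer levels the integer
  added is a multiple of \<open>b\<close>. The equality of floors is what keeps points of [0,1) in
  [0,1).\<close>

lemma replace_digit:
  fixes x :: real and c p :: nat
  assumes "b \<ge> 2" "p \<ge> 1" "c < b"
  defines "y \<equiv> x + (real c - real (real_digit b x p)) / real b ^ p"
  shows "\<lfloor>y\<rfloor> = \<lfloor>x\<rfloor>" "real_digit b y r = (if r = p then c else real_digit b x r)"
proof -
  have b: "real b ^ n > 0" for n using assms by simp
  have up: "\<lfloor>y * real b ^ n\<rfloor> = \<lfloor>x * real b ^ n\<rfloor> + (int c - int (real_digit b x p)) * int b ^ (n - p)"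
    if "n \<ge> p" for n
  proof -
    have "y * real b ^ n = x * real b ^ n + (real c - real (real_digit b x p)) * (real b ^ n / real b ^ p)"
      using b[of p] by (simp add: y_def field_simps)
    also have "real b ^ n / real b ^ p = real b ^ (n - p)"
      using that assms by (simp add: power_diff)
    finally have "y * real b ^ n
        = x * real b ^ n + real_of_int ((int c - int (real_digit b x p)) * int b ^ (n - p))"
      by simp
    then show ?thesis
      by (simp only: floor_add_int)
  qed
  have "\<lfloor>x * real b ^ p\<rfloor> = int b * \<lfloor>x * real b ^ (p - 1)\<rfloor> + int (real_digit b x p)"
    using floor_real_digit_Suc[OF assms(1), of x "p - 1"] assms(2) by simp
  then have p: "\<lfloor>y * real b ^ p\<rfloor> = int b * \<lfloor>x * real b ^ (p - 1)\<rfloor> + int c"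
    using up[of p] by simp
  have "\<lfloor>y * real b ^ (p - 1)\<rfloor> = \<lfloor>y * real b ^ p\<rfloor> div int b"
    using floor_mult_power_div[OF assms(1), of "p - 1" p y] assms(2) by simp
  then have p1: "\<lfloor>y * real b ^ (p - 1)\<rfloor> = \<lfloor>x * real b ^ (p - 1)\<rfloor>"
    using p assms by simp
  have low: "\<lfloor>y * real b ^ n\<rfloor> = \<lfloor>x * real b ^ n\<rfloor>" if "n < p" for n
    using floor_mult_power_div[OF assms(1), of n "p - 1" x]
      floor_mult_power_div[OF assms(1), of n "p - 1" y] p1 that by simp
  show "\<lfloor>y\<rfloor> = \<lfloor>x\<rfloor>"
    using low[of 0] assms(2) by simp
  have "int (real_digit b y r) = int (if r = p then c else real_digit b x r)"
  proof (cases r p rule: linorder_cases)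
    case greater
    then have "int b ^ (r - p) = int b * int b ^ (r - p - 1)"
      by (metis Suc_diff_1 power_Suc zero_less_diff)
    then have "\<lfloor>y * real b ^ r\<rfloor>
        = \<lfloor>x * real b ^ r\<rfloor> + int b * ((int c - int (real_digit b x p)) * int b ^ (r - p - 1))"
      using greater up[of r] by (simp only: less_imp_le mult.left_commute)
    then have "\<lfloor>y * real b ^ r\<rfloor> mod int b = \<lfloor>x * real b ^ r\<rfloor> mod int b"
      by (simp only: mod_mult_self2)
    then show ?thesis
      using greater assms(1) by (simp add: int_real_digit)
  qed (use low p assms in \<open>auto simp: int_real_digit\<close>)
  then show "real_digit b y r = (if r = p then c else real_digit b x r)"
    by (simp only: of_nat_eq_iff)
qed

text \<open>The displacement is separated from the shift because it will be evaluated at one point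
  and added to another.\<close>

definition digit_offset :: "nat \<Rightarrow> nat \<Rightarrow> nat \<Rightarrow> real \<Rightarrow> real" where
  "digit_offset b p z x = (real ((real_digit b x p + z) mod b) - real (real_digit b x p)) / real b ^ p"

text \<open>Points outside [0,1) are fixed, so that the closed unit interval, endpoint 1 included,
  is mapped to itself.\<close>

definition digit_shift :: "nat \<Rightarrow> nat \<Rightarrow> nat \<Rightarrow> real \<Rightarrow> real" where
  "digit_shift b p z x = (if 0 \<le> x \<and> x < 1 then x + digit_offset b p z x else x)"

lemma digit_shift:
  assumes "b \<ge> 2" "p \<ge> 1" "0 \<le> x" "x < 1"
  shows "0 \<le> digit_shift b p z x" "digit_shift b p z x < 1"
    "real_digit b (digit_shift b p z x) r = (if r = p then (real_digit b x p + z) mod b else real_digit b x r)"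
proof -
  have c: "(real_digit b x p + z) mod b < b" using assms by simp
  have x: "\<lfloor>x\<rfloor> = 0" using assms by linarith
  note R = replace_digit[OF assms(1,2) c, of x, folded digit_offset_def]
  have "\<lfloor>digit_shift b p z x\<rfloor> = 0"
    using R(1) x assms by (simp add: digit_shift_def)
  then show "0 \<le> digit_shift b p z x" "digit_shift b p z x < 1"
    by linarith+
  show "real_digit b (digit_shift b p z x) r = (if r = p then (real_digit b x p + z) mod b else real_digit b x r)"
    using R(2) assms by (simp add: digit_shift_def)
qed

lemma measurable_real_digit [measurable]: "(\<lambda>x. real_digit b x r) \<in> borel \<rightarrow>\<^sub>M count_space UNIV"
  unfolding real_digit_def by measurable

lemma measurable_digit_shift [measurable]: "digit_shift b p z \<in> borel \<rightarrow>\<^sub>M borel"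
  unfolding digit_shift_def digit_offset_def by measurable

text \<open>On the set of points with \<open>p\<close>-th digit \<open>c\<close> the shift is a
  translation, onto the set with digit \<open>(c + z) mod b\<close>. Translations preserve Lebesgue
  measure, and adding \<open>z\<close> modulo \<open>b\<close> permutes the digits.\<close>

lemma nn_integral_digit_shift:
  fixes F :: "real \<Rightarrow> ennreal"
  assumes b: "b \<ge> 2" "p \<ge> 1" and [measurable]: "F \<in> borel_measurable borel"
  shows "(\<integral>\<^sup>+x. indicator {0..<1} x * F (digit_shift b p z x) \<partial>lborel)
    = (\<integral>\<^sup>+x. indicator {0..<1} x * F x \<partial>lborel)"
proof -
  define D where "D c = {x. 0 \<le> x \<and> x < 1 \<and> real_digit b x p = c}" for c
  have [measurable]: "D c \<in> sets borel" for c
    unfolding D_def by measurable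
  have split: "(indicator {0..<1} x :: ennreal) = (\<Sum>c<b. indicator (D c) x)" for x
  proof -
    have "(\<Sum>c<b. indicator (D c) x) = (\<Sum>c<b. if c = real_digit b x p then indicator {0..<1} x else 0 :: ennreal)"
      by (intro sum.cong refl) (auto simp: D_def indicator_def)
    also have "\<dots> = indicator {0..<1} x"
      using real_digit_less[OF b(1)] by simp
    finally show ?thesis ..
  qed
  have piece: "(\<integral>\<^sup>+x. indicator (D c) x * F (digit_shift b p z x) \<partial>lborel)
      = (\<integral>\<^sup>+x. indicator (D ((c + z) mod b)) x * F x \<partial>lborel)" if "c < b" for c
  proof -
    let ?c = "(c + z) mod b" let ?d = "(real ?c - real c) / real b ^ p"
    have c: "?c < b" using b by simp
    have iff: "?d + x \<in> D ?c \<longleftrightarrow> x \<in> D c" for x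
    proof
      assume x: "x \<in> D c"
      have e: "x + ?d = x + (real ?c - real (real_digit b x p)) / real b ^ p"
        using x by (simp add: D_def)
      have "\<lfloor>x\<rfloor> = 0" using x by (auto simp: D_def intro!: floor_unique)
      then have "\<lfloor>x + ?d\<rfloor> = 0" "real_digit b (x + ?d) p = ?c"
        unfolding e using replace_digit[OF b c, of x] by auto
      then show "?d + x \<in> D ?c"
        by (simp add: D_def add.commute floor_eq_iff)
    next
      assume y: "?d + x \<in> D ?c"
      \<comment> \<open>The converse is again a replacement of a digit: putting \<open>c\<close>
        back into the translated point recovers \<open>x\<close>.\<close>
      have e: "x = (?d + x) + (real c - real (real_digit b (?d + x) p)) / real b ^ p"
        using y b by (simp add: D_def field_simps)
      have "\<lfloor>?d + x\<rfloor> = 0" using y by (auto simp: D_def floor_eq_iff)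
      then have "\<lfloor>x\<rfloor> = 0" "real_digit b x p = c"
        using replace_digit[OF b that, of "?d + x", folded e] by auto
      then show "x \<in> D c"
        by (simp add: D_def floor_eq_iff)
    qed
    have "(\<integral>\<^sup>+x. indicator (D ?c) x * F x \<partial>lborel)
        = (\<integral>\<^sup>+x. indicator (D ?c) (?d + x) * F (?d + x) \<partial>lborel)"
      by (subst nn_integral_real_affine[where c = 1 and t = ?d]) auto
    also have "\<dots> = (\<integral>\<^sup>+x. indicator (D c) x * F (digit_shift b p z x) \<partial>lborel)"
    proof (intro nn_integral_cong)
      fix x
      have "digit_shift b p z x = ?d + x" if "x \<in> D c"
        using that by (simp add: D_def digit_shift_def digit_offset_def)
      then show "indicator (D ?c) (?d + x) * F (?d + x) = indicator (D c) x * F (digit_shift b p z x)"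
        using iff[of x] by (auto simp: indicator_def)
    qed
    finally show ?thesis ..
  qed
  have inj: "inj_on (\<lambda>c. (c + z) mod b) {..<b}"
  proof (rule inj_onI)
    have *: "c = c'" if "c \<le> c'" "c' < b" "(c' + z) mod b = (c + z) mod b" for c c'
    proof -
      have "b dvd c' - c"
        using that mod_eq_dvd_iff_nat[of "c + z" "c' + z" b] by simp
      then show ?thesis
        using that by (auto dest: dvd_imp_le)
    qed
    fix c c' assume "c \<in> {..<b}" "c' \<in> {..<b}" "(c + z) mod b = (c' + z) mod b"
    then show "c = c'"
      using *[of c c'] *[of c' c] by (cases "c \<le> c'") auto
  qed
  then have "(\<lambda>c. (c + z) mod b) ` {..<b} = {..<b}"
    using b by (intro endo_inj_surj) auto
  then have bij: "bij_betw (\<lambda>c. (c + z) mod b) {..<b} {..<b}"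
    using inj by (simp add: bij_betw_def)
  have "(\<integral>\<^sup>+x. indicator {0..<1} x * F (digit_shift b p z x) \<partial>lborel)
      = (\<Sum>c<b. \<integral>\<^sup>+x. indicator (D c) x * F (digit_shift b p z x) \<partial>lborel)"
    unfolding split sum_distrib_right by (rule nn_integral_sum) auto
  also have "\<dots> = (\<Sum>c<b. \<integral>\<^sup>+x. indicator (D ((c + z) mod b)) x * F x \<partial>lborel)"
    by (intro sum.cong piece) auto
  also have "\<dots> = (\<Sum>c<b. \<integral>\<^sup>+x. indicator (D c) x * F x \<partial>lborel)"
    by (rule sum.reindex_bij_betw[OF bij])
  also have "\<dots> = (\<integral>\<^sup>+x. indicator {0..<1} x * F x \<partial>lborel)"
    unfolding split sum_distrib_right by (rule nn_integral_sum[symmetric]) auto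
  finally show ?thesis .
qed

lemma nn_integral_unit_measure:
  assumes "F \<in> borel_measurable borel"
  shows "(\<integral>\<^sup>+x. F x \<partial>unit_measure) = (\<integral>\<^sup>+x. indicator {0..<1} x * F x \<partial>lborel)"
proof -
  have "(\<integral>\<^sup>+x. F x \<partial>unit_measure) = (\<integral>\<^sup>+x. F x * indicator {0..1} x \<partial>lborel)"
    by (simp add: nn_integral_restrict_space)
  also have "\<dots> = (\<integral>\<^sup>+x. indicator {0..<1} x * F x \<partial>lborel)"
  proof (rule nn_integral_cong_AE)
    show "AE x in lborel. F x * indicator {0..1} x = indicator {0..<1} x * F x"
      using AE_lborel_singleton[of 1] by eventually_elim (auto simp: indicator_def)
  qed
  finally show ?thesis .
qed

lemma measurable_digit_shift_unit [measurable]: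
  assumes "b \<ge> 2" "p \<ge> 1"
  shows "digit_shift b p z \<in> unit_measure \<rightarrow>\<^sub>M unit_measure"
proof (rule measurable_restrict_space3)
  show "digit_shift b p z \<in> {0..1} \<rightarrow> {0..1}"
  proof
    fix x :: real assume "x \<in> {0..1}"
    then show "digit_shift b p z x \<in> {0..1}"
      using digit_shift(1,2)[OF assms, of x z] by (cases "x < 1") (auto simp: digit_shift_def)
  qed
qed simp

lemma distr_digit_shift:
  assumes "b \<ge> 2" "p \<ge> 1"
  shows "distr unit_measure unit_measure (digit_shift b p z) = unit_measure"
proof (rule measure_eqI)
  fix A assume "A \<in> sets (distr unit_measure unit_measure (digit_shift b p z))"
  then have A: "A \<in> sets unit_measure" by simp
  then have [measurable]: "A \<in> sets borel" "A \<subseteq> {0..1}"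
    by (auto simp: sets_restrict_space_iff)
  have "emeasure (distr unit_measure unit_measure (digit_shift b p z)) A
      = (\<integral>\<^sup>+x. indicator A x \<partial>distr unit_measure unit_measure (digit_shift b p z))"
    using A by simp
  also have "\<dots> = (\<integral>\<^sup>+x. indicator A (digit_shift b p z x) \<partial>unit_measure)"
    using A assms by (intro nn_integral_distr) auto
  also have "\<dots> = (\<integral>\<^sup>+x. indicator {0..<1} x * indicator A (digit_shift b p z x) \<partial>lborel)"
    by (rule nn_integral_unit_measure) measurable
  also have "\<dots> = (\<integral>\<^sup>+x. indicator {0..<1} x * indicator A x \<partial>lborel)"
    by (rule nn_integral_digit_shift) (use assms in auto)
  also have "\<dots> = (\<integral>\<^sup>+x. indicator A x \<partial>unit_measure)"
    by (rule nn_integral_unit_measure[symmetric]) measurable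
  finally show "emeasure (distr unit_measure unit_measure (digit_shift b p z)) A = emeasure unit_measure A"
    using A by simp
qed simp

lemma integral_digit_shift:
  fixes g :: "real \<Rightarrow> complex"
  assumes "b \<ge> 2" "p \<ge> 1" "g \<in> borel_measurable unit_measure"
  shows "(LINT x|unit_measure. g (digit_shift b p z x)) = (LINT x|unit_measure. g x)"
  using integral_distr[OF measurable_digit_shift_unit[OF assms(1,2)] assms(3), of z]
  by (simp add: distr_digit_shift[OF assms(1,2)])

section \<open>Walsh coefficients in one dimension\<close>

text \<open>The additive character of the integers modulo \<open>b\<close>, with arguments in
  \<open>nat\<close> so that sums of digit products need no reduction.\<close>

definition root_char :: "nat \<Rightarrow> nat \<Rightarrow> complex" where
  "root_char b m = exp (2 * of_real pi * \<i> / of_nat b * of_nat m)"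

lemma root_char_0 [simp]: "root_char b 0 = 1"
  by (simp add: root_char_def)

lemma root_char_add: "root_char b (m + n) = root_char b m * root_char b n"
  by (simp add: root_char_def exp_add[symmetric] distrib_left)

lemma norm_root_char [simp]: "cmod (root_char b m) = 1"
proof -
  have "root_char b m = exp (\<i> * of_real (2 * pi / real b * real m))"
    by (simp add: root_char_def field_simps)
  then show ?thesis by (simp only: norm_exp_i_times)
qed

lemma root_char_eq_1_iff:
  assumes "b > 0"
  shows "root_char b m = 1 \<longleftrightarrow> b dvd m"
proof -
  have "root_char b m = 1 \<longleftrightarrow> (\<exists>n::int. real m / real b = real_of_int n)"
    unfolding root_char_def exp_eq_1 using assms by (simp add: field_simps)
  also have "\<dots> \<longleftrightarrow> b dvd m"
  proof
    assume "\<exists>n::int. real m / real b = real_of_int n"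
    then obtain n :: int where "real m / real b = real_of_int n" ..
    then have "real_of_int (int m) = real_of_int (n * int b)"
      using assms by (simp add: field_simps)
    then have "int m = n * int b" by (simp only: of_int_eq_iff)
    then have "int b dvd int m" by simp
    then show "b dvd m" by simp
  next
    assume "b dvd m"
    then obtain n where "m = b * n" ..
    then show "\<exists>n::int. real m / real b = real_of_int n"
      using assms by (intro exI[of _ "int n"]) simp
  qed
  finally show ?thesis .
qed

lemma root_char_mod:
  assumes "b > 0" "m mod b = n mod b"
  shows "root_char b m = root_char b n"
proof -
  have "root_char b m = root_char b (m mod b)" if "b > 0" for m
    using root_char_add[of b "m mod b" "b * (m div b)"] root_char_eq_1_iff[OF that] by simp
  then show ?thesis using assms by metis
qed

text \<open>Orthogonality to the trivial character, by the geometric sum; it makes the average over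
  a digit vanish at frequencies whose dual digit is nonzero.\<close>

lemma sum_root_char:
  assumes "b > 0" "\<not> b dvd m"
  shows "(\<Sum>z<b. root_char b (m * z)) = 0"
proof -
  have pow: "root_char b (m * z) = root_char b m ^ z" for z
    by (induction z) (simp_all add: root_char_add)
  have "root_char b m ^ b = 1"
    using assms by (simp add: pow[symmetric] root_char_eq_1_iff)
  moreover have "root_char b m \<noteq> 1"
    using assms by (simp add: root_char_eq_1_iff)
  ultimately show ?thesis
    using geometric_sum[of "root_char b m" b] by (simp add: pow)
qed

lemma nat_digit_eq_0: "k < b ^ r \<Longrightarrow> nat_digit b k r = 0"
  by (simp add: nat_digit_def)

lemma less_power_base: "b \<ge> 2 \<Longrightarrow> k \<le> r \<Longrightarrow> k < b ^ r" for b k r :: nat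
  by (meson le_less_trans less_exp order_less_le_trans power_mono zero_le_numeral)

text \<open>The cutoff \<open>k\<close> is crude but sufficient: \<open>k < b ^ r\<close> for
  \<open>r \<ge> k\<close>, so the digits from index \<open>k\<close> on are zero.\<close>

lemma wal_eq:
  assumes "b \<ge> 2"
  shows "wal b k x = root_char b (\<Sum>r<k. nat_digit b k r * real_digit b x (Suc r))"
proof -
  have "(\<Sum>r. real (nat_digit b k r * real_digit b x (Suc r)))
      = (\<Sum>r<k. real (nat_digit b k r * real_digit b x (Suc r)))"
    using assms by (intro suminf_finite) (auto simp: nat_digit_eq_0 less_power_base not_less)
  then show ?thesis
    by (simp add: wal_def root_char_def)
qed

lemma norm_wal: "b \<ge> 2 \<Longrightarrow> cmod (wal b k x) = 1"
  by (simp add: wal_eq)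

lemma wal_0: "wal b 0 x = 1"
  by (simp add: wal_def nat_digit_def)

lemma wal_cnj: "b \<ge> 2 \<Longrightarrow> wal b k x * cnj (wal b k x) = 1"
  by (simp add: complex_norm_square[symmetric] norm_wal)

lemma measurable_wal:
  assumes "b \<ge> 2"
  shows "wal b k \<in> borel_measurable borel"
  unfolding wal_eq[OF assms, abs_def] root_char_def by measurable

lemma measurable_wal_unit [measurable]: "b \<ge> 2 \<Longrightarrow> wal b k \<in> borel_measurable unit_measure"
  by (rule measurable_restrict_space1) (simp add: measurable_wal)

lemma wal_digit_shift:
  assumes "b \<ge> 2" "p \<ge> 1" "0 \<le> x" "x < 1"
  shows "wal b k (digit_shift b p z x) = root_char b (nat_digit b k (p - 1) * z) * wal b k x"
proof -
  let ?\<kappa> = "nat_digit b k"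
  \<comment> \<open>Equality holds only modulo \<open>b\<close>, because the shift is cyclic; that
    suffices for the character.\<close>
  have "?\<kappa> r * real_digit b (digit_shift b p z x) (Suc r) mod b
      = (?\<kappa> r * real_digit b x (Suc r) + (if r = p - 1 then ?\<kappa> r * z else 0)) mod b" for r
    using digit_shift(3)[OF assms, of z "Suc r"] assms(2)
    by (auto simp: mod_mult_right_eq distrib_left[symmetric])
  then have "(\<Sum>r<k. ?\<kappa> r * real_digit b (digit_shift b p z x) (Suc r)) mod b
      = (\<Sum>r<k. ?\<kappa> r * real_digit b x (Suc r) + (if r = p - 1 then ?\<kappa> r * z else 0)) mod b"
    by (subst (1 2) mod_sum_eq[symmetric]) simp
  \<comment> \<open>The digit paired with position \<open>p\<close> has index \<open>p - 1\<close>;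
    if this index is not below \<open>k\<close>, the digit is 0 and the extra term vanishes on both
    sides.\<close>
  also have "(\<Sum>r<k. ?\<kappa> r * real_digit b x (Suc r) + (if r = p - 1 then ?\<kappa> r * z else 0))
      = ?\<kappa> (p - 1) * z + (\<Sum>r<k. ?\<kappa> r * real_digit b x (Suc r))"
    using assms(1) by (auto simp: sum.distrib nat_digit_eq_0 less_power_base not_less)
  finally show ?thesis
    using assms(1) by (simp add: wal_eq root_char_mod[of b _ "?\<kappa> (p - 1) * z + _"] root_char_add)
qed

definition wal_coeff :: "nat \<Rightarrow> (real \<Rightarrow> complex) \<Rightarrow> nat \<Rightarrow> complex" where
  "wal_coeff b g h = (LINT x|unit_measure. g x * cnj (wal b h x))"

text \<open>The shift preserves the measure, so the coefficient may be computed at the shifted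
  point; there the conjugated Walsh function carries the inverse root of unity, and compensating for
  it produces the factor.\<close>

lemma wal_coeff_digit_shift:
  assumes "b \<ge> 2" "p \<ge> 1" "g \<in> borel_measurable unit_measure"
  shows "wal_coeff b (\<lambda>x. g (digit_shift b p z x)) h = root_char b (nat_digit b h (p - 1) * z) * wal_coeff b g h"
proof -
  note [measurable] = assms(3) measurable_digit_shift_unit[OF assms(1,2)] measurable_wal_unit[OF assms(1)]
  let ?w = "root_char b (nat_digit b h (p - 1) * z)" and ?T = "digit_shift b p z"
  have cm: "(\<lambda>x. cnj (wal b h x)) \<in> borel_measurable unit_measure"
    using L2_int_cnj[OF L2_int_bounded[OF finite_measure_unit_measure measurable_wal_unit[OF assms(1)]], of h 1]
    by (auto simp: norm_wal[OF assms(1)] L2_int_def)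
  have "wal_coeff b (\<lambda>x. g (?T x)) h = (LINT x|unit_measure. ?w * (g (?T x) * cnj (wal b h (?T x))))"
    unfolding wal_coeff_def
  proof (rule integral_cong_AE)
    show "AE x in unit_measure. g (?T x) * cnj (wal b h x) = ?w * (g (?T x) * cnj (wal b h (?T x)))"
      using AE_unit_measure_less_1
    proof eventually_elim
      case (elim x)
      have w: "?w * cnj ?w = 1"
        by (simp add: complex_norm_square[symmetric])
      have "?w * (g (?T x) * cnj (wal b h (?T x))) = ?w * (g (?T x) * (cnj ?w * cnj (wal b h x)))"
        using elim assms(1,2) by (simp add: wal_digit_shift)
      also have "\<dots> = (?w * cnj ?w) * (g (?T x) * cnj (wal b h x))"
        by (simp only: ac_simps)
      finally show ?case
        by (simp only: w mult_1)
    qed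
    show "(\<lambda>x. g (?T x) * cnj (wal b h x)) \<in> borel_measurable unit_measure"
      using cm by measurable
    show "(\<lambda>x. ?w * (g (?T x) * cnj (wal b h (?T x)))) \<in> borel_measurable unit_measure"
      using measurable_compose[OF measurable_digit_shift_unit[OF assms(1,2)] cm] by measurable
  qed
  also have "\<dots> = ?w * (LINT x|unit_measure. g (?T x) * cnj (wal b h (?T x)))"
    by simp
  also have "(LINT x|unit_measure. g (?T x) * cnj (wal b h (?T x))) = wal_coeff b g h"
    unfolding wal_coeff_def
    by (rule integral_digit_shift[OF assms(1,2), of "\<lambda>x. g x * cnj (wal b h x)"]) (use cm in measurable)
  finally show ?thesis .
qed

lemma L2_int_wal: "b \<ge> 2 \<Longrightarrow> L2_int unit_measure (wal b h)"
  by (rule L2_int_bounded[OF finite_measure_unit_measure, where B = 1]) (auto simp: norm_wal)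

lemma L2_int_cnj_wal: "b \<ge> 2 \<Longrightarrow> L2_int unit_measure (\<lambda>x. cnj (wal b h x))"
  by (rule L2_int_cnj[OF L2_int_wal])

section \<open>Orthonormality of the Walsh functions and Bessel's inequality\<close>

lemma nat_eq_sum_digits:
  assumes "k < b ^ N"
  shows "k = (\<Sum>r<N. nat_digit b k r * b ^ r)"
  using assms
proof (induction N arbitrary: k)
  case (Suc N)
  then have b: "b > 0" by (cases "b = 0") auto
  have "k div b < b ^ N"
    using Suc.prems b by (simp add: less_mult_imp_div_less mult.commute)
  then have "k div b = (\<Sum>r<N. nat_digit b (k div b) r * b ^ r)"
    by (rule Suc.IH)
  also have "\<dots> = (\<Sum>r<N. nat_digit b k (Suc r) * b ^ r)"
    by (simp add: nat_digit_def div_mult2_eq)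
  finally have *: "k div b = (\<Sum>r<N. nat_digit b k (Suc r) * b ^ r)" .
  have "k = k mod b + b * (k div b)" by simp
  also have "\<dots> = nat_digit b k 0 * b ^ 0 + (\<Sum>r<N. nat_digit b k (Suc r) * b ^ Suc r)"
    by (simp only: *) (simp add: nat_digit_def sum_distrib_left mult.left_commute)
  also have "\<dots> = (\<Sum>r<Suc N. nat_digit b k r * b ^ r)"
    by (simp only: sum.lessThan_Suc_shift)
  finally show ?case .
qed simp

lemma nat_digit_eqI:
  assumes "b \<ge> 2" "\<And>r. nat_digit b k r = nat_digit b k' r"
  shows "k = k'"
proof -
  have "k < b ^ (k + k')" "k' < b ^ (k + k')"
    using assms(1) by (simp_all add: less_power_base)
  then show ?thesis
    using nat_eq_sum_digits[of k b "k + k'"] nat_eq_sum_digits[of k' b "k + k'"] assms(2) by simp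
qed

lemma nat_digit_less: "b > 0 \<Longrightarrow> nat_digit b k r < b"
  by (simp add: nat_digit_def)

text \<open>For distinct frequencies choose an index where their digits differ. Shifting the dual
  digit multiplies the inner product by two different roots of unity, according to whether the
  factor is read off from \<open>k\<close> or from \<open>h\<close>, so the inner product is
  0.\<close>

lemma wal_coeff_wal:
  assumes "b \<ge> 2"
  shows "wal_coeff b (wal b k) h = (if k = h then 1 else 0)"
proof (cases "k = h")
  case True
  then show ?thesis
    using assms measure_unit_measure by (simp add: wal_coeff_def wal_cnj space_restrict_space)
next
  case False
  then obtain r where r: "nat_digit b k r \<noteq> nat_digit b h r"
    using nat_digit_eqI[OF assms] by blast
  let ?T = "digit_shift b (Suc r) 1" and ?k = "nat_digit b k r" and ?h = "nat_digit b h r"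
  note m = measurable_digit_shift_unit[OF assms, of "Suc r" 1] measurable_wal_unit[OF assms]
  note [measurable] = m
  have "wal_coeff b (\<lambda>x. wal b k (?T x)) h = (LINT x|unit_measure. root_char b ?k * (wal b k x * cnj (wal b h x)))"
    unfolding wal_coeff_def
  proof (rule integral_cong_AE)
    show "AE x in unit_measure. wal b k (?T x) * cnj (wal b h x) = root_char b ?k * (wal b k x * cnj (wal b h x))"
      using AE_unit_measure_less_1 by eventually_elim (simp add: wal_digit_shift[OF assms])
    show "(\<lambda>x. wal b k (?T x) * cnj (wal b h x)) \<in> borel_measurable unit_measure"
      using L2_int_measurable[OF L2_int_cnj_wal[OF assms, of h]] measurable_compose[OF m(1) m(2)] by simp
    show "(\<lambda>x. root_char b ?k * (wal b k x * cnj (wal b h x))) \<in> borel_measurable unit_measure"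
      using L2_int_measurable[OF L2_int_cnj_wal[OF assms, of h]] by simp
  qed
  also have "\<dots> = root_char b ?k * wal_coeff b (wal b k) h"
    by (simp add: wal_coeff_def)
  finally have "root_char b ?k * wal_coeff b (wal b k) h = root_char b ?h * wal_coeff b (wal b k) h"
    using wal_coeff_digit_shift[OF assms, of "Suc r" "wal b k" 1 h] m(2) by simp
  moreover have "root_char b ?k \<noteq> root_char b ?h"
  proof
    have *: "root_char b m \<noteq> root_char b n" if "m < n" "n < b" for m n
    proof
      assume "root_char b m = root_char b n"
      then have "root_char b m * root_char b (n - m) = root_char b m * 1"
        using root_char_add[of b m "n - m"] that by simp
      moreover have "root_char b m \<noteq> 0"
        by (simp add: root_char_def)
      ultimately have "b dvd n - m"
        using assms by (simp add: root_char_eq_1_iff)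
      then show False
        using that by (auto dest: dvd_imp_le)
    qed
    assume "root_char b ?k = root_char b ?h"
    then show False
      using *[of ?k ?h] *[of ?h ?k] r assms by (auto simp: nat_digit_less neq_iff)
  qed
  ultimately show ?thesis
    using False by auto
qed

text \<open>Expansion of the squared distance between \<open>g\<close> and its Walsh partial sum
  \<open>S\<close>: with \<open>A\<close> the sum of the squared coefficients, it equals the squared
  norm of \<open>g\<close> minus \<open>2 A\<close> plus \<open>A\<close>.\<close>

lemma wal_Bessel:
  assumes "b \<ge> 2" "L2_int unit_measure g" "finite H"
  shows "(\<Sum>h\<in>H. (cmod (wal_coeff b g h))\<^sup>2) \<le> (LINT x|unit_measure. (cmod (g x))\<^sup>2)"
proof -
  define c where "c = wal_coeff b g"
  define S where "S x = (\<Sum>h\<in>H. c h * wal b h x)" for x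
  define A where "A = (\<Sum>h\<in>H. (cmod (c h))\<^sup>2)"
  have S: "L2_int unit_measure S"
    unfolding S_def using assms by (intro L2_int_sum L2_int_cmult L2_int_wal)
  have Sc: "cnj (S x) = (\<Sum>h\<in>H. cnj (c h) * cnj (wal b h x))" for x
    by (simp add: S_def)
  \<comment> \<open>Needed for \<open>f = g\<close>, and for \<open>f = S\<close>, which has the
    same coefficients on \<open>H\<close>.\<close>
  have gS: "(LINT x|unit_measure. f x * cnj (S x)) = (\<Sum>h\<in>H. cnj (c h) * wal_coeff b f h)"
    if "L2_int unit_measure f" for f
  proof -
    have "(LINT x|unit_measure. f x * cnj (S x))
        = (LINT x|unit_measure. (\<Sum>h\<in>H. cnj (c h) * (f x * cnj (wal b h x))))"
      by (simp add: Sc sum_distrib_left mult.left_commute)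
    also have "\<dots> = (\<Sum>h\<in>H. LINT x|unit_measure. cnj (c h) * (f x * cnj (wal b h x)))"
      using L2_Cauchy_Schwarz(1)[OF that L2_int_cnj_wal[OF assms(1)]]
      by (intro Bochner_Integration.integral_sum) auto
    finally show ?thesis
      by (simp add: wal_coeff_def)
  qed
  have wS: "wal_coeff b S h = c h" if "h \<in> H" for h
  proof -
    have "wal_coeff b S h = (LINT x|unit_measure. (\<Sum>k\<in>H. c k * (wal b k x * cnj (wal b h x))))"
      by (simp add: wal_coeff_def S_def sum_distrib_right mult.assoc)
    also have "\<dots> = (\<Sum>k\<in>H. LINT x|unit_measure. c k * (wal b k x * cnj (wal b h x)))"
      using L2_Cauchy_Schwarz(1)[OF L2_int_wal[OF assms(1)] L2_int_cnj_wal[OF assms(1)]]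
      by (intro Bochner_Integration.integral_sum) auto
    also have "\<dots> = (\<Sum>k\<in>H. c k * wal_coeff b (wal b k) h)"
      by (simp add: wal_coeff_def)
    also have "\<dots> = c h"
      using that assms(3) by (simp add: wal_coeff_wal[OF assms(1)] if_distrib cong: if_cong)
    finally show ?thesis .
  qed
  have A: "(\<Sum>h\<in>H. cnj (c h) * c h) = of_real A"
    unfolding A_def of_real_sum complex_norm_square by (simp add: mult.commute)
  have i1: "(LINT x|unit_measure. g x * cnj (S x)) = of_real A"
    using gS[OF assms(2)] A by (simp add: c_def)
  have i2: "(LINT x|unit_measure. S x * cnj (S x)) = of_real A"
    using gS[OF S] A wS by (simp cong: sum.cong)
  note int = L2_Cauchy_Schwarz(1)[OF assms(2) L2_int_cnj[OF S]]
    L2_Cauchy_Schwarz(1)[OF S L2_int_cnj[OF S]]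
  have intn: "integrable unit_measure (\<lambda>x. (cmod (g x))\<^sup>2)" "integrable unit_measure (\<lambda>x. (cmod (S x))\<^sup>2)"
    using assms(2) S by (auto simp: L2_int_def)
  have j1: "(LINT x|unit_measure. Re (g x * cnj (S x))) = A"
    using i1 integral_Re[OF int(1)] by simp
  have j2: "(LINT x|unit_measure. (cmod (S x))\<^sup>2) = A"
  proof -
    have "(LINT x|unit_measure. (cmod (S x))\<^sup>2) = (LINT x|unit_measure. Re (S x * cnj (S x)))"
      by (intro Bochner_Integration.integral_cong) (simp_all add: complex_norm_square[symmetric] del: complex_cnj_mult)
    then show ?thesis
      using i2 integral_Re[OF int(2)] by simp
  qed
  define R where "R x = Re (g x * cnj (S x))" for x
  have R: "integrable unit_measure R" "(LINT x|unit_measure. R x) = A"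
    using integrable_Re[OF int(1)] j1 by (simp_all only: R_def[abs_def])
  have "0 \<le> (LINT x|unit_measure. (cmod (g x - S x))\<^sup>2)"
    by (intro Bochner_Integration.integral_nonneg) simp
  also have "\<dots> = (LINT x|unit_measure. (cmod (g x))\<^sup>2 - 2 * R x + (cmod (S x))\<^sup>2)"
    by (intro Bochner_Integration.integral_cong refl) (simp add: R_def cmod_power2, simp add: power2_eq_square algebra_simps)
  also have "\<dots> = (LINT x|unit_measure. (cmod (g x))\<^sup>2) - 2 * A + A"
    using intn R j2 by simp
  finally show ?thesis
    by (simp add: A_def c_def)
qed

section \<open>Averaged differences\<close>

lemma L2_int_digit_shift:
  assumes "b \<ge> 2" "p \<ge> 1" "L2_int unit_measure g"
  shows "L2_int unit_measure (\<lambda>x. g (digit_shift b p z x))"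
proof -
  have "integrable (distr unit_measure unit_measure (digit_shift b p z)) (\<lambda>x. (cmod (g x))\<^sup>2)"
    unfolding distr_digit_shift[OF assms(1,2)] using assms(3) by (simp add: L2_int_def)
  then have "integrable unit_measure (\<lambda>x. (cmod (g (digit_shift b p z x)))\<^sup>2)"
    by (subst (asm) integrable_distr_eq)
      (use measurable_digit_shift_unit[OF assms(1,2)] assms(3) in \<open>auto simp: L2_int_def\<close>)
  moreover have "(\<lambda>x. g (digit_shift b p z x)) \<in> borel_measurable unit_measure"
    by (rule measurable_compose[OF measurable_digit_shift_unit[OF assms(1,2)] L2_int_measurable[OF assms(3)]])
  ultimately show ?thesis
    by (simp add: L2_int_def)
qed

text \<open>Subtracts from \<open>g\<close> its averages over the digits in \<open>ps\<close>; this leaves unchanged the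
  Walsh coefficients at frequencies whose digits dual to \<open>ps\<close> are all nonzero.\<close>

fun digit_diff :: "nat \<Rightarrow> nat list \<Rightarrow> (real \<Rightarrow> complex) \<Rightarrow> real \<Rightarrow> complex" where
  "digit_diff b [] g = g"
| "digit_diff b (p # ps) g =
     (\<lambda>x. 1 / of_nat b * (\<Sum>z<b. digit_diff b ps g x - digit_diff b ps g (digit_shift b p z x)))"

lemma L2_int_digit_diff:
  assumes "b \<ge> 2" "\<And>p. p \<in> set ps \<Longrightarrow> p \<ge> 1" "L2_int unit_measure g"
  shows "L2_int unit_measure (digit_diff b ps g)"
  using assms(2)
proof (induction ps)
  case (Cons p ps)
  then show ?case
    unfolding digit_diff.simps using assms(1)
    by (intro L2_int_cmult L2_int_sum L2_int_diff L2_int_digit_shift) auto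
qed (use assms in simp)

text \<open>The average over the shifts of digit \<open>p\<close> has coefficient 0 here, since its
  factor is the sum of a nontrivial character over all residues; subtracting it changes
  nothing.\<close>

lemma wal_coeff_digit_diff:
  assumes "b \<ge> 2" "\<And>p. p \<in> set ps \<Longrightarrow> p \<ge> 1 \<and> nat_digit b h (p - 1) \<noteq> 0" "L2_int unit_measure g"
  shows "wal_coeff b (digit_diff b ps g) h = wal_coeff b g h"
  using assms(2)
proof (induction ps)
  case (Cons p ps)
  let ?g = "digit_diff b ps g" and ?\<kappa> = "nat_digit b h (p - 1)"
  let ?T = "digit_shift b p"
  have p: "p \<ge> 1" "?\<kappa> \<noteq> 0" using Cons.prems by auto
  have L: "L2_int unit_measure ?g"
    using Cons.prems assms by (intro L2_int_digit_diff) auto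
  note LT = L2_int_digit_shift[OF assms(1) p(1) L]
  note int = L2_Cauchy_Schwarz(1)[OF L L2_int_cnj_wal[OF assms(1), of h]]
    L2_Cauchy_Schwarz(1)[OF LT L2_int_cnj_wal[OF assms(1), of h]]
  have "wal_coeff b (digit_diff b (p # ps) g) h
      = (LINT x|unit_measure. 1 / of_nat b * (\<Sum>z<b. ?g x * cnj (wal b h x) - ?g (?T z x) * cnj (wal b h x)))"
    by (simp add: wal_coeff_def sum_distrib_right left_diff_distrib)
  also have "\<dots> = 1 / of_nat b * (\<Sum>z<b. wal_coeff b ?g h - wal_coeff b (\<lambda>x. ?g (?T z x)) h)"
    using int by (simp add: wal_coeff_def)
  also have "\<dots> = 1 / of_nat b * (of_nat b * wal_coeff b ?g h - (\<Sum>z<b. root_char b (?\<kappa> * z)) * wal_coeff b ?g h)"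
    using L2_int_measurable[OF L]
    by (simp only: wal_coeff_digit_shift[OF assms(1) p(1)] sum_subtractf sum_distrib_right[symmetric]) simp
  also have "(\<Sum>z<b. root_char b (?\<kappa> * z)) = 0"
    using p(2) assms(1) nat_digit_less[of b h "p - 1"] by (intro sum_root_char) (auto dest: dvd_imp_le)
  also have "1 / of_nat b * (of_nat b * wal_coeff b ?g h - 0 * wal_coeff b ?g h) = wal_coeff b ?g h"
    using assms(1) by simp
  also have "\<dots> = wal_coeff b g h"
    using Cons.prems by (intro Cons.IH) auto
  finally show ?case .
qed simp

text \<open>The digits which determine the offsets are those of a fixed point \<open>x\<close>, so that the result is
  as smooth in \<open>y\<close> as \<open>g\<close> is.\<close>

fun frozen_diff :: "nat \<Rightarrow> real \<Rightarrow> nat list \<Rightarrow> (real \<Rightarrow> complex) \<Rightarrow> real \<Rightarrow> complex" where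
  "frozen_diff b x [] g = g"
| "frozen_diff b x (p # ps) g =
     (\<lambda>y. 1 / of_nat b * (\<Sum>z<b. frozen_diff b x ps g y - frozen_diff b x ps g (y + digit_offset b p z x)))"

text \<open>The points from which all translates formed by \<open>frozen_diff\<close> stay in [0,1],
  where \<open>g\<close> is known to be differentiable.\<close>

fun frozen_dom :: "nat \<Rightarrow> real \<Rightarrow> nat list \<Rightarrow> real set" where
  "frozen_dom b x [] = {0..1}"
| "frozen_dom b x (p # ps) = {y \<in> frozen_dom b x ps. \<forall>z<b. y + digit_offset b p z x \<in> frozen_dom b x ps}"

lemma digit_diff_eq_frozen_diff:
  assumes "b \<ge> 2" "distinct ps" "\<And>p. p \<in> set ps \<Longrightarrow> p \<ge> 1" "0 \<le> y" "y < 1"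
    "\<And>p. p \<in> set ps \<Longrightarrow> real_digit b y p = real_digit b x p"
  shows "digit_diff b ps g y = frozen_diff b x ps g y \<and> y \<in> frozen_dom b x ps"
  using assms(2-)
proof (induction ps arbitrary: y)
  case (Cons p ps)
  have T: "digit_shift b p z y = y + digit_offset b p z x" for z
    using Cons.prems by (simp add: digit_shift_def digit_offset_def)
  have p: "p \<ge> 1" using Cons.prems by simp
  have 1: "digit_diff b ps g y = frozen_diff b x ps g y \<and> y \<in> frozen_dom b x ps"
    using Cons.prems by (intro Cons.IH) auto
  have 2: "digit_diff b ps g (digit_shift b p z y) = frozen_diff b x ps g (digit_shift b p z y)
      \<and> digit_shift b p z y \<in> frozen_dom b x ps" for z
    using Cons.prems digit_shift[OF assms(1) p, of y z] by (intro Cons.IH) auto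
  show ?case
    using 1 2 by (simp add: T)
qed auto

text \<open>Convexity of the domain allows an increment to be integrated along the segment between
  two of its points.\<close>

lemma frozen_dom_between:
  assumes "y \<in> frozen_dom b x ps" "y' \<in> frozen_dom b x ps" "y \<le> t" "t \<le> y'"
  shows "t \<in> frozen_dom b x ps"
  using assms
proof (induction ps arbitrary: y y' t)
  case (Cons p ps)
  have "t + digit_offset b p z x \<in> frozen_dom b x ps" if "z < b" for z
    by (rule Cons.IH[of "y + digit_offset b p z x" "y' + digit_offset b p z x"]) (use Cons.prems that in simp_all)
  moreover have "t \<in> frozen_dom b x ps"
    by (rule Cons.IH[of y y']) (use Cons.prems in simp_all)
  ultimately show ?case by simp
qed auto

lemma has_vector_derivative_translate:
  assumes "(f has_vector_derivative f') (at (y + c) within S)" "\<And>t. t \<in> T \<Longrightarrow> t + c \<in> S"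
  shows "((\<lambda>t::real. f (t + c)) has_vector_derivative f') (at y within T)"
proof -
  have "((\<lambda>t. t + c) has_vector_derivative 1) (at y within T)"
    by (auto intro!: derivative_eq_intros)
  moreover have "(f has_vector_derivative f') (at (y + c) within (\<lambda>t. t + c) ` T)"
    using assms by (auto intro: has_vector_derivative_within_subset)
  ultimately have "((f \<circ> (\<lambda>t. t + c)) has_vector_derivative 1 *\<^sub>R f') (at y within T)"
    by (rule vector_diff_chain_within)
  then show ?thesis by (simp add: o_def)
qed

text \<open>Frozen displacements are constants, so taking differences commutes with
  differentiation.\<close>

lemma has_vector_derivative_frozen_diff:
  assumes "\<And>t. t \<in> {0..1} \<Longrightarrow> (g has_vector_derivative g' t) (at t within {0..1})" "y \<in> frozen_dom b x ps"
  shows "(frozen_diff b x ps g has_vector_derivative frozen_diff b x ps g' y) (at y within frozen_dom b x ps)"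
  using assms(2)
proof (induction ps arbitrary: y)
  case (Cons p ps)
  let ?D = "frozen_dom b x (p # ps)" and ?f = "frozen_diff b x ps"
  have 1: "(?f g has_vector_derivative ?f g' y) (at y within ?D)"
    using Cons.prems by (intro has_vector_derivative_within_subset[OF Cons.IH]) auto
  have 2: "((\<lambda>t. ?f g (t + digit_offset b p z x)) has_vector_derivative ?f g' (y + digit_offset b p z x)) (at y within ?D)"
    if "z < b" for z
    using Cons.prems that by (intro has_vector_derivative_translate[OF Cons.IH]) auto
  have "((\<lambda>y. 1 / of_nat b * (\<Sum>z<b. ?f g y - ?f g (y + digit_offset b p z x))) has_vector_derivative
      1 / of_nat b * (\<Sum>z<b. ?f g' y - ?f g' (y + digit_offset b p z x))) (at y within ?D)"
    by (intro has_vector_derivative_mult_right has_vector_derivative_sum has_vector_derivative_diff 1 2) auto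
  then show ?case by simp
qed (use assms in simp)

lemma continuous_on_frozen_diff:
  assumes "continuous_on {0..1} g"
  shows "continuous_on (frozen_dom b x ps) (frozen_diff b x ps g)"
proof (induction ps)
  case (Cons p ps)
  have "continuous_on (frozen_dom b x (p # ps)) (frozen_diff b x ps g)"
    by (rule continuous_on_subset[OF Cons]) auto
  moreover have "continuous_on (frozen_dom b x (p # ps)) (\<lambda>y. frozen_diff b x ps g (y + digit_offset b p z x))"
    if "z < b" for z
    using that by (intro continuous_on_compose2[OF Cons] continuous_intros) auto
  ultimately show ?case
    unfolding frozen_diff.simps by (intro continuous_on_mult_left continuous_on_sum continuous_on_diff) auto
qed (use assms in simp)

lemma finite_measure_interval: "finite_measure (restrict_space lborel {a..c::real})"
  by (rule finite_measureI) (simp add: emeasure_restrict_space space_restrict_space emeasure_lborel_Icc_eq)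

lemma L2_int_continuous_on_interval:
  assumes "continuous_on {a..c::real} f"
  shows "L2_int (restrict_space lborel {a..c}) f"
proof -
  have "bounded (f ` {a..c})"
    by (intro compact_imp_bounded compact_continuous_image assms) simp
  then obtain B where B: "\<forall>y\<in>f ` {a..c}. cmod y \<le> B"
    unfolding bounded_iff by blast
  have "f \<in> borel_measurable (restrict_space borel {a..c})"
    by (rule borel_measurable_continuous_on_restrict[OF assms])
  then have "f \<in> borel_measurable (restrict_space lborel {a..c})"
    by (simp cong: measurable_cong_sets restrict_space_sets_cong)
  then show ?thesis
    using B by (intro L2_int_bounded[OF finite_measure_interval]) (auto simp: space_restrict_space)
qed

text \<open>The increment is the integral of \<open>e'\<close> against the constant 1, whose squared
  norm is \<open>c - a\<close>; Cauchy-Schwarz does the rest.\<close>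

lemma increment_square_le:
  fixes e e' :: "real \<Rightarrow> complex"
  assumes "a \<le> c" "\<And>t. t \<in> {a..c} \<Longrightarrow> (e has_vector_derivative e' t) (at t within {a..c})"
    "continuous_on {a..c} e'"
  shows "ennreal ((cmod (e c - e a))\<^sup>2)
    \<le> ennreal (c - a) * (\<integral>\<^sup>+t. indicator {a..c} t * ennreal ((cmod (e' t))\<^sup>2) \<partial>lborel)"
proof -
  define N :: "real measure" where "N = restrict_space lborel {a..c}"
  have emeas: "emeasure N (space N) = ennreal (c - a)"
    using assms(1) by (simp add: N_def space_restrict_space emeasure_restrict_space)
  have L: "L2_int N e'"
    unfolding N_def by (rule L2_int_continuous_on_interval[OF assms(3)])
  have one: "L2_int N (\<lambda>_. 1)"
    unfolding N_def by (intro L2_int_bounded[OF finite_measure_interval, where B = 1]) auto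
  have one': "(L2_norm_on N (\<lambda>_. 1))\<^sup>2 = c - a"
    using emeas assms(1) by (simp add: L2_norm_on_square measure_def)
  have "(LINT t|N. e' t * 1) = (LINT t|lborel. indicator {a..c} t *\<^sub>R e' t)"
    by (simp add: N_def integral_restrict_space)
  also have "\<dots> = e c - e a"
    by (rule integral_FTC_atLeastAtMost) (use assms in auto)
  finally have "cmod (e c - e a) \<le> L2_norm_on N e' * L2_norm_on N (\<lambda>_. 1)"
    using L2_Cauchy_Schwarz(3)[OF L one] by simp
  then have "(cmod (e c - e a))\<^sup>2 \<le> (L2_norm_on N e' * L2_norm_on N (\<lambda>_. 1))\<^sup>2"
    by (intro power_mono) auto
  also have "\<dots> = (c - a) * (L2_norm_on N e')\<^sup>2"
    by (simp add: power_mult_distrib one')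
  finally have "ennreal ((cmod (e c - e a))\<^sup>2) \<le> ennreal (c - a) * ennreal ((L2_norm_on N e')\<^sup>2)"
    using assms(1) by (simp add: ennreal_mult[symmetric] ennreal_leI)
  also have "ennreal ((L2_norm_on N e')\<^sup>2) = (\<integral>\<^sup>+t. indicator {a..c} t * ennreal ((cmod (e' t))\<^sup>2) \<partial>lborel)"
    unfolding nn_integral_L2_int[OF L, symmetric] by (simp add: N_def nn_integral_restrict_space mult.commute)
  finally show ?thesis .
qed

definition max_offset :: "nat \<Rightarrow> nat \<Rightarrow> real" where
  "max_offset b p = (real b - 1) / real b ^ p"

lemma max_offset_nonneg: "b \<ge> 2 \<Longrightarrow> 0 \<le> max_offset b p"
  by (simp add: max_offset_def)

lemma digit_offset_le:
  assumes "b \<ge> 2"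
  shows "\<bar>digit_offset b p z x\<bar> \<le> max_offset b p"
proof -
  have "(real_digit b x p + z) mod b < b" "real_digit b x p < b"
    using assms real_digit_less[OF assms, of x p] by auto
  then have "\<bar>real ((real_digit b x p + z) mod b) - real (real_digit b x p)\<bar> \<le> real b - 1"
    using assms by linarith
  then show ?thesis
    using assms by (simp add: digit_offset_def max_offset_def divide_right_mono)
qed

text \<open>The majorant from iterating \<open>increment_square_le\<close>: the factor bounds the
  length of the segment, and the window is two-sided because the displacement may have either sign.
  No digit of any point enters. Values in \<open>ennreal\<close> allow integration without
  integrability conditions.\<close>

fun smear :: "nat \<Rightarrow> nat list \<Rightarrow> (real \<Rightarrow> ennreal) \<Rightarrow> real \<Rightarrow> ennreal" where
  "smear b [] G = G"
| "smear b (p # ps) G = (\<lambda>y. ennreal (max_offset b p) *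
     (\<integral>\<^sup>+s. indicator {y - max_offset b p..y + max_offset b p} s * smear b ps G s \<partial>lborel))"

lemma measurable_smear [measurable]:
  assumes [measurable]: "G \<in> borel_measurable borel"
  shows "smear b ps G \<in> borel_measurable borel"
proof (induction ps)
  case (Cons p ps)
  note [measurable] = Cons
  have "(\<lambda>y. \<integral>\<^sup>+s. (if y - max_offset b p \<le> s \<and> s \<le> y + max_offset b p then smear b ps G s else 0) \<partial>lborel)
      \<in> borel_measurable borel"
    by measurable
  also have "(\<lambda>y. \<integral>\<^sup>+s. (if y - max_offset b p \<le> s \<and> s \<le> y + max_offset b p then smear b ps G s else 0) \<partial>lborel)
      = (\<lambda>y. \<integral>\<^sup>+s. indicator {y - max_offset b p..y + max_offset b p} s * smear b ps G s \<partial>lborel)"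
    by (intro ext nn_integral_cong) (auto simp: indicator_def)
  finally show ?case by simp
qed simp

text \<open>After exchanging the integrals, each \<open>s\<close> is met by the windows centred in
  an interval of length \<open>2 * max_offset b p\<close>; with the factor in front this gives the 2
  and the square.\<close>

lemma nn_integral_smear:
  assumes "b \<ge> 2" and [measurable]: "G \<in> borel_measurable borel"
  shows "(\<integral>\<^sup>+y. smear b ps G y \<partial>lborel) = ennreal (\<Prod>p\<leftarrow>ps. 2 * (max_offset b p)\<^sup>2) * (\<integral>\<^sup>+y. G y \<partial>lborel)"
proof (induction ps)
  case (Cons p ps)
  let ?e = "max_offset b p" and ?Q = "smear b ps G"
  have e: "?e \<ge> 0" by (rule max_offset_nonneg[OF assms(1)])
  have prod: "0 \<le> (\<Prod>p\<leftarrow>ps. 2 * (max_offset b p)\<^sup>2)"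
    by (intro prod_list_nonneg) auto
  have "(\<integral>\<^sup>+y. smear b (p # ps) G y \<partial>lborel)
      = ennreal ?e * (\<integral>\<^sup>+y. (\<integral>\<^sup>+s. (if y - ?e \<le> s \<and> s \<le> y + ?e then ?Q s else 0) \<partial>lborel) \<partial>lborel)"
    by (subst nn_integral_cmult[symmetric], measurable)
      (auto intro!: nn_integral_cong arg_cong2[where f = times] simp: indicator_def)
  also have "(\<integral>\<^sup>+y. (\<integral>\<^sup>+s. (if y - ?e \<le> s \<and> s \<le> y + ?e then ?Q s else 0) \<partial>lborel) \<partial>lborel)
      = (\<integral>\<^sup>+s. (\<integral>\<^sup>+y. (if y - ?e \<le> s \<and> s \<le> y + ?e then ?Q s else 0) \<partial>lborel) \<partial>lborel)"
    by (rule lborel_pair.Fubini'[symmetric]) measurable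
  also have "\<dots> = (\<integral>\<^sup>+s. ?Q s * ennreal (2 * ?e) \<partial>lborel)"
  proof (rule nn_integral_cong)
    fix s
    have "(\<integral>\<^sup>+y. (if y - ?e \<le> s \<and> s \<le> y + ?e then ?Q s else 0) \<partial>lborel)
        = (\<integral>\<^sup>+y. ?Q s * indicator {s - ?e..s + ?e} y \<partial>lborel)"
      by (intro nn_integral_cong) (auto simp: indicator_def)
    also have "\<dots> = ?Q s * ennreal (2 * ?e)"
      using e by (subst nn_integral_cmult_indicator) auto
    finally show "(\<integral>\<^sup>+y. (if y - ?e \<le> s \<and> s \<le> y + ?e then ?Q s else 0) \<partial>lborel) = ?Q s * ennreal (2 * ?e)" .
  qed
  also have "\<dots> = (\<integral>\<^sup>+s. ?Q s \<partial>lborel) * ennreal (2 * ?e)"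
    by (rule nn_integral_multc) measurable
  also have "ennreal ?e * \<dots> = (ennreal ?e * ennreal (2 * ?e)) * ennreal (\<Prod>p\<leftarrow>ps. 2 * (max_offset b p)\<^sup>2) * (\<integral>\<^sup>+y. G y \<partial>lborel)"
    by (simp add: Cons ac_simps)
  also have "ennreal ?e * ennreal (2 * ?e) * ennreal (\<Prod>p\<leftarrow>ps. 2 * (max_offset b p)\<^sup>2)
      = ennreal (\<Prod>p\<leftarrow>p # ps. 2 * (max_offset b p)\<^sup>2)"
    using e prod by (simp add: ennreal_mult[symmetric] power2_eq_square ac_simps)
  finally show ?case .
qed simp

text \<open>The outer difference averages increments of \<open>h\<close>, whose derivative
  \<open>h'\<close> is a frozen difference of \<open>g 1\<close> over one position fewer. The
  induction hypothesis for the chain starting at \<open>g 1\<close> bounds \<open>h'\<close> along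
  the whole segment.\<close>

lemma frozen_diff_le_smear:
  fixes g :: "nat \<Rightarrow> real \<Rightarrow> complex"
  assumes "b \<ge> 2"
    and "\<And>k t. k < length ps \<Longrightarrow> t \<in> {0..1} \<Longrightarrow> (g k has_vector_derivative g (Suc k) t) (at t within {0..1})"
    and "continuous_on {0..1} (g (length ps))"
    and "y \<in> frozen_dom b x ps"
  shows "ennreal ((cmod (frozen_diff b x ps (g 0) y))\<^sup>2)
    \<le> smear b ps (\<lambda>t. indicator {0..1} t * ennreal ((cmod (g (length ps) t))\<^sup>2)) y"
  using assms(2-4)
proof (induction ps arbitrary: g y)
  case (Cons p ps)
  let ?G = "\<lambda>t. indicator {0..1} t * ennreal ((cmod (g (length (p # ps)) t))\<^sup>2)"
  let ?e = "max_offset b p" and ?D = "frozen_dom b x ps"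
  define h where "h = frozen_diff b x ps (g 0)"
  define h' where "h' = frozen_diff b x ps (g 1)"
  \<comment> \<open>If further positions follow, \<open>g 1\<close> is continuous because it has a
    derivative; otherwise it is the last function of the chain, continuous by assumption.\<close>
  have cont: "continuous_on {0..1} (g 1)"
  proof (cases ps)
    case (Cons q qs)
    then show ?thesis
      using Cons.prems(1)[of 1] by (intro continuous_on_vector_derivative[of _ _ "g 2"]) (auto simp: numeral_2_eq_2)
  qed (use Cons.prems in simp)
  have h': "ennreal ((cmod (h' t))\<^sup>2) \<le> smear b ps ?G t" if "t \<in> ?D" for t
    unfolding h'_def using Cons.IH[of "\<lambda>k. g (Suc k)" t] Cons.prems that by auto
  have der: "(h has_vector_derivative h' t) (at t within {u..w})" if "{u..w} \<subseteq> ?D" "t \<in> {u..w}" for t u w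
    unfolding h_def h'_def using that Cons.prems(1)[of 0]
    by (intro has_vector_derivative_within_subset[OF has_vector_derivative_frozen_diff]) auto
  have cont': "continuous_on {u..w} h'" if "{u..w} \<subseteq> ?D" for u w
    unfolding h'_def using that by (intro continuous_on_subset[OF continuous_on_frozen_diff[OF cont]])
  have seg: "ennreal ((cmod (h w - h u))\<^sup>2) \<le> smear b (p # ps) ?G y"
    if "u \<le> w" "u \<in> ?D" "w \<in> ?D" "y - ?e \<le> u" "w \<le> y + ?e" "w - u \<le> ?e" for u w
  proof -
    have D: "{u..w} \<subseteq> ?D"
      using frozen_dom_between[OF that(2,3)] by auto
    have "ennreal ((cmod (h w - h u))\<^sup>2)
        \<le> ennreal (w - u) * (\<integral>\<^sup>+t. indicator {u..w} t * ennreal ((cmod (h' t))\<^sup>2) \<partial>lborel)"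
      by (rule increment_square_le[OF that(1) der[OF D] cont'[OF D]])
    also have "\<dots> \<le> ennreal ?e * (\<integral>\<^sup>+t. indicator {y - ?e..y + ?e} t * smear b ps ?G t \<partial>lborel)"
    proof (rule mult_mono[OF ennreal_leI[OF that(6)] nn_integral_mono])
      fix t
      show "indicator {u..w} t * ennreal ((cmod (h' t))\<^sup>2) \<le> indicator {y - ?e..y + ?e} t * smear b ps ?G t"
      proof (cases "t \<in> {u..w}")
        case True
        then have "t \<in> {y - ?e..y + ?e}" "t \<in> ?D"
          using that D by auto
        then show ?thesis
          using True h'[of t] by (simp only: indicator_simps mult_1)
      qed simp
    qed simp_all
    finally show ?thesis by simp
  qed
  \<comment> \<open>\<open>seg\<close> is applied to the two points in increasing order, whichever
    it is.\<close>
  have each: "ennreal ((cmod (h y - h (y + digit_offset b p z x)))\<^sup>2) \<le> smear b (p # ps) ?G y" if "z < b" for z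
  proof -
    let ?d = "digit_offset b p z x"
    have d: "\<bar>?d\<bar> \<le> ?e" by (rule digit_offset_le[OF assms(1)])
    have D: "y \<in> ?D" "y + ?d \<in> ?D" using Cons.prems(3) that by auto
    show ?thesis
      using seg[of y "y + ?d"] seg[of "y + ?d" y] d D by (cases "?d \<ge> 0") (auto simp: norm_minus_commute)
  qed
  \<comment> \<open>An infinite majorant leaves nothing to prove; a finite value \<open>c\<close>
    bounds each of the \<open>b\<close> increments by \<open>sqrt c\<close>, hence also their
    mean.\<close>
  show ?case
  proof (cases "smear b (p # ps) ?G y")
    case (real c)
    have "cmod (h y - h (y + digit_offset b p z x)) \<le> sqrt c" if "z < b" for z
      using each[OF that] real by (intro real_le_rsqrt) simp
    then have "cmod (\<Sum>z<b. h y - h (y + digit_offset b p z x)) \<le> of_nat (card {..<b}) * sqrt c"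
      by (intro sum_norm_bound) auto
    then have "cmod (frozen_diff b x (p # ps) (g 0) y) \<le> sqrt c"
      using assms(1) by (simp add: h_def norm_mult norm_divide field_simps)
    then have "(cmod (frozen_diff b x (p # ps) (g 0) y))\<^sup>2 \<le> (sqrt c)\<^sup>2"
      by (intro power_mono) auto
    then show ?thesis
      using real by (simp only: real_sqrt_pow2) (simp add: ennreal_leI)
  qed simp
qed (simp add: indicator_def)

text \<open>\<open>g\<close> is a chain in which each function is the derivative of the one before;
  in the induction over coordinates, Walsh integrals over the other variables are supplied as such a
  chain.\<close>

theorem wal_coeff_sum_le:
  fixes g :: "nat \<Rightarrow> real \<Rightarrow> complex"
  assumes "b \<ge> 2" "finite H" "distinct ps" "\<And>p. p \<in> set ps \<Longrightarrow> p \<ge> 1"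
    and "\<And>p h. p \<in> set ps \<Longrightarrow> h \<in> H \<Longrightarrow> nat_digit b h (p - 1) \<noteq> 0"
    and der: "\<And>k t. k < length ps \<Longrightarrow> t \<in> {0..1} \<Longrightarrow> (g k has_vector_derivative g (Suc k) t) (at t within {0..1})"
    and cont: "continuous_on {0..1} (g (length ps))"
  shows "(\<Sum>h\<in>H. (cmod (wal_coeff b (g 0) h))\<^sup>2)
    \<le> (\<Prod>p\<leftarrow>ps. 2 * (max_offset b p)\<^sup>2) * (LINT t|unit_measure. (cmod (g (length ps) t))\<^sup>2)"
proof -
  let ?n = "length ps" and ?P = "\<Prod>p\<leftarrow>ps. 2 * (max_offset b p)\<^sup>2"
  have L: "L2_int unit_measure f" and M: "(\<lambda>t. indicator {0..1} t * ennreal ((cmod (f t))\<^sup>2)) \<in> borel_measurable borel"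
    if f: "continuous_on {0..1} f" for f :: "real \<Rightarrow> complex"
  proof -
    show "L2_int unit_measure f"
      by (rule L2_int_continuous_on_interval[OF f])
    have m: "f \<in> borel_measurable (restrict_space borel {0..1})"
      by (rule borel_measurable_continuous_on_restrict[OF f])
    have "(\<lambda>t. ennreal ((cmod (f t))\<^sup>2)) \<in> borel_measurable (restrict_space borel {0..1})"
      using m by measurable
    then show "(\<lambda>t. indicator {0..1} t * ennreal ((cmod (f t))\<^sup>2)) \<in> borel_measurable borel"
      by (subst (asm) borel_measurable_restrict_space_iff_ennreal) (auto simp: mult.commute)
  qed
  have cont0: "continuous_on {0..1} (g 0)"
    using der[of 0] cont by (cases "?n = 0") (auto intro: continuous_on_vector_derivative[of _ _ "g 1"])
  let ?d = "digit_diff b ps (g 0)"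
  have P: "0 \<le> ?P" by (intro prod_list_nonneg) auto
  have "(\<Sum>h\<in>H. (cmod (wal_coeff b (g 0) h))\<^sup>2) = (\<Sum>h\<in>H. (cmod (wal_coeff b ?d h))\<^sup>2)"
    using assms(1,4,5) L[OF cont0] by (intro sum.cong refl) (simp add: wal_coeff_digit_diff)
  also have "\<dots> \<le> (L2_norm_on unit_measure ?d)\<^sup>2"
    unfolding L2_norm_on_square using assms(1,2,4) L[OF cont0] by (intro wal_Bessel L2_int_digit_diff)
  finally have "ennreal (\<Sum>h\<in>H. (cmod (wal_coeff b (g 0) h))\<^sup>2) \<le> ennreal ((L2_norm_on unit_measure ?d)\<^sup>2)"
    by (rule ennreal_leI)
  also have "\<dots> = (\<integral>\<^sup>+x. ennreal ((cmod (?d x))\<^sup>2) \<partial>unit_measure)"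
    using assms(1,4) L[OF cont0] by (intro nn_integral_L2_int[symmetric] L2_int_digit_diff)
  \<comment> \<open>Here the freezing point and the point of evaluation are both \<open>x\<close>;
    the majorant no longer refers to its digits.\<close>
  also have "\<dots> \<le> (\<integral>\<^sup>+x. smear b ps (\<lambda>t. indicator {0..1} t * ennreal ((cmod (g ?n t))\<^sup>2)) x \<partial>unit_measure)"
  proof (rule nn_integral_mono_AE, use AE_unit_measure_less_1 in eventually_elim)
    case (elim x)
    have "?d x = frozen_diff b x ps (g 0) x \<and> x \<in> frozen_dom b x ps"
      using assms(1,3,4) elim by (intro digit_diff_eq_frozen_diff) auto
    then show ?case
      using frozen_diff_le_smear[OF assms(1) der cont] by simp
  qed
  \<comment> \<open>Enlarging the domain to the whole line makes the integral of
    \<open>smear\<close> computable exactly.\<close>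
  also have "\<dots> \<le> (\<integral>\<^sup>+x. smear b ps (\<lambda>t. indicator {0..1} t * ennreal ((cmod (g ?n t))\<^sup>2)) x \<partial>lborel)"
    by (subst nn_integral_restrict_space) (auto intro!: nn_integral_mono simp: indicator_def)
  also have "\<dots> = ennreal ?P * (\<integral>\<^sup>+t. indicator {0..1} t * ennreal ((cmod (g ?n t))\<^sup>2) \<partial>lborel)"
    by (rule nn_integral_smear[OF assms(1) M[OF cont]])
  also have "(\<integral>\<^sup>+t. indicator {0..1} t * ennreal ((cmod (g ?n t))\<^sup>2) \<partial>lborel) = ennreal ((L2_norm_on unit_measure (g ?n))\<^sup>2)"
    unfolding nn_integral_L2_int[OF L[OF cont], symmetric] by (simp add: nn_integral_restrict_space mult.commute)
  also have "ennreal ?P * \<dots> = ennreal (?P * (LINT t|unit_measure. (cmod (g ?n t))\<^sup>2))"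
    using P by (simp add: ennreal_mult[symmetric] L2_norm_on_square)
  finally show ?thesis
    using P by (simp add: Bochner_Integration.integral_nonneg)
qed

section \<open>Smooth functions on the cube\<close>

interpretation unit_product: product_sigma_finite "\<lambda>_::nat. unit_measure"
  by (rule product_sigma_finite.intro) (rule finite_measure.axioms(1)[OF finite_measure_unit_measure])

lemma space_cube: "space (cube u) = cube_set u"
  by (simp add: cube_def cube_set_def space_PiM space_restrict_space)

lemma emeasure_cube: "finite u \<Longrightarrow> emeasure (cube u) (cube_set u) = 1"
  unfolding cube_def cube_set_def
  by (subst unit_product.emeasure_PiM) (auto simp: emeasure_unit_measure sets_restrict_space)

lemma finite_measure_cube: "finite u \<Longrightarrow> finite_measure (cube u)"
  by (rule finite_measureI) (simp add: space_cube emeasure_cube)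

lemma measure_cube: "finite u \<Longrightarrow> measure (cube u) (cube_set u) = 1"
  by (simp add: measure_def emeasure_cube)

text \<open>Off \<open>u\<close> the coordinates are pinned to \<open>undefined\<close>, so the cube
  is a product of compact sets over all indices and Tychonoff's theorem applies.\<close>

lemma compact_cube_set: "compact (cube_set u)"
proof -
  have "cube_set u = PiE UNIV (\<lambda>i. if i \<in> u then {0..1} else {undefined})"
    by (auto simp: cube_set_def PiE_def Pi_def extensional_def split: if_splits)
  moreover have "compactin (product_topology (\<lambda>i::nat. euclidean) UNIV)
      (PiE UNIV (\<lambda>i. if i \<in> u then {0..1::real} else {undefined}))"
    by (subst compactin_PiE) auto
  ultimately show ?thesis
    by (simp add: euclidean_product_topology)
qed

text \<open>The Borel sets of the function space are generated by the countably many coordinates,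
  and those outside \<open>u\<close> are constant on the cube. This makes continuous functions
  measurable for the product measure.\<close>

lemma measurable_cube_ident: "(\<lambda>x. x) \<in> cube u \<rightarrow>\<^sub>M borel"
proof (rule measurable_coordinatewise_then_product)
  fix i
  show "(\<lambda>x. x i) \<in> borel_measurable (cube u)"
  proof (cases "i \<in> u")
    case True
    have "(\<lambda>x. x i) \<in> cube u \<rightarrow>\<^sub>M unit_measure"
      unfolding cube_def using True by (rule measurable_component_singleton)
    then show ?thesis
      by (rule measurable_compose) (simp add: measurable_restrict_space1)
  next
    case False
    then have "x i = undefined" if "x \<in> space (cube u)" for x
      using that by (auto simp: space_cube cube_set_def PiE_def extensional_def)
    then show ?thesis
      by (subst measurable_cong[where g = "\<lambda>_. undefined"]) auto
  qed
qed

lemma measurable_cube_continuous: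
  fixes F :: "(nat \<Rightarrow> real) \<Rightarrow> 'a::topological_space"
  assumes "continuous_on (cube_set u) F"
  shows "F \<in> borel_measurable (cube u)"
proof -
  have "(\<lambda>x. x) \<in> cube u \<rightarrow>\<^sub>M restrict_space borel (cube_set u)"
    by (rule measurable_restrict_space2) (auto simp: space_cube measurable_cube_ident)
  from measurable_compose[OF this borel_measurable_continuous_on_restrict[OF assms]]
  show ?thesis by simp
qed

lemma bounded_cube_continuous:
  fixes F :: "(nat \<Rightarrow> real) \<Rightarrow> 'a::real_normed_vector"
  assumes "continuous_on (cube_set u) F"
  obtains B where "\<And>x. x \<in> cube_set u \<Longrightarrow> norm (F x) \<le> B"
proof -
  have "bounded (F ` cube_set u)"
    by (intro compact_imp_bounded compact_continuous_image assms compact_cube_set)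
  then obtain B where "\<forall>y\<in>F ` cube_set u. norm y \<le> B"
    unfolding bounded_iff by blast
  then show thesis
    by (intro that[of B]) auto
qed

lemma L2_int_cube_continuous:
  assumes "continuous_on (cube_set u) F" "finite u"
  shows "L2_int (cube u) F"
proof -
  obtain B where "\<And>x. x \<in> cube_set u \<Longrightarrow> norm (F x) \<le> B"
    using bounded_cube_continuous[OF assms(1)] by blast
  then show ?thesis
    by (intro L2_int_bounded[OF finite_measure_cube[OF assms(2)] measurable_cube_continuous[OF assms(1)]])
      (auto simp: space_cube)
qed

lemma integrable_cube_bounded:
  fixes F :: "(nat \<Rightarrow> real) \<Rightarrow> complex"
  assumes "finite u" "F \<in> borel_measurable (cube u)" "\<And>x. x \<in> cube_set u \<Longrightarrow> cmod (F x) \<le> B"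
  shows "integrable (cube u) F"
  by (intro finite_measure.integrable_const_bound[OF finite_measure_cube[OF assms(1)], where B = B] AE_I2 assms)
    (auto simp: space_cube)

lemma cube_set_upd: "x \<in> cube_set u \<Longrightarrow> t \<in> {0..1} \<Longrightarrow> x(i := t) \<in> cube_set (insert i u)"
  by (auto simp: cube_set_def PiE_def extensional_def Pi_def)

lemma cube_set_upd_in: "x \<in> cube_set u \<Longrightarrow> i \<in> u \<Longrightarrow> t \<in> {0..1} \<Longrightarrow> x(i := t) \<in> cube_set u"
  using cube_set_upd[of x u t i] by (simp add: insert_absorb)

lemma cube_set_component: "x \<in> cube_set u \<Longrightarrow> i \<in> u \<Longrightarrow> x i \<in> {0..1}"
  by (auto simp: cube_set_def)

lemma cube_set_merge:
  "u \<inter> w = {} \<Longrightarrow> x \<in> cube_set u \<Longrightarrow> y \<in> cube_set w \<Longrightarrow> merge u w (x, y) \<in> cube_set (u \<union> w)"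
  by (auto simp: cube_set_def merge_def PiE_def extensional_def Pi_def)

text \<open>Stated for Banach-valued \<open>F\<close>, since it serves both the complex Walsh
  integrand and the real square of a derivative. The new coordinate is the outer variable, as the
  one-dimensional inequality is applied in it.\<close>

lemma integrable_cube_insert:
  fixes F :: "(nat \<Rightarrow> real) \<Rightarrow> 'a::{banach, second_countable_topology}"
  assumes "finite u" "i \<notin> u" "integrable (cube (insert i u)) F"
  shows "integrable unit_measure (\<lambda>t. LINT x|cube u. F (x(i := t)))"
    and "(LINT x|cube (insert i u). F x) = (LINT t|unit_measure. LINT x|cube u. F (x(i := t)))"
proof -
  interpret P: pair_sigma_finite unit_measure "cube u"
    unfolding cube_def using assms(1)
    by (intro pair_sigma_finite.intro unit_product.sigma_finite unit_product.sigma_finite_measures)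
  have m: "(\<lambda>(t, x). x(i := t)) \<in> (unit_measure \<Otimes>\<^sub>M cube u) \<rightarrow>\<^sub>M cube (insert i u)"
    unfolding cube_def by measurable
  have F: "F \<in> borel_measurable (cube (insert i u))"
    using assms(3) by simp
  then have Fm: "(\<lambda>(t, x). F (x(i := t))) \<in> borel_measurable (unit_measure \<Otimes>\<^sub>M cube u)"
    using measurable_compose[OF m F] by (simp add: case_prod_beta)
  have "(\<integral>\<^sup>+z. ennreal (norm (case z of (t, x) \<Rightarrow> F (x(i := t)))) \<partial>(unit_measure \<Otimes>\<^sub>M cube u))
      = (\<integral>\<^sup>+t. \<integral>\<^sup>+x. ennreal (norm (F (x(i := t)))) \<partial>cube u \<partial>unit_measure)"
    using Fm by (subst P.M2.nn_integral_fst[symmetric]) (auto simp: case_prod_beta)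
  also have "\<dots> = (\<integral>\<^sup>+x. ennreal (norm (F x)) \<partial>cube (insert i u))"
    using F unfolding cube_def
    by (subst unit_product.product_nn_integral_insert_rev[OF assms(1,2)]) auto
  also have "\<dots> < \<infinity>"
    using assms(3) by (simp add: integrable_iff_bounded)
  finally have int: "integrable (unit_measure \<Otimes>\<^sub>M cube u) (\<lambda>(t, x). F (x(i := t)))"
    using Fm by (simp add: integrable_iff_bounded)
  show "integrable unit_measure (\<lambda>t. LINT x|cube u. F (x(i := t)))"
    using P.integrable_fst[OF int] .
  have "(LINT x|cube (insert i u). F x) = (LINT x|cube u. LINT t|unit_measure. F (x(i := t)))"
    using assms unfolding cube_def by (intro unit_product.product_integral_insert) auto
  also have "\<dots> = (LINT t|unit_measure. LINT x|cube u. F (x(i := t)))"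
    by (rule P.Fubini_integral[OF int])
  finally show "(LINT x|cube (insert i u). F x) = (LINT t|unit_measure. LINT x|cube u. F (x(i := t)))" .
qed

text \<open>Arbitrary coordinate sets occur because slices and marginals lose coordinates.\<close>

definition smooth_cube :: "nat set \<Rightarrow> ((nat \<Rightarrow> real) \<Rightarrow> complex) \<Rightarrow> bool" where
  "smooth_cube u G \<longleftrightarrow>
     (\<forall>ks. set ks \<subseteq> u \<longrightarrow>
        continuous_on (cube_set u) (foldr partial_deriv ks G) \<and>
        (\<forall>i\<in>u. \<forall>x\<in>cube_set u.
           (\<lambda>t. foldr partial_deriv ks G (x(i := t))) differentiable (at (x i) within {0..1})))"

lemma smooth_on_cube_eq: "smooth_on_cube s = smooth_cube {1..s}"
  by (simp add: fun_eq_iff smooth_on_cube_def smooth_cube_def)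

lemma smooth_cube_foldr: "smooth_cube u G \<Longrightarrow> set ks \<subseteq> u \<Longrightarrow> smooth_cube u (foldr partial_deriv ks G)"
  unfolding smooth_cube_def
proof (intro allI impI)
  fix js assume *: "\<forall>ks. set ks \<subseteq> u \<longrightarrow>
      continuous_on (cube_set u) (foldr partial_deriv ks G) \<and>
      (\<forall>i\<in>u. \<forall>x\<in>cube_set u.
         (\<lambda>t. foldr partial_deriv ks G (x(i := t))) differentiable (at (x i) within {0..1}))"
    and "set ks \<subseteq> u" "set js \<subseteq> u"
  then have "set (js @ ks) \<subseteq> u" by simp
  from *[rule_format, OF this] show "continuous_on (cube_set u) (foldr partial_deriv js (foldr partial_deriv ks G)) \<and>
      (\<forall>i\<in>u. \<forall>x\<in>cube_set u.
         (\<lambda>t. foldr partial_deriv js (foldr partial_deriv ks G) (x(i := t))) differentiable (at (x i) within {0..1}))"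
    by simp
qed

lemma smooth_cube_partial_deriv: "smooth_cube u G \<Longrightarrow> i \<in> u \<Longrightarrow> smooth_cube u (partial_deriv i G)"
  using smooth_cube_foldr[of u G "[i]"] by simp

lemma smooth_cube_partial_deriv_power: "smooth_cube u G \<Longrightarrow> i \<in> u \<Longrightarrow> smooth_cube u ((partial_deriv i ^^ n) G)"
  by (induction n) (auto intro: smooth_cube_partial_deriv)

lemma smooth_cube_mixed:
  "smooth_cube u G \<Longrightarrow> set xs \<subseteq> u \<Longrightarrow> smooth_cube u (foldr (\<lambda>i. partial_deriv i ^^ \<nu> i) xs G)"
  by (induction xs) (auto intro: smooth_cube_partial_deriv_power)

lemma smooth_cube_continuous: "smooth_cube u G \<Longrightarrow> continuous_on (cube_set u) G"
  unfolding smooth_cube_def by (elim allE[of _ "[]"]) simp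

lemma smooth_cube_has_vector_derivative:
  assumes "smooth_cube u G" "i \<in> u" "x(i := t) \<in> cube_set u" "t \<in> {0..1}"
  shows "((\<lambda>t. G (x(i := t))) has_vector_derivative partial_deriv i G (x(i := t))) (at t within {0..1})"
proof -
  have "(\<lambda>t. G (x(i := t))) differentiable (at t within {0..1})"
    using assms(1)[unfolded smooth_cube_def, rule_format, of "[]"] assms(2,3) by force
  then show ?thesis
    by (simp add: vector_derivative_works partial_deriv_def)
qed

lemma partial_deriv_eqI:
  assumes "((\<lambda>t. G (x(i := t))) has_vector_derivative D) (at (x i) within {0..1})" "x i \<in> {0..1}"
  shows "partial_deriv i G x = D"
  unfolding partial_deriv_def by (rule vector_derivative_within_closed_interval[OF _ assms(2,1)]) simp

text \<open>The derivative is taken within [0,1], so it sees only the part of the coordinate line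
  inside the cube; off the cube the functions may differ.\<close>

lemma partial_deriv_cong:
  assumes "\<And>x. x \<in> cube_set u \<Longrightarrow> F x = G x" "i \<in> u" "x \<in> cube_set u"
  shows "partial_deriv i F x = partial_deriv i G x"
proof -
  have "F (x(i := t)) = G (x(i := t))" if "t \<in> {0..1}" for t
    by (rule assms(1)[OF cube_set_upd_in[OF assms(3,2) that]])
  then have "((\<lambda>t. F (x(i := t))) has_vector_derivative D) (at (x i) within {0..1})
      \<longleftrightarrow> ((\<lambda>t. G (x(i := t))) has_vector_derivative D) (at (x i) within {0..1})" for D
    using cube_set_component[OF assms(3,2)]
    by (auto elim!: has_vector_derivative_transform[rotated 2])
  then show ?thesis
    by (simp add: partial_deriv_def vector_derivative_def)
qed

lemma foldr_partial_deriv_cong: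
  assumes "\<And>x. x \<in> cube_set u \<Longrightarrow> F x = G x" "set ks \<subseteq> u" "x \<in> cube_set u"
  shows "foldr partial_deriv ks F x = foldr partial_deriv ks G x"
  using assms(2,3)
proof (induction ks arbitrary: x)
  case (Cons i ks)
  show ?case
    using Cons.prems Cons.IH by (auto intro!: partial_deriv_cong[of u])
qed (use assms in auto)

lemma differentiable_cong_Icc:
  assumes "\<And>t. t \<in> {0..1} \<Longrightarrow> f t = g t" "t0 \<in> {0..1::real}"
  shows "f differentiable (at t0 within {0..1}) \<longleftrightarrow> g differentiable (at t0 within {0..1})"
  using assms by (metis differentiable_transform_within zero_less_one)

text \<open>The family \<open>A\<close> lists candidates for all iterated derivatives, and only one
  first-order derivative has to be checked for each member. The identification with
  \<open>foldr partial_deriv\<close> is by induction on \<open>ks\<close>, on the cube only.\<close>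

lemma smooth_cubeI:
  assumes "\<And>ks. set ks \<subseteq> u \<Longrightarrow> continuous_on (cube_set u) (A ks)"
    and "\<And>ks i x. set ks \<subseteq> u \<Longrightarrow> i \<in> u \<Longrightarrow> x \<in> cube_set u
      \<Longrightarrow> ((\<lambda>t. A ks (x(i := t))) has_vector_derivative A (i # ks) x) (at (x i) within {0..1})"
  shows "smooth_cube u (A [])"
    and "\<And>ks x. set ks \<subseteq> u \<Longrightarrow> x \<in> cube_set u \<Longrightarrow> foldr partial_deriv ks (A []) x = A ks x"
proof -
  show *: "foldr partial_deriv ks (A []) x = A ks x" if "set ks \<subseteq> u" "x \<in> cube_set u" for ks x
    using that
  proof (induction ks arbitrary: x)
    case (Cons i ks)
    have "partial_deriv i (foldr partial_deriv ks (A [])) x = partial_deriv i (A ks) x"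
      using Cons by (intro partial_deriv_cong[of u]) auto
    also have "\<dots> = A (i # ks) x"
      using Cons.prems by (intro partial_deriv_eqI assms(2) cube_set_component) auto
    finally show ?case by simp
  qed simp
  show "smooth_cube u (A [])"
    unfolding smooth_cube_def
  proof (intro allI impI conjI ballI)
    fix ks assume ks: "set ks \<subseteq> u"
    show "continuous_on (cube_set u) (foldr partial_deriv ks (A []))"
      using assms(1)[OF ks] * ks by (simp cong: continuous_on_cong)
    fix i x assume ix: "i \<in> u" "x \<in> cube_set u"
    have "foldr partial_deriv ks (A []) (x(i := t)) = A ks (x(i := t))" if "t \<in> {0..1}" for t
      using that ix ks by (intro * cube_set_upd_in)
    then show "(\<lambda>t. foldr partial_deriv ks (A []) (x(i := t))) differentiable at (x i) within {0..1}"
      using assms(2)[OF ks ix] cube_set_component[OF ix(2,1)]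
      by (subst differentiable_cong_Icc) (auto intro: differentiableI_vector)
  qed
qed

lemma smooth_cube_diff:
  assumes "smooth_cube u F" "smooth_cube u G"
  shows "smooth_cube u (\<lambda>x. F x - G x)"
    and "set ks \<subseteq> u \<Longrightarrow> x \<in> cube_set u \<Longrightarrow>
      foldr partial_deriv ks (\<lambda>x. F x - G x) x = foldr partial_deriv ks F x - foldr partial_deriv ks G x"
proof -
  let ?A = "\<lambda>ks x. foldr partial_deriv ks F x - foldr partial_deriv ks G x"
  have 1: "continuous_on (cube_set u) (?A ks)" if "set ks \<subseteq> u" for ks
    using that assms by (intro continuous_intros smooth_cube_continuous smooth_cube_foldr)
  have 2: "((\<lambda>t. ?A ks (x(i := t))) has_vector_derivative ?A (i # ks) x) (at (x i) within {0..1})"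
    if "set ks \<subseteq> u" "i \<in> u" "x \<in> cube_set u" for ks i x
    using smooth_cube_has_vector_derivative[OF smooth_cube_foldr[OF assms(1) that(1)] that(2), of x "x i"]
      smooth_cube_has_vector_derivative[OF smooth_cube_foldr[OF assms(2) that(1)] that(2), of x "x i"]
      that cube_set_component[OF that(3,2)]
    by (auto intro!: derivative_eq_intros)
  show "smooth_cube u (\<lambda>x. F x - G x)"
    using smooth_cubeI(1)[of u ?A, OF 1 2] by simp
  show "foldr partial_deriv ks (\<lambda>x. F x - G x) x = foldr partial_deriv ks F x - foldr partial_deriv ks G x"
    if "set ks \<subseteq> u" "x \<in> cube_set u"
    using smooth_cubeI(2)[of u ?A, OF 1 2 that] by simp
qed

text \<open>A literal equality of functions: updates at two different coordinates commute.\<close>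

lemma partial_deriv_slice:
  "i \<noteq> j \<Longrightarrow> partial_deriv j (\<lambda>x. G (x(i := t))) = (\<lambda>x. partial_deriv j G (x(i := t)))"
  by (simp add: partial_deriv_def fun_eq_iff fun_upd_twist)

lemma foldr_partial_deriv_slice:
  "i \<notin> set ks \<Longrightarrow> foldr partial_deriv ks (\<lambda>x. G (x(i := t))) = (\<lambda>x. foldr partial_deriv ks G (x(i := t)))"
  by (induction ks) (auto simp: partial_deriv_slice)

lemma partial_deriv_power_slice:
  "i \<noteq> j \<Longrightarrow> (partial_deriv j ^^ n) (\<lambda>x. G (x(i := t))) = (\<lambda>x. (partial_deriv j ^^ n) G (x(i := t)))"
  by (induction n) (auto simp: partial_deriv_slice)

lemma foldr_mixed_slice:
  "i \<notin> set xs \<Longrightarrow> foldr (\<lambda>j. partial_deriv j ^^ \<nu> j) xs (\<lambda>x. G (x(i := t)))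
    = (\<lambda>x. foldr (\<lambda>j. partial_deriv j ^^ \<nu> j) xs G (x(i := t)))"
  by (induction xs) (auto simp: partial_deriv_power_slice)

lemma continuous_on_fun_upd:
  "continuous_on S (\<lambda>x. x(i := t) :: nat \<Rightarrow> real)"
proof (intro continuous_on_coordinatewise_then_product)
  fix j
  show "continuous_on S (\<lambda>x. (x(i := t)) j)"
    by (cases "j = i") (auto intro: continuous_on_subset[OF continuous_on_product_coordinates])
qed

lemma smooth_cube_slice:
  assumes "smooth_cube (insert i u) G" "i \<notin> u" "t \<in> {0..1}"
  shows "smooth_cube u (\<lambda>x. G (x(i := t)))"
  unfolding smooth_cube_def
proof (intro allI impI conjI ballI)
  fix ks assume ks: "set ks \<subseteq> u"
  then have eq: "foldr partial_deriv ks (\<lambda>x. G (x(i := t))) = (\<lambda>x. foldr partial_deriv ks G (x(i := t)))"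
    using assms(2) by (intro foldr_partial_deriv_slice) auto
  have sm: "smooth_cube (insert i u) (foldr partial_deriv ks G)"
    using ks by (intro smooth_cube_foldr assms) auto
  show "continuous_on (cube_set u) (foldr partial_deriv ks (\<lambda>x. G (x(i := t))))"
    unfolding eq using assms(3)
    by (intro continuous_on_compose2[OF smooth_cube_continuous[OF sm] continuous_on_fun_upd])
      (auto intro: cube_set_upd)
  fix j x assume jx: "j \<in> u" "x \<in> cube_set u"
  have "((\<lambda>r. foldr partial_deriv ks G ((x(i := t))(j := r))) has_vector_derivative
      partial_deriv j (foldr partial_deriv ks G) ((x(i := t))(j := x j))) (at (x j) within {0..1})"
  proof (rule smooth_cube_has_vector_derivative[OF sm])
    show "(x(i := t))(j := x j) \<in> cube_set (insert i u)"
      by (rule cube_set_upd_in[OF cube_set_upd[OF jx(2) assms(3)] insertI2[OF jx(1)] cube_set_component[OF jx(2,1)]])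
  qed (use jx cube_set_component in auto)
  moreover have "x(j := r, i := t) = x(i := t, j := r)" for r
    using jx assms(2) by (auto simp: fun_upd_twist)
  ultimately show "(\<lambda>r. foldr partial_deriv ks (\<lambda>x. G (x(i := t))) (x(j := r))) differentiable at (x j) within {0..1}"
    unfolding eq by (auto intro: differentiableI_vector)
qed

section \<open>The inequality for smooth functions\<close>

text \<open>The Leibniz rule by dominated convergence. The derivative is within [0,1], so the end
  points are covered by the same argument.\<close>

lemma has_vector_derivative_integral:
  fixes H H' :: "real \<Rightarrow> 'a \<Rightarrow> complex"
  assumes N: "finite_measure N"
    and der: "\<And>t x. t \<in> {0..1} \<Longrightarrow> x \<in> space N \<Longrightarrow> ((\<lambda>t. H t x) has_vector_derivative H' t x) (at t within {0..1})"
    and int: "\<And>t. t \<in> {0..1} \<Longrightarrow> integrable N (H t)"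
    and meas: "\<And>t. t \<in> {0..1} \<Longrightarrow> H' t \<in> borel_measurable N"
    and bnd: "\<And>t x. t \<in> {0..1} \<Longrightarrow> x \<in> space N \<Longrightarrow> cmod (H' t x) \<le> B"
    and t0: "t0 \<in> {0..1}"
  shows "((\<lambda>t. LINT x|N. H t x) has_vector_derivative (LINT x|N. H' t0 x)) (at t0 within {0..1})"
  unfolding has_vector_derivative_def has_derivative_within tendsto_at_iff_sequentially
proof (intro conjI allI impI)
  interpret finite_measure N by (rule N)
  have int': "integrable N (H' t0)"
    using t0 bnd meas by (intro integrable_const_bound[where B = B] AE_I2) auto
  \<comment> \<open>The normalised remainder of the linear approximation at \<open>t0\<close>: it
    tends to 0 pointwise, and the mean value inequality bounds it by \<open>2 * B\<close>.\<close>
  define q where "q y x = (1 / norm (y - t0)) *\<^sub>R (H y x - (H t0 x + (y - t0) *\<^sub>R H' t0 x))" for y x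
  have lip: "cmod (H y x - H t0 x) \<le> B * norm (y - t0)" if "y \<in> {0..1}" "x \<in> space N" for y x
  proof (rule differentiable_bound[of "{0..1}" "\<lambda>t. H t x" "\<lambda>t h. h *\<^sub>R H' t x"])
    show "((\<lambda>t. H t x) has_derivative (\<lambda>h. h *\<^sub>R H' t x)) (at t within {0..1})" if "t \<in> {0..1}" for t
      using der[OF that \<open>x \<in> space N\<close>] by (simp add: has_vector_derivative_def)
    show "onorm (\<lambda>h. h *\<^sub>R H' t x) \<le> B" if "t \<in> {0..1}" for t
      using bnd[OF that \<open>x \<in> space N\<close>] by (intro onorm_le) (auto simp: mult.commute[of B] intro: mult_left_mono)
  qed (use that t0 in auto)
  have q_bound: "cmod (q y x) \<le> 2 * B" if "y \<in> {0..1} - {t0}" "x \<in> space N" for y x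
  proof -
    have "cmod (H y x - (H t0 x + (y - t0) *\<^sub>R H' t0 x)) \<le> cmod (H y x - H t0 x) + cmod ((y - t0) *\<^sub>R H' t0 x)"
      using norm_triangle_ineq4[of "H y x - H t0 x" "(y - t0) *\<^sub>R H' t0 x"] by (simp add: algebra_simps)
    also have "\<dots> \<le> B * norm (y - t0) + norm (y - t0) * B"
      using that t0 bnd[OF t0 that(2)] by (intro add_mono lip) (auto intro: mult_left_mono)
    finally have "cmod (H y x - (H t0 x + (y - t0) *\<^sub>R H' t0 x)) \<le> 2 * B * norm (y - t0)"
      by simp
    then show ?thesis
      using that by (simp add: q_def divide_simps)
  qed
  fix X :: "nat \<Rightarrow> real" assume X: "\<forall>i. X i \<in> {0..1} - {t0}" "X \<longlonglongrightarrow> t0"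
  have "(\<lambda>n. LINT x|N. q (X n) x) \<longlonglongrightarrow> (LINT x|N. 0)"
  proof (rule integral_dominated_convergence[where w = "\<lambda>_. 2 * B"])
    show "AE x in N. (\<lambda>n. q (X n) x) \<longlonglongrightarrow> 0"
    proof (rule AE_I2)
      fix x assume "x \<in> space N"
      from der[OF t0 this] have "((\<lambda>y. q y x) \<longlongrightarrow> 0) (at t0 within {0..1})"
        unfolding has_vector_derivative_def has_derivative_within q_def by simp
      then show "(\<lambda>n. q (X n) x) \<longlonglongrightarrow> 0"
        using X unfolding tendsto_at_iff_sequentially by (auto simp: o_def)
    qed
    show "AE x in N. norm (q (X n) x) \<le> 2 * B" for n
      using X q_bound by (intro AE_I2) auto
    show "q (X n) \<in> borel_measurable N" for n
      unfolding q_def using X int[of "X n"] int[OF t0] int' by auto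
  qed auto
  also have "(\<lambda>n. LINT x|N. q (X n) x) = (\<lambda>y. (1 / norm (y - t0)) *\<^sub>R
      ((LINT x|N. H y x) - ((LINT x|N. H t0 x) + (y - t0) *\<^sub>R (LINT x|N. H' t0 x)))) \<circ> X"
  proof
    fix n
    have "X n \<in> {0..1}" using X by auto
    then show "(LINT x|N. q (X n) x) = ((\<lambda>y. (1 / norm (y - t0)) *\<^sub>R
      ((LINT x|N. H y x) - ((LINT x|N. H t0 x) + (y - t0) *\<^sub>R (LINT x|N. H' t0 x)))) \<circ> X) n"
      unfolding q_def o_def using int int' t0 by simp
  qed
  finally show "((\<lambda>y. (1 / norm (y - t0)) *\<^sub>R
      ((LINT x|N. H y x) - ((LINT x|N. H t0 x) + (y - t0) *\<^sub>R (LINT x|N. H' t0 x)))) \<circ> X) \<longlonglongrightarrow> 0"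
    by (simp add: o_def)
qed (auto intro: bounded_linear_scaleR_left)

text \<open>The weight will be a product of conjugated Walsh functions of the other coordinates,
  which need not be continuous; it does not depend on \<open>t\<close>, so measurability and a bound
  suffice.\<close>

lemma slice_integral_has_vector_derivative:
  assumes "finite u" "i \<notin> u" "smooth_cube (insert i u) G"
    and "\<phi> \<in> borel_measurable (cube u)" "\<And>x. x \<in> cube_set u \<Longrightarrow> cmod (\<phi> x) \<le> 1" "t \<in> {0..1}"
  shows "((\<lambda>t. LINT x|cube u. G (x(i := t)) * \<phi> x) has_vector_derivative
      (LINT x|cube u. partial_deriv i G (x(i := t)) * \<phi> x)) (at t within {0..1})"
proof -
  have D: "smooth_cube (insert i u) (partial_deriv i G)"
    using assms(3) by (intro smooth_cube_partial_deriv) auto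
  have bound: "\<exists>B. \<forall>t\<in>{0..1}. \<forall>x\<in>cube_set u. cmod (F (x(i := t)) * \<phi> x) \<le> B"
    and meas: "t \<in> {0..1} \<Longrightarrow> (\<lambda>x. F (x(i := t)) * \<phi> x) \<in> borel_measurable (cube u)"
    if F: "smooth_cube (insert i u) F" for F t
  proof -
    obtain B where B: "\<And>x. x \<in> cube_set (insert i u) \<Longrightarrow> cmod (F x) \<le> B"
      using bounded_cube_continuous[OF smooth_cube_continuous[OF F]] by blast
    have "cmod (F (x(i := t)) * \<phi> x) \<le> B" if "t \<in> {0..1}" "x \<in> cube_set u" for t x
    proof -
      have "cmod (F (x(i := t)) * \<phi> x) \<le> B * 1"
        unfolding norm_mult using B[OF cube_set_upd[OF that(2,1)]] assms(5)[OF that(2)]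
        by (intro mult_mono) (auto intro: order_trans[OF norm_ge_zero])
      then show ?thesis by simp
    qed
    then show "\<exists>B. \<forall>t\<in>{0..1}. \<forall>x\<in>cube_set u. cmod (F (x(i := t)) * \<phi> x) \<le> B"
      by blast
    show "(\<lambda>x. F (x(i := t)) * \<phi> x) \<in> borel_measurable (cube u)" if "t \<in> {0..1}"
      using measurable_cube_continuous[OF smooth_cube_continuous[OF smooth_cube_slice[OF F assms(2) that]]] assms(4)
      by simp
  qed
  obtain B B' where B: "\<forall>t\<in>{0..1}. \<forall>x\<in>cube_set u. cmod (G (x(i := t)) * \<phi> x) \<le> B"
    "\<forall>t\<in>{0..1}. \<forall>x\<in>cube_set u. cmod (partial_deriv i G (x(i := t)) * \<phi> x) \<le> B'"
    using bound[OF assms(3)] bound[OF D] by blast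
  show ?thesis
  proof (rule has_vector_derivative_integral[OF finite_measure_cube[OF assms(1)], where B = B'])
    fix t :: real assume t: "t \<in> {0..1}"
    show "integrable (cube u) (\<lambda>x. G (x(i := t)) * \<phi> x)"
      using t B(1) by (intro integrable_cube_bounded[OF assms(1) meas[OF assms(3)]]) auto
    show "(\<lambda>x. partial_deriv i G (x(i := t)) * \<phi> x) \<in> borel_measurable (cube u)"
      by (rule meas[OF D t])
    fix x assume x: "x \<in> space (cube u)"
    show "cmod (partial_deriv i G (x(i := t)) * \<phi> x) \<le> B'"
      using B(2) t x by (auto simp: space_cube)
    show "((\<lambda>t. G (x(i := t)) * \<phi> x) has_vector_derivative partial_deriv i G (x(i := t)) * \<phi> x) (at t within {0..1})"
      using x t by (intro has_vector_derivative_mult_left smooth_cube_has_vector_derivative[OF assms(3)] cube_set_upd)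
        (auto simp: space_cube)
  qed (rule assms(6))
qed

section \<open>Induction over the coordinates\<close>

lemma measurable_wal_prod:
  assumes "b \<ge> 2" "finite u"
  shows "(\<lambda>x. \<Prod>j\<in>u. cnj (wal b (h j) (x j))) \<in> borel_measurable (cube u)"
proof (rule borel_measurable_prod)
  fix j assume "j \<in> u"
  then have "(\<lambda>x. x j) \<in> cube u \<rightarrow>\<^sub>M unit_measure"
    unfolding cube_def by (rule measurable_component_singleton)
  from measurable_compose[OF this L2_int_measurable[OF L2_int_cnj_wal[OF assms(1), of "h j"]]]
  show "(\<lambda>x. cnj (wal b (h j) (x j))) \<in> borel_measurable (cube u)" .
qed

lemma norm_wal_prod: "b \<ge> 2 \<Longrightarrow> cmod (\<Prod>j\<in>u. cnj (wal b (h j) (x j))) = 1"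
  by (simp add: prod_norm[symmetric] norm_wal)

lemma sum_PiE_insert:
  fixes F :: "('a \<Rightarrow> 'b) \<Rightarrow> 'c::comm_monoid_add"
  assumes "finite u" "i \<notin> u"
  shows "(\<Sum>h\<in>PiE (insert i u) H. F h) = (\<Sum>h\<in>PiE u H. \<Sum>a\<in>H i. F (h(i := a)))"
proof -
  have "(\<Sum>h\<in>PiE (insert i u) H. F h) = (\<Sum>(a, h)\<in>H i \<times> PiE u H. F (h(i := a)))"
    unfolding PiE_insert_eq by (subst sum.reindex) (auto simp: inj_combinator[OF assms(2)] case_prod_beta)
  also have "\<dots> = (\<Sum>a\<in>H i. \<Sum>h\<in>PiE u H. F (h(i := a)))"
    by (rule sum.cartesian_product[symmetric])
  also have "\<dots> = (\<Sum>h\<in>PiE u H. \<Sum>a\<in>H i. F (h(i := a)))"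
    by (rule sum.swap)
  finally show ?thesis .
qed

text \<open>The last coordinate \<open>i\<close> of the list is split off, since
  \<open>foldr\<close> applies its derivatives to \<open>G\<close> first. The remaining derivatives
  do not involve \<open>i\<close> and commute with fixing it, so partial derivatives are never
  interchanged.\<close>

theorem wal_coeff_cube_sum_le:
  assumes "b \<ge> 2" "distinct xs" "smooth_cube (set xs) G"
    and "\<And>i. i \<in> set xs \<Longrightarrow> finite (H i)"
    and "\<And>i. i \<in> set xs \<Longrightarrow> distinct (P i) \<and> length (P i) = \<nu> i"
    and "\<And>i p. i \<in> set xs \<Longrightarrow> p \<in> set (P i) \<Longrightarrow> p \<ge> 1 \<and> (\<forall>h\<in>H i. nat_digit b h (p - 1) \<noteq> 0)"
  shows "(\<Sum>h\<in>PiE (set xs) H. (cmod (LINT x|cube (set xs). G x * (\<Prod>j\<in>set xs. cnj (wal b (h j) (x j)))))\<^sup>2)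
    \<le> (\<Prod>i\<in>set xs. \<Prod>p\<leftarrow>P i. 2 * (max_offset b p)\<^sup>2)
      * (L2_norm_on (cube (set xs)) (foldr (\<lambda>i. partial_deriv i ^^ \<nu> i) xs G))\<^sup>2"
  using assms(2-)
proof (induction xs arbitrary: G rule: rev_induct)
  case Nil
  \<comment> \<open>The cube over no coordinates is a single point of mass 1, and both sides are the
    squared modulus of \<open>G\<close> there.\<close>
  show ?case
    by (simp add: L2_norm_on_square cube_def PiM_empty lebesgue_integral_count_space_finite)
next
  case (snoc i xs)
  define u where "u = set xs"
  have fin: "finite u" and iu: "i \<notin> u" and ins: "set (xs @ [i]) = insert i u"
    using snoc.prems by (auto simp: u_def)
  have G: "smooth_cube (insert i u) G"
    using snoc.prems(2) ins by simp
  let ?D = "\<lambda>k. (partial_deriv i ^^ k) G"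
  have DG: "smooth_cube (insert i u) (?D k)" for k
    using G by (intro smooth_cube_partial_deriv_power) auto
  define \<phi> where "\<phi> h x = (\<Prod>j\<in>u. cnj (wal b (h j) (x j)))" for h x
  have \<phi>: "\<phi> h \<in> borel_measurable (cube u)" "cmod (\<phi> h x) = 1" for h x
    unfolding \<phi>_def using assms(1) fin by (simp_all add: measurable_wal_prod norm_wal_prod)
  \<comment> \<open>The Walsh coefficient in the coordinates \<open>u\<close> of the slice at
    \<open>t\<close>; for fixed \<open>h\<close> these functions form the chain required in one
    dimension.\<close>
  define g where "g h k t = (LINT x|cube u. ?D k (x(i := t)) * \<phi> h x)" for h k t
  have g_der: "(g h k has_vector_derivative g h (Suc k) t) (at t within {0..1})" if "t \<in> {0..1}" for h k t
    using slice_integral_has_vector_derivative[OF fin iu DG[of k] \<phi>(1)[of h] _ that] \<phi>(2)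
    unfolding g_def by simp
  have g_cont: "continuous_on {0..1} (g h k)" for h k
    by (rule continuous_on_vector_derivative[OF g_der])
  let ?F = "foldr (\<lambda>i. partial_deriv i ^^ \<nu> i) xs (?D (\<nu> i))"
  let ?C = "\<Prod>p\<leftarrow>P i. 2 * (max_offset b p)\<^sup>2" and ?Cu = "\<Prod>i\<in>u. \<Prod>p\<leftarrow>P i. 2 * (max_offset b p)\<^sup>2"
  have C: "0 \<le> ?C" by (intro prod_list_nonneg) auto
  have i: "i \<in> set (xs @ [i])" by simp
  have coeff: "(LINT x|cube (insert i u). G x * (\<Prod>j\<in>insert i u. cnj (wal b ((h(i := a)) j) (x j))))
      = wal_coeff b (g h 0) a" for h a
  proof -
    let ?I = "\<lambda>x. G x * (\<Prod>j\<in>insert i u. cnj (wal b ((h(i := a)) j) (x j)))"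
    obtain B where B: "\<And>x. x \<in> cube_set (insert i u) \<Longrightarrow> cmod (G x) \<le> B"
      using bounded_cube_continuous[OF smooth_cube_continuous[OF G]] by blast
    have "integrable (cube (insert i u)) ?I"
    proof (rule integrable_cube_bounded[where B = B])
      show "?I \<in> borel_measurable (cube (insert i u))"
        using measurable_cube_continuous[OF smooth_cube_continuous[OF G]] fin assms(1)
        by (intro borel_measurable_times measurable_wal_prod) auto
      show "cmod (?I x) \<le> B" if "x \<in> cube_set (insert i u)" for x
        using B[OF that] assms(1) by (simp only: norm_mult norm_wal_prod mult_1_right)
    qed (use fin in simp)
    then have "(LINT x|cube (insert i u). ?I x) = (LINT t|unit_measure. LINT x|cube u. ?I (x(i := t)))"
      by (rule integrable_cube_insert(2)[OF fin iu])
    also have "\<dots> = wal_coeff b (g h 0) a"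
      unfolding wal_coeff_def
    proof (rule Bochner_Integration.integral_cong[OF refl])
      fix t
      have eq: "?I (x(i := t)) = G (x(i := t)) * \<phi> h x * cnj (wal b a t)" for x
      proof -
        have "(\<Prod>j\<in>u. cnj (wal b ((h(i := a)) j) ((x(i := t)) j))) = \<phi> h x"
          unfolding \<phi>_def using iu by (intro prod.cong) auto
        then show ?thesis
          using fin iu by (simp add: mult.assoc mult.commute[of _ "cnj (wal b a t)"])
      qed
      show "(LINT x|cube u. ?I (x(i := t))) = g h 0 t * cnj (wal b a t)"
        by (simp only: eq g_def funpow_0 Bochner_Integration.integral_mult_left_zero)
    qed
    finally show ?thesis .
  qed
  have Fsq: "integrable (cube (insert i u)) (\<lambda>x. (cmod (?F x))\<^sup>2)"
    using L2_int_cube_continuous[OF smooth_cube_continuous[OF smooth_cube_mixed[OF DG]], of xs \<nu> "\<nu> i"] fin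
    by (auto simp: u_def L2_int_def)
  have gL: "integrable unit_measure (\<lambda>t. (cmod (g h k t))\<^sup>2)" for h k
    using L2_int_continuous_on_interval[OF g_cont] by (simp add: L2_int_def)
  have finP: "finite (PiE u H)"
    using snoc.prems(3) fin by (intro finite_PiE) (auto simp: u_def)
  have "(\<Sum>h\<in>PiE (insert i u) H. (cmod (LINT x|cube (insert i u). G x * (\<Prod>j\<in>insert i u. cnj (wal b (h j) (x j)))))\<^sup>2)
      = (\<Sum>h\<in>PiE u H. \<Sum>a\<in>H i. (cmod (wal_coeff b (g h 0) a))\<^sup>2)"
    by (simp only: sum_PiE_insert[OF fin iu] coeff)
  also have "\<dots> \<le> (\<Sum>h\<in>PiE u H. ?C * (LINT t|unit_measure. (cmod (g h (\<nu> i) t))\<^sup>2))"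
  proof (rule sum_mono)
    fix h
    have len: "length (P i) = \<nu> i" using snoc.prems(4)[OF i] by simp
    show "(\<Sum>a\<in>H i. (cmod (wal_coeff b (g h 0) a))\<^sup>2) \<le> ?C * (LINT t|unit_measure. (cmod (g h (\<nu> i) t))\<^sup>2)"
      using snoc.prems(3,4,5)[OF i] g_der g_cont
      unfolding len[symmetric] by (intro wal_coeff_sum_le[OF assms(1)]) auto
  qed
  also have "\<dots> = ?C * (LINT t|unit_measure. (\<Sum>h\<in>PiE u H. (cmod (g h (\<nu> i) t))\<^sup>2))"
    using gL by (simp add: sum_distrib_left)
  also have "\<dots> \<le> ?C * (LINT t|unit_measure. ?Cu * (LINT x|cube u. (cmod (?F (x(i := t))))\<^sup>2))"
  proof (intro mult_left_mono[OF _ C] integral_mono)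
    show "integrable unit_measure (\<lambda>t. \<Sum>h\<in>PiE u H. (cmod (g h (\<nu> i) t))\<^sup>2)"
      using gL by simp
    show "integrable unit_measure (\<lambda>t. ?Cu * (LINT x|cube u. (cmod (?F (x(i := t))))\<^sup>2))"
      using integrable_cube_insert(1)[OF fin iu Fsq] by simp
    fix t assume "t \<in> space unit_measure"
    then have t: "t \<in> {0..1}" by (simp add: space_restrict_space)
    \<comment> \<open>The induction hypothesis for the slice at \<open>t\<close> of
      \<open>?D (\<nu> i)\<close>; its right side, integrated over \<open>t\<close>, becomes the
      squared norm over the larger cube.\<close>
    have "(\<Sum>h\<in>PiE (set xs) H. (cmod (LINT x|cube (set xs). (\<lambda>x. ?D (\<nu> i) (x(i := t))) x * (\<Prod>j\<in>set xs. cnj (wal b (h j) (x j)))))\<^sup>2)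
      \<le> (\<Prod>i\<in>set xs. \<Prod>p\<leftarrow>P i. 2 * (max_offset b p)\<^sup>2)
      * (L2_norm_on (cube (set xs)) (foldr (\<lambda>i. partial_deriv i ^^ \<nu> i) xs (\<lambda>x. ?D (\<nu> i) (x(i := t)))))\<^sup>2"
    proof (rule snoc.IH)
      show "smooth_cube (set xs) (\<lambda>x. ?D (\<nu> i) (x(i := t)))"
        using smooth_cube_slice[OF DG iu t] by (simp add: u_def)
      fix j assume j: "j \<in> set xs"
      show "finite (H j)" "distinct (P j) \<and> length (P j) = \<nu> j"
        using snoc.prems(3,4)[of j] j by simp_all
      fix p assume "p \<in> set (P j)"
      then show "p \<ge> 1 \<and> (\<forall>h\<in>H j. nat_digit b h (p - 1) \<noteq> 0)"
        using snoc.prems(5)[of j p] j by simp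
    qed (use snoc.prems in simp)
    also have "foldr (\<lambda>i. partial_deriv i ^^ \<nu> i) xs (\<lambda>x. ?D (\<nu> i) (x(i := t))) = (\<lambda>x. ?F (x(i := t)))"
      using iu by (intro foldr_mixed_slice) (simp add: u_def)
    finally show "(\<Sum>h\<in>PiE u H. (cmod (g h (\<nu> i) t))\<^sup>2) \<le> ?Cu * (LINT x|cube u. (cmod (?F (x(i := t))))\<^sup>2)"
      by (simp only: g_def \<phi>_def u_def L2_norm_on_square)
  qed
  also have "\<dots> = ?C * (?Cu * (LINT x|cube (insert i u). (cmod (?F x))\<^sup>2))"
    by (simp add: integrable_cube_insert(2)[OF fin iu Fsq])
  also have "\<dots> = (\<Prod>i\<in>insert i u. \<Prod>p\<leftarrow>P i. 2 * (max_offset b p)\<^sup>2)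
      * (L2_norm_on (cube (insert i u)) (foldr (\<lambda>i. partial_deriv i ^^ \<nu> i) (xs @ [i]) G))\<^sup>2"
    using fin iu by (simp add: L2_norm_on_square)
  finally show ?case
    unfolding ins .
qed

section \<open>Marginals and Sobolev functions\<close>

lemma merge_upd: "i \<in> u \<Longrightarrow> merge u w (x(i := t), y) = (merge u w (x, y))(i := t)"
  by (auto simp: merge_def)

lemma continuous_on_merge:
  fixes y :: "nat \<Rightarrow> real"
  shows "continuous_on S (\<lambda>x. merge u w (x, y))" "continuous_on S (\<lambda>x. merge u w (y, x))"
proof -
  show "continuous_on S (\<lambda>x. merge u w (x, y))"
  proof (rule continuous_on_coordinatewise_then_product)
    fix i show "continuous_on S (\<lambda>x. merge u w (x, y) i)"
      by (cases "i \<in> u"; cases "i \<in> w")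
        (auto simp: merge_def intro: continuous_on_subset[OF continuous_on_product_coordinates])
  qed
  show "continuous_on S (\<lambda>x. merge u w (y, x))"
  proof (rule continuous_on_coordinatewise_then_product)
    fix i show "continuous_on S (\<lambda>x. merge u w (y, x) i)"
      by (cases "i \<in> u"; cases "i \<in> w")
        (auto simp: merge_def intro: continuous_on_subset[OF continuous_on_product_coordinates])
  qed
qed

lemma cube_set_merge_complement:
  "u \<subseteq> v \<Longrightarrow> x \<in> cube_set u \<Longrightarrow> y \<in> cube_set (v - u) \<Longrightarrow> merge u (v - u) (x, y) \<in> cube_set v"
  using cube_set_merge[of u "v - u" x y] by (simp add: Un_absorb1)

lemma continuous_on_section:
  assumes "continuous_on (cube_set v) F" "u \<subseteq> v" "x \<in> cube_set u"
  shows "continuous_on (cube_set (v - u)) (\<lambda>y. F (merge u (v - u) (x, y)))"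
  using assms by (intro continuous_on_compose2[OF assms(1) continuous_on_merge(2)])
    (auto intro: cube_set_merge_complement)

lemma integrable_section:
  fixes F :: "(nat \<Rightarrow> real) \<Rightarrow> complex"
  assumes "continuous_on (cube_set v) F" "u \<subseteq> v" "x \<in> cube_set u" "finite v"
  shows "integrable (cube (v - u)) (\<lambda>y. F (merge u (v - u) (x, y)))"
proof -
  obtain B where "\<And>x. x \<in> cube_set v \<Longrightarrow> cmod (F x) \<le> B"
    using bounded_cube_continuous[OF assms(1)] by blast
  then show ?thesis
    using assms by (intro integrable_cube_bounded[where B = B] measurable_cube_continuous continuous_on_section)
      (auto intro: cube_set_merge_complement)
qed

lemma continuous_on_marginal:
  assumes "continuous_on (cube_set {1..s}) F" "u \<subseteq> {1..s}"
  shows "continuous_on (cube_set u) (marginal s u F)"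
  unfolding continuous_on_sequentially
proof (intro allI ballI impI, elim conjE)
  let ?w = "{1..s} - u"
  fix X x assume x: "x \<in> cube_set u" "\<forall>n. X n \<in> cube_set u" "X \<longlonglongrightarrow> x"
  obtain B where B: "\<And>x. x \<in> cube_set {1..s} \<Longrightarrow> cmod (F x) \<le> B"
    using bounded_cube_continuous[OF assms(1)] by blast
  show "(marginal s u F \<circ> X) \<longlonglongrightarrow> marginal s u F x"
    unfolding marginal_def o_def
  proof (rule integral_dominated_convergence[where w = "\<lambda>_. B"])
    show "(\<lambda>y. F (merge u ?w (x, y))) \<in> borel_measurable (cube ?w)"
      by (intro measurable_cube_continuous continuous_on_section assms x)
    show "(\<lambda>y. F (merge u ?w (X n, y))) \<in> borel_measurable (cube ?w)" for n
      using x(2) by (intro measurable_cube_continuous continuous_on_section assms) auto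
    show "integrable (cube ?w) (\<lambda>_. B)"
      by (simp add: finite_measure.integrable_const finite_measure_cube)
    show "AE y in cube ?w. norm (F (merge u ?w (X n, y))) \<le> B" for n
      using x(2) assms(2) by (intro AE_I2 B cube_set_merge_complement) (auto simp: space_cube)
    show "AE y in cube ?w. (\<lambda>n. F (merge u ?w (X n, y))) \<longlonglongrightarrow> F (merge u ?w (x, y))"
    proof (rule AE_I2)
      fix y assume "y \<in> space (cube ?w)"
      then have "continuous_on (cube_set u) (\<lambda>x. F (merge u ?w (x, y)))"
        using assms(2) by (intro continuous_on_compose2[OF assms(1) continuous_on_merge(1)])
          (auto intro: cube_set_merge_complement simp: space_cube)
      then show "(\<lambda>n. F (merge u ?w (X n, y))) \<longlonglongrightarrow> F (merge u ?w (x, y))"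
        using x unfolding continuous_on_sequentially by (auto simp: o_def)
    qed
  qed
qed

text \<open>Derivatives in coordinates of \<open>u\<close> pass under the integral over the others,
  so the marginals of the derivatives form a family \<open>A\<close> as in
  \<open>smooth_cubeI\<close>.\<close>

lemma smooth_cube_marginal:
  assumes "smooth_cube {1..s} G" "u \<subseteq> {1..s}"
  shows "smooth_cube u (marginal s u G)"
proof -
  let ?w = "{1..s} - u"
  define A where "A ks = marginal s u (foldr partial_deriv ks G)" for ks
  have "smooth_cube u (A [])"
  proof (rule smooth_cubeI(1))
    fix ks assume ks: "set ks \<subseteq> u"
    define F where "F = foldr partial_deriv ks G"
    have F: "smooth_cube {1..s} F"
      unfolding F_def using ks assms(2) by (intro smooth_cube_foldr assms(1)) auto
    show "continuous_on (cube_set u) (A ks)"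
      unfolding A_def F_def[symmetric] by (intro continuous_on_marginal smooth_cube_continuous F assms(2))
    fix i x assume i: "i \<in> u" and x: "x \<in> cube_set u"
    have i': "i \<in> {1..s}" using i assms(2) by auto
    have D: "smooth_cube {1..s} (partial_deriv i F)"
      by (intro smooth_cube_partial_deriv F i')
    obtain B where B: "\<And>x. x \<in> cube_set {1..s} \<Longrightarrow> cmod (partial_deriv i F x) \<le> B"
      using bounded_cube_continuous[OF smooth_cube_continuous[OF D]] by blast
    have xt: "x(i := t) \<in> cube_set u" if "t \<in> {0..1}" for t
      by (rule cube_set_upd_in[OF x i that])
    have m: "(merge u ?w (x, y))(i := t) \<in> cube_set {1..s}" if "t \<in> {0..1}" "y \<in> cube_set ?w" for t y
      using cube_set_merge_complement[OF assms(2) xt[OF that(1)] that(2)] by (simp add: merge_upd[OF i])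
    have "((\<lambda>t. LINT y|cube ?w. F (merge u ?w (x(i := t), y))) has_vector_derivative
        (LINT y|cube ?w. partial_deriv i F (merge u ?w (x(i := x i), y)))) (at (x i) within {0..1})"
    proof (rule has_vector_derivative_integral[OF finite_measure_cube, where B = B])
      fix t :: real assume t: "t \<in> {0..1}"
      show "integrable (cube ?w) (\<lambda>y. F (merge u ?w (x(i := t), y)))"
        by (intro integrable_section smooth_cube_continuous F assms(2) xt t) simp
      show "(\<lambda>y. partial_deriv i F (merge u ?w (x(i := t), y))) \<in> borel_measurable (cube ?w)"
        by (intro measurable_cube_continuous continuous_on_section smooth_cube_continuous D assms(2) xt t)
      fix y assume "y \<in> space (cube ?w)"
      then have y: "y \<in> cube_set ?w" by (simp add: space_cube)
      show "cmod (partial_deriv i F (merge u ?w (x(i := t), y))) \<le> B"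
        unfolding merge_upd[OF i] by (intro B m t y)
      show "((\<lambda>t. F (merge u ?w (x(i := t), y))) has_vector_derivative
          partial_deriv i F (merge u ?w (x(i := t), y))) (at t within {0..1})"
        unfolding merge_upd[OF i] by (intro smooth_cube_has_vector_derivative[OF F i'] m t y)
    qed (use cube_set_component[OF x i] in auto)
    then show "((\<lambda>t. A ks (x(i := t))) has_vector_derivative A (i # ks) x) (at (x i) within {0..1})"
      by (simp add: A_def marginal_def F_def)
  qed
  then show ?thesis by (simp add: A_def)
qed

lemma marginal_diff:
  assumes "continuous_on (cube_set {1..s}) F" "continuous_on (cube_set {1..s}) G" "u \<subseteq> {1..s}" "x \<in> cube_set u"
  shows "marginal s u (\<lambda>x. F x - G x) x = marginal s u F x - marginal s u G x"
  unfolding marginal_def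
  by (intro Bochner_Integration.integral_diff integrable_section assms) simp_all

text \<open>Powers of a derivative become repetitions in the list, the form in which congruence and
  linearity are stated.\<close>

lemma foldr_partial_deriv_power:
  "foldr (\<lambda>i. partial_deriv i ^^ \<nu> i) xs G = foldr partial_deriv (concat (map (\<lambda>i. replicate (\<nu> i) i) xs)) G"
proof (induction xs)
  case (Cons i xs)
  have "(partial_deriv i ^^ n) F = foldr partial_deriv (replicate n i) F" for n F
    by (induction n) auto
  then show ?case using Cons by simp
qed simp

lemma mixed_deriv_marginal_diff:
  assumes "smooth_cube {1..s} F" "smooth_cube {1..s} G" "u \<subseteq> {1..s}" "x \<in> cube_set u"
  shows "mixed_deriv u \<nu> (marginal s u (\<lambda>x. F x - G x)) x
    = mixed_deriv u \<nu> (marginal s u F) x - mixed_deriv u \<nu> (marginal s u G) x"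
proof -
  let ?ks = "concat (map (\<lambda>i. replicate (\<nu> i) i) (sorted_list_of_set u))"
  have fin: "finite u" using assms(3) finite_subset by blast
  have ks: "set ?ks \<subseteq> u" using fin by auto
  have "foldr partial_deriv ?ks (marginal s u (\<lambda>x. F x - G x)) x
      = foldr partial_deriv ?ks (\<lambda>x. marginal s u F x - marginal s u G x) x"
    by (rule foldr_partial_deriv_cong[OF _ ks assms(4)])
      (intro marginal_diff smooth_cube_continuous assms(1-3))
  also have "\<dots> = foldr partial_deriv ?ks (marginal s u F) x - foldr partial_deriv ?ks (marginal s u G) x"
    by (rule smooth_cube_diff(2)[OF smooth_cube_marginal[OF assms(1,3)] smooth_cube_marginal[OF assms(2,3)] ks assms(4)])
  finally show ?thesis
    by (simp add: mixed_deriv_def foldr_partial_deriv_power)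
qed

lemma L2_int_mixed_deriv:
  assumes "smooth_cube {1..s} F" "u \<subseteq> {1..s}"
  shows "L2_int (cube u) (mixed_deriv u \<nu> (marginal s u F))"
proof -
  have fin: "finite u" using assms(2) finite_subset by blast
  show ?thesis
    unfolding mixed_deriv_def using fin
    by (intro L2_int_cube_continuous smooth_cube_continuous smooth_cube_mixed smooth_cube_marginal assms) auto
qed

section \<open>Walsh coefficients: continuity and reduction to marginals\<close>

lemma measurable_cnj_wal_vec: "b \<ge> 2 \<Longrightarrow> (\<lambda>x. cnj (wal_vec b s h x)) \<in> borel_measurable (cube {1..s})"
  using measurable_wal_prod[of b "{1..s}" h] unfolding wal_vec_def cnj_prod by simp

lemma norm_wal_vec: "b \<ge> 2 \<Longrightarrow> cmod (wal_vec b s h x) = 1"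
  by (simp add: wal_vec_def prod_norm[symmetric] norm_wal)

lemma L2_int_cnj_wal_vec: "b \<ge> 2 \<Longrightarrow> L2_int (cube {1..s}) (\<lambda>x. cnj (wal_vec b s h x))"
  by (rule L2_int_bounded[OF finite_measure_cube measurable_cnj_wal_vec, where B = 1]) (simp_all add: norm_wal_vec)

text \<open>Walsh functions have norm 1, so by Cauchy-Schwarz a coefficient changes by at most the
  distance of the functions.\<close>

lemma walsh_coeff_tendsto:
  assumes "b \<ge> 2" "\<And>n. L2_int (cube {1..s}) (F n)" "L2_int (cube {1..s}) f"
    and "(\<lambda>n. L2norm {1..s} (\<lambda>x. F n x - f x)) \<longlonglongrightarrow> 0"
  shows "(\<lambda>n. walsh_coeff b s (F n) h) \<longlonglongrightarrow> walsh_coeff b s f h"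
proof (rule LIM_zero_cancel, rule Lim_null_comparison[OF _ assms(4)], rule always_eventually, rule allI)
  fix n
  note w = L2_int_cnj_wal_vec[OF assms(1), of s h]
  have "walsh_coeff b s (F n) h - walsh_coeff b s f h
      = (LINT x|cube {1..s}. (F n x - f x) * cnj (wal_vec b s h x))"
    unfolding walsh_coeff_def left_diff_distrib
    by (rule Bochner_Integration.integral_diff[symmetric])
      (intro L2_Cauchy_Schwarz(1) assms w)+
  also have "cmod \<dots> \<le> L2_norm_on (cube {1..s}) (\<lambda>x. F n x - f x) * L2_norm_on (cube {1..s}) (\<lambda>x. cnj (wal_vec b s h x))"
    by (intro L2_Cauchy_Schwarz(3) L2_int_diff assms w)
  also have "L2_norm_on (cube {1..s}) (\<lambda>x. cnj (wal_vec b s h x)) = 1"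
    by (simp add: L2_norm_on_def norm_wal_vec[OF assms(1)] measure_cube space_cube)
  finally show "norm (walsh_coeff b s (F n) h - walsh_coeff b s f h) \<le> L2norm {1..s} (\<lambda>x. F n x - f x)"
    by (simp add: L2norm_eq)
qed

text \<open>A zero frequency contributes the constant factor 1, so its coordinate is merely
  integrated out. This is how the marginal enters the inequality.\<close>

lemma walsh_coeff_eq_marginal:
  assumes "b \<ge> 2" "continuous_on (cube_set {1..s}) F" "u \<subseteq> {1..s}" "\<And>i. i \<in> {1..s} - u \<Longrightarrow> h i = 0"
  shows "walsh_coeff b s F h = (LINT x|cube u. marginal s u F x * (\<Prod>j\<in>u. cnj (wal b (h j) (x j))))"
proof -
  let ?w = "{1..s} - u" let ?I = "\<lambda>x. F x * cnj (wal_vec b s h x)"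
  have Un: "u \<union> ?w = {1..s}" using assms(3) by auto
  have fin: "finite u" using assms(3) finite_subset by blast
  have int: "integrable (cube (u \<union> ?w)) ?I"
    unfolding Un by (intro L2_Cauchy_Schwarz(1) L2_int_cube_continuous L2_int_cnj_wal_vec assms) simp
  have "walsh_coeff b s F h = (LINT x|cube (u \<union> ?w). ?I x)"
    unfolding Un walsh_coeff_def ..
  also have "\<dots> = (LINT x|cube u. LINT y|cube ?w. ?I (merge u ?w (x, y)))"
    using fin int unfolding cube_def by (intro unit_product.product_integral_fold) auto
  also have "\<dots> = (LINT x|cube u. marginal s u F x * (\<Prod>j\<in>u. cnj (wal b (h j) (x j))))"
  proof (rule Bochner_Integration.integral_cong[OF refl])
    fix x
    have "cnj (wal_vec b s h (merge u ?w (x, y))) = (\<Prod>j\<in>u. cnj (wal b (h j) (x j)))" for y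
    proof -
      have "cnj (wal_vec b s h (merge u ?w (x, y))) = (\<Prod>j\<in>{1..s}. cnj (wal b (h j) (merge u ?w (x, y) j)))"
        by (simp add: wal_vec_def)
      also have "\<dots> = (\<Prod>j\<in>u. cnj (wal b (h j) (merge u ?w (x, y) j)))"
        using assms(3,4) by (intro prod.mono_neutral_right) (auto simp: wal_0)
      also have "\<dots> = (\<Prod>j\<in>u. cnj (wal b (h j) (x j)))"
        by (intro prod.cong) (auto simp: merge_def)
      finally show ?thesis .
    qed
    then show "(LINT y|cube ?w. ?I (merge u ?w (x, y))) = marginal s u F x * (\<Prod>j\<in>u. cnj (wal b (h j) (x j)))"
      by (simp add: marginal_def)
  qed
  finally show ?thesis .
qed

lemma walsh_coeff_sum_le:
  assumes "b \<ge> 2" "smooth_cube {1..s} F" "u \<subseteq> {1..s}"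
    and "\<And>i. i \<in> u \<Longrightarrow> finite (H i)"
    and "\<And>i. i \<in> u \<Longrightarrow> distinct (P i) \<and> length (P i) = \<nu> i"
    and "\<And>i p. i \<in> u \<Longrightarrow> p \<in> set (P i) \<Longrightarrow> p \<ge> 1 \<and> (\<forall>h\<in>H i. nat_digit b h (p - 1) \<noteq> 0)"
  shows "(\<Sum>h\<in>PiE u H. (cmod (walsh_coeff b s F (\<lambda>i. if i \<in> u then h i else 0)))\<^sup>2)
    \<le> (\<Prod>i\<in>u. \<Prod>p\<leftarrow>P i. 2 * (max_offset b p)\<^sup>2) * (L2norm u (mixed_deriv u \<nu> (marginal s u F)))\<^sup>2"
proof -
  have fin: "finite u" using assms(3) finite_subset by blast
  have set: "set (sorted_list_of_set u) = u" using fin by simp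
  have "walsh_coeff b s F (\<lambda>i. if i \<in> u then h i else 0)
      = (LINT x|cube u. marginal s u F x * (\<Prod>j\<in>u. cnj (wal b (h j) (x j))))" for h
    using walsh_coeff_eq_marginal[OF assms(1) smooth_cube_continuous[OF assms(2)] assms(3),
        of "\<lambda>i. if i \<in> u then h i else 0"]
    by (simp cong: prod.cong)
  then show ?thesis
    using wal_coeff_cube_sum_le[of b "sorted_list_of_set u" "marginal s u F" H P \<nu>, unfolded set]
      smooth_cube_marginal[OF assms(2,3)] assms
    by (simp add: L2norm_eq mixed_deriv_def)
qed

section \<open>Passage to the completion\<close>

lemma sobolev_norm_of_ge:
  "cmod c \<le> sobolev_norm_of s \<alpha> c N"
  "u \<subseteq> {1..s} \<Longrightarrow> u \<noteq> {} \<Longrightarrow> \<nu> \<in> (\<Pi>\<^sub>E i\<in>u. {1..\<alpha>}) \<Longrightarrow> N u \<nu> \<le> sobolev_norm_of s \<alpha> c N"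
proof -
  let ?U = "Pow {1..s} - {{}}" and ?S = "\<lambda>u. \<Sum>\<nu>\<in>(\<Pi>\<^sub>E i\<in>u. {1..\<alpha>}). (N u \<nu>)\<^sup>2"
  have S: "0 \<le> ?S u" for u by (intro sum_nonneg) auto
  show "cmod c \<le> sobolev_norm_of s \<alpha> c N"
    unfolding sobolev_norm_of_def using S by (intro real_le_rsqrt) (simp add: sum_nonneg)
  assume u: "u \<subseteq> {1..s}" "u \<noteq> {}" and \<nu>: "\<nu> \<in> (\<Pi>\<^sub>E i\<in>u. {1..\<alpha>})"
  have "finite u" using u finite_subset by blast
  then have "finite (\<Pi>\<^sub>E i\<in>u. {1..\<alpha>})" by (intro finite_PiE) auto
  then have "(N u \<nu>)\<^sup>2 \<le> ?S u"
    using \<nu> by (intro member_le_sum) auto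
  also have "\<dots> \<le> sum ?S ?U"
    using u S by (intro member_le_sum) auto
  finally show "N u \<nu> \<le> sobolev_norm_of s \<alpha> c N"
    unfolding sobolev_norm_of_def by (intro real_le_rsqrt) (simp add: add_increasing)
qed

text \<open>By linearity the norm of a difference controls the difference of the mixed derivatives,
  which are therefore Cauchy. Existence gives the choice in \<open>sobolev_deriv\<close> its
  meaning.\<close>

lemma sobolev_deriv_exists:
  assumes "represents s \<alpha> F f" "u \<subseteq> {1..s}" "u \<noteq> {}" "\<nu> \<in> (\<Pi>\<^sub>E i\<in>u. {1..\<alpha>})"
  shows "\<exists>g. square_int u g \<and>
    (\<lambda>n. L2norm u (\<lambda>x. mixed_deriv u \<nu> (marginal s u (F n)) x - g x)) \<longlonglongrightarrow> 0"
  unfolding square_int_eq L2norm_eq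
proof (rule L2_complete)
  have smooth: "smooth_cube {1..s} (F n)" for n
    using assms(1) by (simp add: represents_def smooth_on_cube_eq)
  show "finite_measure (cube u)"
    using assms(2) finite_subset by (intro finite_measure_cube) blast
  show "L2_int (cube u) (mixed_deriv u \<nu> (marginal s u (F n)))" for n
    by (rule L2_int_mixed_deriv[OF smooth assms(2)])
  fix e :: real assume "0 < e"
  then obtain M where M: "\<And>m n. m \<ge> M \<Longrightarrow> n \<ge> M \<Longrightarrow> smooth_norm s \<alpha> (\<lambda>x. F m x - F n x) < e"
    using assms(1) unfolding represents_def by blast
  have "L2_norm_on (cube u) (\<lambda>x. mixed_deriv u \<nu> (marginal s u (F m)) x - mixed_deriv u \<nu> (marginal s u (F n)) x)
      \<le> smooth_norm s \<alpha> (\<lambda>x. F m x - F n x)" for m n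
  proof -
    have "L2_norm_on (cube u) (\<lambda>x. mixed_deriv u \<nu> (marginal s u (F m)) x - mixed_deriv u \<nu> (marginal s u (F n)) x)
        = L2norm u (mixed_deriv u \<nu> (marginal s u (\<lambda>x. F m x - F n x)))"
      unfolding L2norm_eq
      by (intro L2_norm_on_cong) (simp add: space_cube mixed_deriv_marginal_diff[OF smooth smooth assms(2)])
    also have "\<dots> \<le> smooth_norm s \<alpha> (\<lambda>x. F m x - F n x)"
      unfolding smooth_norm_def by (rule sobolev_norm_of_ge(2)[OF assms(2-4)])
    finally show ?thesis .
  qed
  then show "\<exists>M. \<forall>m\<ge>M. \<forall>n\<ge>M. L2_norm_on (cube u)
      (\<lambda>x. mixed_deriv u \<nu> (marginal s u (F m)) x - mixed_deriv u \<nu> (marginal s u (F n)) x) < e"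
    using M by (intro exI[of _ M]) (meson le_less_trans)
qed

theorem sobolev_walsh_coeff_sum_le:
  assumes "b \<ge> 2" "f \<in> sobolev_space s \<alpha>" "u \<subseteq> {1..s}" "u \<noteq> {}" "\<nu> \<in> (\<Pi>\<^sub>E i\<in>u. {1..\<alpha>})"
    and "\<And>i. i \<in> u \<Longrightarrow> finite (H i)"
    and "\<And>i. i \<in> u \<Longrightarrow> distinct (P i) \<and> length (P i) = \<nu> i"
    and "\<And>i p. i \<in> u \<Longrightarrow> p \<in> set (P i) \<Longrightarrow> p \<ge> 1 \<and> (\<forall>h\<in>H i. nat_digit b h (p - 1) \<noteq> 0)"
  shows "(\<Sum>h\<in>PiE u H. (cmod (walsh_coeff b s f (\<lambda>i. if i \<in> u then h i else 0)))\<^sup>2)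
    \<le> (\<Prod>i\<in>u. \<Prod>p\<leftarrow>P i. 2 * (max_offset b p)\<^sup>2) * (deriv_norm s \<alpha> u \<nu> f)\<^sup>2"
proof -
  obtain F0 where f: "L2_int (cube {1..s}) f" "represents s \<alpha> F0 f"
    using assms(2) by (auto simp: sobolev_space_def square_int_eq)
  define g where "g = sobolev_deriv s \<alpha> u \<nu> f"
  have "\<exists>g. square_int u g \<and> (\<exists>F. represents s \<alpha> F f \<and>
      (\<lambda>n. L2norm u (\<lambda>x. mixed_deriv u \<nu> (marginal s u (F n)) x - g x)) \<longlonglongrightarrow> 0)"
    using sobolev_deriv_exists[OF f(2) assms(3-5)] f(2) by blast
  \<comment> \<open>The approximating sequence is the one attached to the chosen derivative
    \<open>g\<close>, so the norms of its derivatives tend to the norm of \<open>g\<close>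
    itself.\<close>
  from someI_ex[OF this] obtain F where g: "square_int u g" and F: "represents s \<alpha> F f"
    and lim: "(\<lambda>n. L2norm u (\<lambda>x. mixed_deriv u \<nu> (marginal s u (F n)) x - g x)) \<longlonglongrightarrow> 0"
    unfolding g_def sobolev_deriv_def by blast
  have smooth: "smooth_cube {1..s} (F n)" for n
    using F by (simp add: represents_def smooth_on_cube_eq)
  have norm: "(\<lambda>n. L2norm u (mixed_deriv u \<nu> (marginal s u (F n)))) \<longlonglongrightarrow> L2norm u g"
    using lim g unfolding L2norm_eq square_int_eq
    by (intro L2_norm_on_tendsto L2_int_mixed_deriv smooth assms(3))
  have coeff: "(\<lambda>n. walsh_coeff b s (F n) h) \<longlonglongrightarrow> walsh_coeff b s f h" for h
    using F by (intro walsh_coeff_tendsto assms(1) f(1) L2_int_cube_continuous smooth_cube_continuous smooth)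
      (auto simp: represents_def)
  have "(\<Sum>h\<in>PiE u H. (cmod (walsh_coeff b s f (\<lambda>i. if i \<in> u then h i else 0)))\<^sup>2)
      \<le> (\<Prod>i\<in>u. \<Prod>p\<leftarrow>P i. 2 * (max_offset b p)\<^sup>2) * (L2norm u g)\<^sup>2"
  proof (rule LIMSEQ_le)
    show "(\<lambda>n. \<Sum>h\<in>PiE u H. (cmod (walsh_coeff b s (F n) (\<lambda>i. if i \<in> u then h i else 0)))\<^sup>2)
        \<longlonglongrightarrow> (\<Sum>h\<in>PiE u H. (cmod (walsh_coeff b s f (\<lambda>i. if i \<in> u then h i else 0)))\<^sup>2)"
      by (intro tendsto_intros coeff)
    show "(\<lambda>n. (\<Prod>i\<in>u. \<Prod>p\<leftarrow>P i. 2 * (max_offset b p)\<^sup>2) * (L2norm u (mixed_deriv u \<nu> (marginal s u (F n))))\<^sup>2)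
        \<longlonglongrightarrow> (\<Prod>i\<in>u. \<Prod>p\<leftarrow>P i. 2 * (max_offset b p)\<^sup>2) * (L2norm u g)\<^sup>2"
      by (intro tendsto_intros norm)
    show "\<exists>N. \<forall>n\<ge>N. (\<Sum>h\<in>PiE u H. (cmod (walsh_coeff b s (F n) (\<lambda>i. if i \<in> u then h i else 0)))\<^sup>2)
        \<le> (\<Prod>i\<in>u. \<Prod>p\<leftarrow>P i. 2 * (max_offset b p)\<^sup>2) * (L2norm u (mixed_deriv u \<nu> (marginal s u (F n))))\<^sup>2"
      by (intro exI[of _ 0] allI impI, rule walsh_coeff_sum_le) (use assms smooth in auto)
  qed
  then show ?thesis
    using assms(4) by (simp add: deriv_norm_def g_def)
qed

section \<open>Interlaced frequencies\<close>

lemma nat_digit_sum: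
  assumes "b \<ge> 2" "\<And>n. c n < b"
  shows "nat_digit b (\<Sum>n<N. c n * b ^ n) m = (if m < N then c m else 0)"
  using assms(2)
proof (induction N arbitrary: c m)
  case (Suc N)
  have S: "(\<Sum>n<Suc N. c n * b ^ n) = c 0 + b * (\<Sum>n<N. c (Suc n) * b ^ n)"
    by (simp only: sum.lessThan_Suc_shift) (simp add: sum_distrib_left mult.left_commute)
  show ?case
  proof (cases m)
    case 0
    then show ?thesis
      using Suc.prems[of 0] by (simp only: S) (simp add: nat_digit_def)
  next
    case (Suc m')
    have "nat_digit b (\<Sum>n<Suc N. c n * b ^ n) m = nat_digit b (\<Sum>n<N. c (Suc n) * b ^ n) m'"
      using Suc.prems[of 0] assms(1) unfolding S Suc nat_digit_def by (simp add: div_mult2_eq)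
    then show ?thesis
      using Suc.IH[of "\<lambda>n. c (Suc n)" m'] Suc.prems Suc by simp
  qed
qed (simp add: nat_digit_def)

text \<open>The double sum over \<open>a\<close> and \<open>r\<close> is a single sum over the
  positions \<open>n = r - 1 + a * d\<close>, and digits of such a sum can be read off.\<close>

lemma nat_digit_interlace:
  assumes "b \<ge> 2" "d \<ge> 1"
  shows "nat_digit b (interlace b d k i) n = nat_digit b (k ((i - 1) * d + n mod d + 1)) (n div d)"
proof -
  define c where "c n = nat_digit b (k ((i - 1) * d + n mod d + 1)) (n div d)" for n
  \<comment> \<open>A common cutoff: every component is at most \<open>L\<close>, so none has a
    nonzero digit at an index \<open>a \<ge> L\<close>.\<close>
  define L where "L = (\<Sum>r\<in>{1..d}. k ((i - 1) * d + r))"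
  have zero: "nat_digit b (k ((i - 1) * d + r)) a = 0" if "a \<ge> L" "r \<in> {1..d}" for a r
  proof -
    have "k ((i - 1) * d + r) \<le> L"
      unfolding L_def using that(2) by (intro member_le_sum) auto
    then show ?thesis
      using that(1) assms(1) by (intro nat_digit_eq_0 less_power_base) auto
  qed
  have group: "(\<Sum>n\<in>{a * d..<a * d + d}. c n * b ^ n)
      = (\<Sum>r\<in>{1..d}. nat_digit b (k ((i - 1) * d + r)) a * b ^ (r - 1 + a * d))" for a
  proof (rule sum.reindex_bij_witness[where i = "\<lambda>r. a * d + (r - 1)" and j = "\<lambda>n. n - a * d + 1"])
    fix n assume n: "n \<in> {a * d..<a * d + d}"
    define r where "r = n - a * d"
    have r: "n = a * d + r" "r < d" using n by (auto simp: r_def)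
    have "n mod d = r" "n div d = a" using r assms(2) by simp_all
    then show "nat_digit b (k ((i - 1) * d + (n - a * d + 1))) a * b ^ (n - a * d + 1 - 1 + a * d) = c n * b ^ n"
      using r by (simp add: c_def add.assoc add.commute)
  qed auto
  have "interlace b d k i = (\<Sum>a<L. \<Sum>r\<in>{1..d}. nat_digit b (k ((i - 1) * d + r)) a * b ^ (r - 1 + a * d))"
    unfolding interlace_def
  proof (intro suminf_finite sum.neutral ballI)
    fix a r assume "a \<notin> {..<L}" "r \<in> {1..d}"
    then show "nat_digit b (k ((i - 1) * d + r)) a * b ^ (r - 1 + a * d) = 0"
      using zero[of a r] by simp
  qed simp
  also have "\<dots> = (\<Sum>a<L. \<Sum>n\<in>{a * d..<a * d + d}. c n * b ^ n)"
    by (simp only: group)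
  also have "\<dots> = (\<Sum>n<L * d. c n * b ^ n)"
    by (rule sum.nat_group)
  finally have "nat_digit b (interlace b d k i) n = (if n < L * d then c n else 0)"
    using assms(1) by (simp add: nat_digit_sum c_def nat_digit_less)
  also have "\<dots> = c n"
  proof (cases "n < L * d")
    case False
    then have "n div d \<ge> L"
      using assms(2) by (simp add: less_eq_div_iff_mult_less_eq)
    then show ?thesis
      using False zero[of "n div d" "n mod d + 1"] assms(2) by (auto simp: c_def Suc_le_eq)
  qed simp
  finally show ?thesis by (simp add: c_def)
qed

text \<open>Dividing by \<open>b ^ (l - 1)\<close> leaves a number from 1 to \<open>b - 1\<close>,
  unchanged by reduction modulo \<open>b\<close>.\<close>

lemma nat_digit_block:
  assumes "k \<in> block b l" "l > 0"
  shows "nat_digit b k (l - 1) \<noteq> 0"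
proof -
  have k: "b ^ (l - 1) \<le> k" "k < b ^ l" using assms by (auto simp: block_def)
  have l: "b ^ l = b * b ^ (l - 1)" using assms(2) by (simp add: power_eq_if)
  have b: "b > 0" using k(2) assms(2) by (cases "b = 0") (auto simp: zero_power)
  have "k div b ^ (l - 1) < b"
    using k l b by (simp add: less_mult_imp_div_less)
  moreover have "k div b ^ (l - 1) > 0"
    using k b by (simp add: div_greater_zero_iff)
  ultimately show ?thesis by (simp add: nat_digit_def)
qed

lemma finite_block: "finite (block b l)"
  by (rule finite_subset[of _ "{..b ^ l}"]) (auto simp: block_def)

lemma finite_block_vec: "finite (block_vec b n l)"
  unfolding block_vec_def by (intro finite_PiE finite_block) auto

lemma coordinate_in_range: "i \<in> {1..s} \<Longrightarrow> h \<in> {1..d} \<Longrightarrow> (i - 1) * d + h \<in> {1..d * s}" for i s h d :: nat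
proof -
  assume i: "i \<in> {1..s}" and h: "h \<in> {1..d}"
  have "(i - 1) * d + h \<le> (i - 1) * d + d" using h by simp
  also have "\<dots> = i * d" using i by (cases i) auto
  also have "\<dots> \<le> d * s" using i by simp
  finally show ?thesis using h by simp
qed

lemma K_atE:
  assumes "j \<in> K_at d s l i" "i \<ge> 1"
  obtains h where "h \<in> {1..d}" "j = (i - 1) * d + h" "j \<in> {1..d * s}" "l j > 0"
proof -
  have i: "i * d = (i - 1) * d + d" using assms(2) by (cases i) auto
  have j: "(i - 1) * d + 1 \<le> j" "j \<le> i * d" "j \<in> {1..d * s}" "l j > 0"
    using assms(1) by (auto simp: K_at_def K_all_def)
  show thesis
    by (rule that[of "j - (i - 1) * d"]) (use j i in auto)
qed

text \<open>The position of the digit of \<open>x\<^sub>i\<close> which the Walsh function pairs with the leading digit of \<open>k\<^sub>j\<close>.\<close>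

definition pivot :: "nat \<Rightarrow> (nat \<Rightarrow> nat) \<Rightarrow> nat \<Rightarrow> nat \<Rightarrow> nat" where
  "pivot d l i j = j - (i - 1) * d + (l j - 1) * d"

lemma max_offset_pivot: "max_offset b (pivot d l i j) = eta_prime b d l i j"
  by (simp add: max_offset_def pivot_def eta_prime_def Let_def)

lemma pivot_ge_1: "j \<in> K_at d s l i \<Longrightarrow> i \<ge> 1 \<Longrightarrow> pivot d l i j \<ge> 1"
  by (erule (1) K_atE) (auto simp: pivot_def)

lemma pivot_mod:
  assumes "j = (i - 1) * d + h" "h \<in> {1..d}"
  shows "(pivot d l i j - 1) mod d = h - 1" "(pivot d l i j - 1) div d = l j - 1"
proof -
  obtain e where e: "h = Suc e" using assms(2) by (cases h) auto
  have "pivot d l i j - 1 = e + (l j - 1) * d" "e < d"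
    using assms e by (simp_all add: pivot_def)
  then show "(pivot d l i j - 1) mod d = h - 1" "(pivot d l i j - 1) div d = l j - 1"
    using e by simp_all
qed

text \<open>Modulo \<open>d\<close> the position determines the place of \<open>j\<close> in its
  group, whatever the block lengths; so positions of different indices never collide.\<close>

lemma inj_on_pivot: "i \<ge> 1 \<Longrightarrow> inj_on (pivot d l i) (K_at d s l i)"
proof (rule inj_onI)
  fix j j' assume i: "i \<ge> 1" and j: "j \<in> K_at d s l i" "j' \<in> K_at d s l i" "pivot d l i j = pivot d l i j'"
  obtain h where h: "h \<in> {1..d}" "j = (i - 1) * d + h" using K_atE[OF j(1) i] by metis
  obtain h' where h': "h' \<in> {1..d}" "j' = (i - 1) * d + h'" using K_atE[OF j(2) i] by metis
  have "h - 1 = h' - 1"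
    using pivot_mod(1)[OF h(2,1), of l] pivot_mod(1)[OF h'(2,1), of l] j(3) by metis
  then show "j = j'" using h h' by auto
qed

text \<open>With \<open>h\<close> the place of \<open>j\<close> in its group, interlacing moves the
  leading digit of \<open>k j\<close>, of index \<open>l j - 1\<close>, to index
  \<open>h - 1 + (l j - 1) * d\<close>. This is the pivot minus 1, since digit index
  \<open>p - 1\<close> is paired with position \<open>p\<close>.\<close>

lemma nat_digit_pivot:
  assumes "b \<ge> 2" "j \<in> K_at d s l i" "i \<ge> 1" "k \<in> block_vec b (d * s) l"
  shows "nat_digit b (interlace b d k i) (pivot d l i j - 1) \<noteq> 0"
proof -
  obtain h where h: "h \<in> {1..d}" "j = (i - 1) * d + h" "j \<in> {1..d * s}" "l j > 0"
    using K_atE[OF assms(2,3)] .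
  have d: "d \<ge> 1" using h(1) by auto
  have "(i - 1) * d + (h - 1) + 1 = j" using h by auto
  then have "nat_digit b (interlace b d k i) (pivot d l i j - 1) = nat_digit b (k j) (l j - 1)"
    unfolding nat_digit_interlace[OF assms(1) d] pivot_mod[OF h(2,1)] by simp
  moreover have "k j \<in> block b (l j)"
    using assms(4) h(3) by (auto simp: block_vec_def)
  ultimately show ?thesis
    using nat_digit_block h(4) by simp
qed

lemma finite_K_at: "finite (K_at d s l i)"
  by (simp add: K_at_def K_all_def)

text \<open>The sorted list of numbers forgets the indices they came from, but the positions are
  needed; hence the indices themselves are sorted by \<open>eta_prime\<close> and the first
  \<open>r\<close> are taken.\<close>

lemma exists_pivot_list:
  assumes "i \<ge> 1" "r \<le> card (K_at d s l i)"
  shows "\<exists>ps. distinct ps \<and> length ps = r \<and> set ps \<subseteq> pivot d l i ` K_at d s l i \<and>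
    (\<Prod>p\<leftarrow>ps. max_offset b p) = (\<Prod>h\<in>{1..r}. eta_sorted b d s l i ! (h - 1))"
proof -
  let ?e = "eta_prime b d l i" and ?xs = "sorted_list_of_set (K_at d s l i)"
  define js where "js = sort_key ?e ?xs"
  have js: "distinct js" "set js = K_at d s l i" "length js = card (K_at d s l i)"
    using finite_K_at by (simp_all add: js_def)
  have sorted: "eta_sorted b d s l i = map ?e js"
    unfolding eta_sorted_def js_def by (rule properties_for_sort) simp_all
  define ps where "ps = map (pivot d l i) (take r js)"
  have "set (take r js) \<subseteq> K_at d s l i"
    using set_take_subset[of r js] js(2) by simp
  then have "distinct ps"
    unfolding ps_def using js(1) by (auto simp: distinct_map intro: inj_on_subset[OF inj_on_pivot[OF assms(1)]])
  moreover have len: "length ps = r"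
    using assms(2) js(3) by (simp add: ps_def)
  moreover have "set ps \<subseteq> pivot d l i ` K_at d s l i"
    unfolding ps_def using set_take_subset[of r js] js(2) by auto
  moreover have "(\<Prod>p\<leftarrow>ps. max_offset b p) = (\<Prod>h\<in>{1..r}. eta_sorted b d s l i ! (h - 1))"
  proof -
    have "(\<Prod>p\<leftarrow>ps. max_offset b p) = prod_list (take r (eta_sorted b d s l i))"
      by (simp add: ps_def sorted take_map o_def max_offset_pivot)
    also have "\<dots> = (\<Prod>h = 0..<r. eta_sorted b d s l i ! h)"
      using assms(2) js(3) by (simp add: prod.list_conv_set_nth sorted)
    also have "\<dots> = (\<Prod>h\<in>{1..r}. eta_sorted b d s l i ! (h - 1))"
      by (rule prod.reindex_bij_witness[where i = "\<lambda>h. h - 1" and j = Suc]) auto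
    finally show ?thesis .
  qed
  ultimately show ?thesis by blast
qed

lemma prod_list_square:
  "(\<Prod>p\<leftarrow>ps. 2 * (f p)\<^sup>2) = 2 ^ length ps * (\<Prod>p\<leftarrow>ps. f p :: real)\<^sup>2"
  by (induction ps) (simp_all add: power_mult_distrib)

section \<open>The image of a block under interlacing\<close>

lemma interlace_outside_v:
  assumes "b \<ge> 2" "d \<ge> 1" "k \<in> block_vec b (d * s) l" "i \<in> {1..s}" "i \<notin> v_set d s l"
  shows "interlace b d k i = 0"
proof (rule nat_digit_eqI[OF assms(1)])
  fix n
  let ?j = "(i - 1) * d + (n mod d + 1)"
  have h: "n mod d + 1 \<in> {1..d}" using assms(2) by (simp add: Suc_le_eq)
  have j: "?j \<in> {1..d * s}" by (rule coordinate_in_range[OF assms(4) h])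
  have "i * d = (i - 1) * d + d" using assms(4) by (cases i) auto
  then have "?j \<in> {(i - 1) * d + 1..i * d}" using h by auto
  moreover have "?j \<notin> K_at d s l i" using assms(4,5) by (auto simp: v_set_def)
  ultimately have "l ?j = 0" using j by (auto simp: K_at_def K_all_def)
  then have "k ?j = 0"
    using assms(3) j by (auto simp: block_vec_def block_def dest!: PiE_mem[of _ _ _ ?j])
  then show "nat_digit b (interlace b d k i) n = nat_digit b 0 n"
    by (simp only: nat_digit_interlace[OF assms(1,2)] add.assoc) (simp add: nat_digit_def)
qed

text \<open>All digits of \<open>k\<close> can be read off from the interlaced numbers, and those
  outside \<open>v_set\<close> are 0, so restricting to \<open>v_set\<close> loses nothing.\<close>

lemma inj_on_interlace:
  assumes "b \<ge> 2" "d \<ge> 1"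
  shows "inj_on (\<lambda>k. restrict (interlace b d k) (v_set d s l)) (block_vec b (d * s) l)"
proof (rule inj_onI)
  fix k k' assume k: "k \<in> block_vec b (d * s) l" "k' \<in> block_vec b (d * s) l"
    and eq: "restrict (interlace b d k) (v_set d s l) = restrict (interlace b d k') (v_set d s l)"
  have eq': "interlace b d k i = interlace b d k' i" if "i \<in> {1..s}" for i
    using fun_cong[OF eq, of i] interlace_outside_v[OF assms k(1) that] interlace_outside_v[OF assms k(2) that]
    by (cases "i \<in> v_set d s l") auto
  show "k = k'"
  proof (rule PiE_ext[OF k[unfolded block_vec_def]])
    fix j assume j: "j \<in> {1..d * s}"
    \<comment> \<open>\<open>j\<close> is the member number \<open>?r + 1\<close> of the group
      \<open>?i\<close>; its digit \<open>a\<close> sits at index \<open>?r + a * d\<close>.\<close>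
    let ?i = "(j - 1) div d + 1" and ?r = "(j - 1) mod d"
    have "(j - 1) div d < s"
      using j by (intro less_mult_imp_div_less) (auto simp: mult.commute)
    then have i: "?i \<in> {1..s}" by auto
    have j_eq: "(?i - 1) * d + ?r + 1 = j"
      using j div_mult_mod_eq[of "j - 1" d] by auto
    show "k j = k' j"
    proof (rule nat_digit_eqI[OF assms(1)])
      fix a
      have "(?r + a * d) mod d = ?r" "(?r + a * d) div d = a"
        using assms(2) by auto
      then have "nat_digit b (interlace b d k0 ?i) (?r + a * d) = nat_digit b (k0 j) a" for k0
        unfolding nat_digit_interlace[OF assms] using j_eq by simp
      then show "nat_digit b (k j) a = nat_digit b (k' j) a"
        using eq'[OF i] by metis
    qed
  qed
qed

text \<open>The coordinate induction requires a product of frequency sets. The image of the block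
  lies in the product of its projections \<open>H i\<close>, and this inclusion is enough because
  the terms are nonnegative.\<close>

lemma block_sum_le:
  fixes b d s :: nat and l :: "nat \<Rightarrow> nat"
  assumes "b \<ge> 2" "d \<ge> 1"
  defines "u \<equiv> v_set d s l" and "H \<equiv> (\<lambda>i. (\<lambda>k. interlace b d k i) ` block_vec b (d * s) l)"
  shows "(\<Sum>k\<in>block_vec b (d * s) l. (cmod (walsh_coeff b s f (interlace b d k)))\<^sup>2)
    \<le> (\<Sum>h\<in>PiE u H. (cmod (walsh_coeff b s f (\<lambda>i. if i \<in> u then h i else 0)))\<^sup>2)"
proof -
  let ?B = "block_vec b (d * s) l" and ?\<Phi> = "\<lambda>k. restrict (interlace b d k) u"
  let ?W = "\<lambda>h. (cmod (walsh_coeff b s f (\<lambda>i. if i \<in> u then h i else 0)))\<^sup>2"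
  have "walsh_coeff b s f (interlace b d k) = walsh_coeff b s f (\<lambda>i. if i \<in> u then ?\<Phi> k i else 0)"
    if "k \<in> ?B" for k
  proof -
    have "interlace b d k i = (if i \<in> u then ?\<Phi> k i else 0)" if i: "i \<in> {1..s}" for i
      using interlace_outside_v[OF assms(1,2) \<open>k \<in> ?B\<close> i] by (auto simp: u_def)
    then have "wal_vec b s (interlace b d k) x = wal_vec b s (\<lambda>i. if i \<in> u then ?\<Phi> k i else 0) x" for x
      unfolding wal_vec_def by (intro prod.cong refl) metis
    then show ?thesis
      unfolding walsh_coeff_def by simp
  qed
  then have "(\<Sum>k\<in>?B. (cmod (walsh_coeff b s f (interlace b d k)))\<^sup>2) = (\<Sum>k\<in>?B. ?W (?\<Phi> k))"
    by (intro sum.cong refl arg_cong[where f = "\<lambda>z. (cmod z)\<^sup>2"])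
  also have "\<dots> = sum ?W (?\<Phi> ` ?B)"
    using sum.reindex[OF inj_on_interlace[OF assms(1,2), of s l, folded u_def], of ?W] by (simp only: o_def)
  also have "\<dots> \<le> sum ?W (PiE u H)"
  proof (rule sum_mono2)
    have "finite u" by (simp add: u_def v_set_def)
    then show "finite (PiE u H)"
      unfolding H_def using finite_block_vec by (intro finite_PiE) auto
    show "?\<Phi> ` ?B \<subseteq> PiE u H"
      by (auto simp: H_def)
  qed auto
  finally show ?thesis .
qed

section \<open>Constants and the final estimate\<close>

lemma v_set_subset: "v_set d s l \<subseteq> {1..s}"
  by (auto simp: v_set_def)

lemma card_K_at_le: "i \<ge> 1 \<Longrightarrow> card (K_at d s l i) \<le> d"
proof -
  assume "i \<ge> 1"
  then have "i * d = (i - 1) * d + d" by (cases i) auto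
  moreover have "card (K_at d s l i) \<le> card {(i - 1) * d + 1..i * d}"
    by (intro card_mono) (auto simp: K_at_def)
  ultimately show ?thesis by simp
qed

lemma sum_card_K_at_le: "(\<Sum>i\<in>v_set d s l. card (K_at d s l i)) \<le> card (K_all d s l)"
proof -
  have disj: "K_at d s l i \<inter> K_at d s l i' = {}" if "i < i'" for i i'
  proof -
    have le: "i * d \<le> (i' - 1) * d" using that by (intro mult_right_mono) auto
    have "x \<notin> K_at d s l i'" if "x \<in> K_at d s l i" for x
    proof
      assume "x \<in> K_at d s l i'"
      then have "(i' - 1) * d + 1 \<le> x" "x \<le> i * d"
        using that by (simp_all add: K_at_def)
      then show False using le by linarith
    qed
    then show ?thesis by blast
  qed
  have "(\<Sum>i\<in>v_set d s l. card (K_at d s l i)) = card (\<Union>i\<in>v_set d s l. K_at d s l i)"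
    using disj by (intro card_UN_disjoint[symmetric]) (auto simp: finite_K_at v_set_def neq_iff Int_commute)
  also have "\<dots> \<le> card (K_all d s l)"
    by (intro card_mono) (auto simp: K_all_def K_at_def)
  finally show ?thesis .
qed

lemma r_vec_eq: "i \<in> v_set d s l \<Longrightarrow> r_vec \<alpha> d s l i = min \<alpha> (card (K_at d s l i))"
  by (simp add: r_vec_def)

lemma r_vec_in: "\<alpha> \<ge> 1 \<Longrightarrow> r_vec \<alpha> d s l \<in> (\<Pi>\<^sub>E i\<in>v_set d s l. {1..\<alpha>})"
  by (auto simp: r_vec_def v_set_def Suc_le_eq card_gt_0_iff finite_K_at)

lemma q_exp_le: "q_exp \<alpha> d s l \<le> s * nat (max (int d - int \<alpha>) 0)"
proof -
  have "q_exp \<alpha> d s l \<le> (\<Sum>i\<in>v_set d s l. d - \<alpha>)"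
    unfolding q_exp_def
  proof (rule sum_mono)
    fix i assume i: "i \<in> v_set d s l"
    then have "card (K_at d s l i) \<le> d"
      by (intro card_K_at_le) (auto simp: v_set_def)
    then show "card (K_at d s l i) - r_vec \<alpha> d s l i \<le> d - \<alpha>"
      using r_vec_eq[OF i, of \<alpha>] by linarith
  qed
  also have "\<dots> \<le> s * (d - \<alpha>)"
    using card_mono[OF _ v_set_subset[of d s l]] by simp
  also have "d - \<alpha> = nat (max (int d - int \<alpha>) 0)" by linarith
  finally show ?thesis .
qed

lemma eta_prod_nonneg:
  assumes "b \<ge> 2"
  shows "0 \<le> eta_prod \<alpha> b d s l"
  unfolding eta_prod_def
proof (intro prod_nonneg ballI)
  fix i h assume i: "i \<in> v_set d s l" and h: "h \<in> {1..r_vec \<alpha> d s l i}"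
  have "h - 1 < length (eta_sorted b d s l i)"
    using h r_vec_eq[OF i, of \<alpha>] finite_K_at[of d s l i] by (auto simp: eta_sorted_def)
  then have "eta_sorted b d s l i ! (h - 1) \<in> set (eta_sorted b d s l i)"
    by (rule nth_mem)
  then show "0 \<le> eta_sorted b d s l i ! (h - 1)"
    using assms by (auto simp: eta_sorted_def eta_prime_def Let_def)
qed

lemma deriv_norm_nonneg: "0 \<le> deriv_norm s \<alpha> u \<nu> f"
  by (simp add: deriv_norm_def L2norm_eq)

lemma deriv_norm_le_sobolev_norm:
  "u \<subseteq> {1..s} \<Longrightarrow> \<nu> \<in> (\<Pi>\<^sub>E i\<in>u. {1..\<alpha>}) \<Longrightarrow> deriv_norm s \<alpha> u \<nu> f \<le> sobolev_norm s \<alpha> f"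
proof (cases "u = {}")
  case True
  then show ?thesis
    unfolding sobolev_norm_def by (simp add: deriv_norm_def sobolev_norm_of_ge(1))
next
  case False
  assume "u \<subseteq> {1..s}" "\<nu> \<in> (\<Pi>\<^sub>E i\<in>u. {1..\<alpha>})"
  then show ?thesis
    unfolding sobolev_norm_def using False
    by (intro sobolev_norm_of_ge(2)[where N = "\<lambda>u \<nu>. deriv_norm s \<alpha> u \<nu> f"])
qed

theorem block_sigma_le:
  assumes "b \<ge> 2" "d \<ge> 1" "\<alpha> \<ge> 1" "f \<in> sobolev_space s \<alpha>"
  shows "block_sigma b d l s f \<le> 2 ^ q_exp \<alpha> d s l * real b ^ card (K_all d s l) * eta_prod \<alpha> b d s l
    * deriv_norm s \<alpha> (v_set d s l) (r_vec \<alpha> d s l) f"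
proof -
  define u where "u = v_set d s l"
  define r where "r = r_vec \<alpha> d s l"
  define H where "H = (\<lambda>i. (\<lambda>k. interlace b d k i) ` block_vec b (d * s) l)"
  let ?N = "deriv_norm s \<alpha> u r f" and ?\<eta> = "eta_prod \<alpha> b d s l"
  have i1: "i \<ge> 1" if "i \<in> u" for i
    using that by (auto simp: u_def v_set_def)
  have "\<forall>i\<in>u. \<exists>ps. distinct ps \<and> length ps = r i \<and> set ps \<subseteq> pivot d l i ` K_at d s l i \<and>
      (\<Prod>p\<leftarrow>ps. max_offset b p) = (\<Prod>h\<in>{1..r i}. eta_sorted b d s l i ! (h - 1))"
    by (intro ballI exists_pivot_list i1) (auto simp: r_def u_def r_vec_eq)
  then obtain P where P: "\<And>i. i \<in> u \<Longrightarrow> distinct (P i) \<and> length (P i) = r i \<and> set (P i) \<subseteq> pivot d l i ` K_at d s l i \<and>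
      (\<Prod>p\<leftarrow>P i. max_offset b p) = (\<Prod>h\<in>{1..r i}. eta_sorted b d s l i ! (h - 1))"
    unfolding bchoice_iff by blast
  have prod: "(\<Prod>i\<in>u. \<Prod>p\<leftarrow>P i. 2 * (max_offset b p)\<^sup>2) = 2 ^ (\<Sum>i\<in>u. r i) * ?\<eta>\<^sup>2"
  proof -
    have "(\<Prod>i\<in>u. \<Prod>p\<leftarrow>P i. 2 * (max_offset b p)\<^sup>2)
        = (\<Prod>i\<in>u. 2 ^ r i * (\<Prod>h\<in>{1..r i}. eta_sorted b d s l i ! (h - 1))\<^sup>2)"
      using P by (intro prod.cong refl) (simp add: prod_list_square)
    also have "\<dots> = 2 ^ (\<Sum>i\<in>u. r i) * ?\<eta>\<^sup>2"
      by (simp add: prod.distrib power_sum prod_power_distrib eta_prod_def u_def r_def)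
    finally show ?thesis .
  qed
  have main: "(\<Sum>h\<in>PiE u H. (cmod (walsh_coeff b s f (\<lambda>i. if i \<in> u then h i else 0)))\<^sup>2)
      \<le> (\<Prod>i\<in>u. \<Prod>p\<leftarrow>P i. 2 * (max_offset b p)\<^sup>2) * ?N\<^sup>2"
  proof (cases "u = {}")
    case True
    \<comment> \<open>The only frequency is 0, with coefficient \<open>I(f)\<close>, and the product
      in front is empty.\<close>
    then show ?thesis
      by (simp add: walsh_coeff_def wal_vec_def wal_0 deriv_norm_def cube_integral_def)
  next
    case False
    show ?thesis
    proof (rule sobolev_walsh_coeff_sum_le[OF assms(1,4) _ False])
      show "u \<subseteq> {1..s}" "r \<in> (\<Pi>\<^sub>E i\<in>u. {1..\<alpha>})"
        using v_set_subset r_vec_in[OF assms(3)] by (simp_all add: u_def r_def)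
      fix i assume i: "i \<in> u"
      show "finite (H i)" by (simp add: H_def finite_block_vec)
      show "distinct (P i) \<and> length (P i) = r i" using P[OF i] by simp
      fix p assume "p \<in> set (P i)"
      then obtain j where "j \<in> K_at d s l i" "p = pivot d l i j" using P[OF i] by auto
      then show "p \<ge> 1 \<and> (\<forall>h\<in>H i. nat_digit b h (p - 1) \<noteq> 0)"
        using pivot_ge_1[OF _ i1[OF i]] nat_digit_pivot[OF assms(1) _ i1[OF i]] by (auto simp: H_def)
    qed
  qed
  \<comment> \<open>The inequality is proved for squares, so the factors 2 must fit into the square
    of the final constant. Each index of \<open>K_all\<close> offers a factor
    \<open>b \<ge> 2\<close>, and the constant, being at least 1, is at most its square.\<close>
  have "(\<Sum>i\<in>u. r i) \<le> (\<Sum>i\<in>u. card (K_at d s l i))"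
    by (intro sum_mono) (simp add: u_def r_def r_vec_eq)
  also have "\<dots> \<le> card (K_all d s l)"
    unfolding u_def by (rule sum_card_K_at_le)
  finally have "(2::real) ^ (\<Sum>i\<in>u. r i) \<le> 2 ^ card (K_all d s l)"
    by (intro power_increasing) auto
  also have "\<dots> \<le> real b ^ card (K_all d s l)"
    using assms(1) by (intro power_mono) auto
  also have "\<dots> \<le> 2 ^ q_exp \<alpha> d s l * real b ^ card (K_all d s l)"
    using mult_right_mono[of 1 "2 ^ q_exp \<alpha> d s l" "real b ^ card (K_all d s l)"] by simp
  also have "\<dots> \<le> (2 ^ q_exp \<alpha> d s l * real b ^ card (K_all d s l))\<^sup>2"
  proof -
    have "1 * 1 \<le> 2 ^ q_exp \<alpha> d s l * real b ^ card (K_all d s l)"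
      using assms(1) by (intro mult_mono one_le_power) auto
    then show ?thesis by (simp add: self_le_power)
  qed
  finally have const: "(2::real) ^ (\<Sum>i\<in>u. r i) \<le> (2 ^ q_exp \<alpha> d s l * real b ^ card (K_all d s l))\<^sup>2" .
  have "(\<Sum>k\<in>block_vec b (d * s) l. (cmod (walsh_coeff b s f (interlace b d k)))\<^sup>2)
      \<le> 2 ^ (\<Sum>i\<in>u. r i) * ?\<eta>\<^sup>2 * ?N\<^sup>2"
    using order_trans[OF block_sum_le[OF assms(1,2), where s = s and l = l and f = f, folded u_def H_def] main] by (simp only: prod)
  also have "\<dots> \<le> (2 ^ q_exp \<alpha> d s l * real b ^ card (K_all d s l))\<^sup>2 * ?\<eta>\<^sup>2 * ?N\<^sup>2"
    by (intro mult_right_mono const) auto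
  also have "\<dots> = (2 ^ q_exp \<alpha> d s l * real b ^ card (K_all d s l) * ?\<eta> * ?N)\<^sup>2"
    by (simp add: power_mult_distrib)
  finally show ?thesis
    unfolding block_sigma_def u_def[symmetric] r_def[symmetric]
    by (rule real_le_lsqrt[rotated])
      (intro mult_nonneg_nonneg eta_prod_nonneg deriv_norm_nonneg assms(1), auto)
qed

theorem lemma5p2:
  fixes b s d \<alpha> :: nat and l :: "nat \<Rightarrow> nat" and f :: "(nat \<Rightarrow> real) \<Rightarrow> complex"
  assumes "prime b" and "s \<ge> 1" and "d \<ge> 1" and "\<alpha> \<ge> 1"
    and "f \<in> sobolev_space s \<alpha>"
  shows "block_sigma b d l s f
           \<le> 2 ^ q_exp \<alpha> d s l * real b ^ card (K_all d s l) * eta_prod \<alpha> b d s l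
             * deriv_norm s \<alpha> (v_set d s l) (r_vec \<alpha> d s l) f
       \<and> block_sigma b d l s f
           \<le> 2 ^ (s * nat (max (int d - int \<alpha>) 0)) * real b ^ (d * s) * eta_prod \<alpha> b d s l
             * sobolev_norm s \<alpha> f"
proof
  have b: "b \<ge> 2" by (rule prime_ge_2_nat[OF assms(1)])
  show first: "block_sigma b d l s f
      \<le> 2 ^ q_exp \<alpha> d s l * real b ^ card (K_all d s l) * eta_prod \<alpha> b d s l
        * deriv_norm s \<alpha> (v_set d s l) (r_vec \<alpha> d s l) f"
    by (rule block_sigma_le[OF b assms(3-5)])
  have "card (K_all d s l) \<le> card {1..d * s}"
    by (intro card_mono) (auto simp: K_all_def)
  then have card: "card (K_all d s l) \<le> d * s" by simp
  have "2 ^ q_exp \<alpha> d s l * real b ^ card (K_all d s l) * eta_prod \<alpha> b d s l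
        * deriv_norm s \<alpha> (v_set d s l) (r_vec \<alpha> d s l) f
      \<le> 2 ^ (s * nat (max (int d - int \<alpha>) 0)) * real b ^ (d * s) * eta_prod \<alpha> b d s l * sobolev_norm s \<alpha> f"
    by (intro mult_mono power_increasing q_exp_le card order_refl mult_nonneg_nonneg zero_le_power
        eta_prod_nonneg[OF b] deriv_norm_nonneg deriv_norm_le_sobolev_norm v_set_subset r_vec_in assms(4))
      (use b in auto)
  then show "block_sigma b d l s f
      \<le> 2 ^ (s * nat (max (int d - int \<alpha>) 0)) * real b ^ (d * s) * eta_prod \<alpha> b d s l * sobolev_norm s \<alpha> f"
    using first by linarith
qed

end
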